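(* Consider the coherent real 1-bit MIMO channel with $n_t\ge 1$ transmit antennas and $n_r$ receive antennas, and fix $\mathsf{snr}>0$. As $n_r\to\infty$ (with $n_t$ and $\mathsf{snr}$ fixed), its capacity satisfies $$C=\frac{n_t}{2}\log\frac{n_r}{2\pi e}+\log \mathrm{Vol}(\mathcal{B}_{n_t})+\log\alpha_{\mathsf{snr},n_t}+o(1),$$ where $$\alpha_{\mathsf{snr},n_t}:=\int_0^{\sqrt{\mathsf{snr}}}\zeta_0(r)^{\frac{n_t-1}{2}}\zeta_2(r)^{\frac12}\,n_t\,r^{n_t-1}\,dr .$$ Moreover, the asymptotically optimal input distribution (Jeffreys' prior, i.e. the density on $\sqrt{\mathsf{snr}}\,\mathcal{B}_{n_t}$ proportional to the square root of the determinant of the Fisher information matrix of the family $\{p(y,\mathbf{h}\mid\mathbf{x})\}$) is isotropic (rotation invariant), and the magnitude $\|\mathbf{x}\|$ has density $$p_{\|\mathbf{x}\|}(r)\propto \zeta_0(r)^{\frac{n_t-1}{2}}\zeta_2(r)^{\frac12}r^{n_t-1},\qquad r\in[0,\sqrt{\mathsf{snr}}].$$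
   Context: Coherent channel: for one channel use, the input is $\mathbf{x}\in\sqrt{\mathsf{snr}}\,\mathcal{B}_{n_t}$, where $\mathcal{B}_n:=\{\mathbf{x}\in\mathbb{R}^n:\|\mathbf{x}\|\le 1\}$ (peak power constraint), and the output is $\mathbf{y}=\mathrm{sign}(\mathbf{H}\mathbf{x}+\mathbf{z})\in\{-1,1\}^{n_r}$ (sign applied componentwise), where $\mathbf{H}\in\mathbb{R}^{n_r\times n_t}$ and $\mathbf{z}\in\mathbb{R}^{n_r}$ have i.i.d. $\mathcal{N}(0,1)$ entries, independent of each other and of $\mathbf{x}$; $\mathbf{H}$ is known to the receiver. The capacity is $C=\sup I(\mathbf{x};\mathbf{y},\mathbf{H})$ (bits, $\log$ is base 2), the supremum over distributions of $\mathbf{x}$ on $\sqrt{\mathsf{snr}}\,\mathcal{B}_{n_t}$. Per receive antenna the channel is the joint density $p(y,\mathbf{h}\mid\mathbf{x})=p(\mathbf{h})\,Q(-y\,\mathbf{h}^{\mathsf T}\mathbf{x})$, $y\in\{-1,1\}$, $\mathbf{h}\sim\mathcal{N}(0,\mathbf{I}_{n_t})$. Here $\phi(t)=\frac{1}{\sqrt{2\pi}}e^{-t^2/2}$, $Q(x)=\int_x^\infty\phi(t)dt$, $\xi(s):=\frac{\phi^2(s)}{Q(s)(1-Q(s))}$, and $\zeta_k(t):=\mathbb{E}[S^k\xi(tS)]$ for $S\sim\mathcal{N}(0,1)$, $k\in\mathbb{Z}$. $\mathrm{Vol}(\mathcal{B}_{n})=\pi^{n/2}/\Gamma(n/2+1)$.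 *)

theory Defs
  imports "HOL-Probability.Probability"
begin

definition phi :: "real \<Rightarrow> real" where
  "phi t = exp (- (t^2) / 2) / sqrt (2 * pi)"

definition Qfun :: "real \<Rightarrow> real" where
  "Qfun x = (\<integral>t. indicator {x..} t * phi t \<partial>lborel)"

definition xi :: "real \<Rightarrow> real" where
  "xi s = (phi s)^2 / (Qfun s * (1 - Qfun s))"

definition zeta :: "int \<Rightarrow> real \<Rightarrow> real" where
  "zeta k t = (\<integral>s. (s powi k) * xi (t * s) * phi s \<partial>lborel)"

definition gauss_vec :: "(real^'n::finite) measure" where
  "gauss_vec = density lborel
     (\<lambda>h. ennreal ((2 * pi) powr (- (real CARD('n)) / 2) * exp (- ((norm h)^2) / 2)))"

definition outputs :: "nat \<Rightarrow> (nat \<Rightarrow> real) set" where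
  "outputs nr = PiE {..<nr} (\<lambda>_. {-1, 1})"

definition chan_prob :: "nat \<Rightarrow> (nat \<Rightarrow> real) \<Rightarrow> (nat \<Rightarrow> real^'n::finite) \<Rightarrow> real^'n \<Rightarrow> real" where
  "chan_prob nr y H x = (\<Prod>i<nr. Qfun (- y i * (H i \<bullet> x)))"

definition chan_H :: "nat \<Rightarrow> (nat \<Rightarrow> real^'n::finite) measure" where
  "chan_H nr = PiM {..<nr} (\<lambda>_. gauss_vec)"

text \<open>Mutual information I(x; y, H) in bits for input distribution mu
  (H independent of x and known at the receiver; p(H) cancels in the ratio).\<close>
definition mutual_info :: "nat \<Rightarrow> (real^'n::finite) measure \<Rightarrow> real" where
  "mutual_info nr mu =
     (\<integral>H. (\<integral>x. (\<Sum>y\<in>outputs nr.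
          chan_prob nr y H x *
          log 2 (chan_prob nr y H x / (\<integral>x'. chan_prob nr y H x' \<partial>mu))) \<partial>mu)
      \<partial>chan_H nr)"

definition input_dists :: "real \<Rightarrow> (real^'n::finite) measure set" where
  "input_dists snr = {mu. prob_space mu \<and> sets mu = sets borel \<and>
                          (AE x in mu. norm x \<le> sqrt snr)}"

definition capacity :: "'n::finite itself \<Rightarrow> nat \<Rightarrow> real \<Rightarrow> real" where
  "capacity _ nr snr = (SUP mu \<in> (input_dists snr :: (real^'n) measure set). mutual_info nr mu)"

definition vol_ball :: "nat \<Rightarrow> real" where
  "vol_ball n = pi powr (real n / 2) / Gamma (real n / 2 + 1)"

definition alpha :: "real \<Rightarrow> nat \<Rightarrow> real" where
  "alpha snr n = (\<integral>r\<in>{0..sqrt snr}.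
      zeta 0 r powr ((real n - 1) / 2) * zeta 2 r powr (1/2) * real n * r ^ (n - 1) \<partial>lborel)"

text \<open>Partial derivative in direction x_i of the log-likelihood ln p(y,h|x)
  = ln p(h) + ln Q(-y h^T x); the term ln p(h) does not depend on x.\<close>
definition score :: "real \<Rightarrow> real^'n::finite \<Rightarrow> real^'n \<Rightarrow> 'n \<Rightarrow> real" where
  "score y h x i = deriv (\<lambda>t. ln (Qfun (- y * (h \<bullet> (x + t *\<^sub>R axis i 1))))) 0"

definition fisher :: "real^'n::finite \<Rightarrow> real^'n^'n" where
  "fisher x = (\<chi> i j. (\<integral>h. (\<Sum>y\<in>{-1, 1::real}.
       Qfun (- y * (h \<bullet> x)) * score y h x i * score y h x j) \<partial>gauss_vec))"

definition jeffreys_density :: "real \<Rightarrow> real^'n::finite \<Rightarrow> real" where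
  "jeffreys_density snr x =
     indicator (cball 0 (sqrt snr)) x * sqrt (det (fisher x)) /
     (\<integral>x'\<in>cball 0 (sqrt snr). sqrt (det (fisher (x' :: real^'n))) \<partial>lborel)"

definition jeffreys :: "real \<Rightarrow> (real^'n::finite) measure" where
  "jeffreys snr = density lborel (\<lambda>x. ennreal (jeffreys_density snr x))"

definition mag_weight :: "nat \<Rightarrow> real \<Rightarrow> real" where
  "mag_weight n r = zeta 0 r powr ((real n - 1) / 2) * zeta 2 r powr (1/2) * r ^ (n - 1)"

definition mag_density :: "real \<Rightarrow> nat \<Rightarrow> real \<Rightarrow> real" where
  "mag_density snr n r = indicator {0..sqrt snr} r * mag_weight n r /
     (\<integral>s\<in>{0..sqrt snr}. mag_weight n s \<partial>lborel)"

end

theory Submission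
  imports Defs
begin

text \<open>
  Multiplying every channel row by its output sign folds \<open>(y, H)\<close> into \<open>N\<close> independent vectors with density
  \<open>2 \<Phi>(k\<^sup>T x)\<close> relative to the standard Gaussian, and the mutual information is the average divergence
  of this product law from its mixture over the input. By Gibbs' inequality, replacing the mixture by that of
  any other input law gives an upper bound.

  Lower bound: the input is Jeffreys' prior and \<open>S\<close> is the whitened normalised score at \<open>x\<close>, so
  \<open>E\<^sub>x |S|\<^sup>2 = n\<close>. Jensen's inequality gives \<open>KL \<ge> - n/2 - ln (E\<^sub>m\<^sub>i\<^sub>x exp (-|S|\<^sup>2/2))\<close>. At distance of order
  \<open>N\<^sup>-\<^sup>1\<^sup>/\<^sup>2\<close> from \<open>x\<close> the law of \<open>S\<close> converges to a shifted Gaussian (by characteristic functions), further away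
  \<open>E exp (-|S|\<^sup>2/2)\<close> decays exponentially (Chernoff), and dominated convergence yields the constant.

  Upper bound: the comparison mixture is Jeffreys' prior of a slightly larger ball, so that no boundary effect
  occurs; Laplace's method with a third-order Taylor expansion bounds it from below uniformly in the input.
  Finally the radius of the larger ball tends to \<open>\<surd>snr\<close>.
\<close>

subsection \<open>The Gaussian tail function and the Mills ratio\<close>

text \<open>The two bounds need opposite controls of the mixture. For the lower bound it must not be
  too large, which involves all inputs at once; testing it only with the bounded quantity
  \<open>exp (-|S|^2/2)\<close> replaces pointwise control of the likelihood by an expectation that
  can be bounded factor by factor over the antennas. Asymptotically this test loses nothing: in the
  Gaussian limit the logarithm of the ratio of the true law to the mixture is
  \<open>-|S|^2/2\<close> up to a constant.

  For the upper bound the mixture must not be too small, and the inputs within distance of order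
  \<open>M / sqrt N\<close> of \<open>x\<close> already carry enough mass. Near the boundary sphere
  a part of this neighbourhood leaves the support of the prior, hence the larger ball. In the lower
  bound the sphere is harmless, being a null set of the prior.

  Jeffreys' prior enters because the Jacobian of whitening at \<open>x\<close> is the reciprocal of
  the square root of the Fisher determinant: it cancels the prior density and leaves a constant
  independent of \<open>x\<close>. The number \<open>2 * pi * exp 1\<close> collects the Gaussian
  mass \<open>(2 * pi) powr (n/2)\<close> and the summand \<open>-n/2\<close>.\<close>

lemma phi_eq_std_normal_density: "phi = std_normal_density"
  by (rule ext) (simp add: phi_def std_normal_density_def)

lemma phi_pos [simp]: "phi t > 0"
  by (simp add: phi_def)

lemma phi_nonneg [simp]: "phi t \<ge> 0"
  using phi_pos[of t] by linarith

lemma phi_minus [simp]: "phi (- t) = phi t"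
  by (simp add: phi_def)

lemma phi_measurable [measurable]: "phi \<in> borel_measurable borel"
  unfolding phi_def by measurable

lemma integrable_phi [simp]: "integrable lborel phi"
  using integrable_std_normal_moment[of 0] by (simp add: phi_eq_std_normal_density)

lemma integral_phi: "(\<integral>t. phi t \<partial>lborel) = 1"
  using integral_std_normal_moment_even[of 0] by (simp add: phi_eq_std_normal_density)

lemma continuous_on_phi: "continuous_on A phi"
  unfolding phi_def by (intro continuous_intros) auto

lemma DERIV_phi: "(phi has_real_derivative - t * phi t) (at t)"
  unfolding phi_def by (auto intro!: derivative_eq_intros simp: field_simps power2_eq_square)

lemma phi_le_1: "phi t \<le> 1"
proof -
  have "exp (- (t^2) / 2) \<le> 1" by simp
  moreover have "sqrt (2 * pi) \<ge> 1" using pi_gt3 by (simp add: real_le_rsqrt)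
  ultimately show ?thesis unfolding phi_def using pi_gt_zero
    by (smt (verit, best) divide_le_eq_1)
qed

lemma phi_mono: "\<bar>s\<bar> \<le> \<bar>t\<bar> \<Longrightarrow> phi t \<le> phi s"
  unfolding phi_def by (intro divide_right_mono) (auto simp: abs_le_square_iff)

lemma Qfun_altdef: "Qfun x = (LINT t:{x..}|lborel. phi t)"
  by (simp add: Qfun_def set_lebesgue_integral_def)

lemma set_integrable_phi: "A \<in> sets borel \<Longrightarrow> set_integrable lborel A phi"
  unfolding set_integrable_def using integrable_mult_indicator[of A lborel phi] by simp

lemma Qfun_diff:
  assumes "a \<le> b"
  shows "Qfun a - Qfun b = integral {a..b} phi"
proof -
  have "Qfun a = (LINT t:{a..<b} \<union> {b..}|lborel. phi t)"
    unfolding Qfun_altdef using assms by (simp add: ivl_disj_un)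
  also have "\<dots> = (LINT t:{a..<b}|lborel. phi t) + Qfun b"
    unfolding Qfun_altdef by (rule set_integral_Un) (auto intro: set_integrable_phi)
  also have "(LINT t:{a..<b}|lborel. phi t) = (LINT t:{a..b}|lborel. phi t)"
    unfolding set_lebesgue_integral_def
    by (rule integral_cong_AE, measurable) (use AE_lborel_singleton[of b] in \<open>eventually_elim, auto split: split_indicator\<close>)
  also have "\<dots> = integral {a..b} phi"
    by (rule set_borel_integral_eq_integral) (auto intro: set_integrable_phi)
  finally show ?thesis by simp
qed

lemma DERIV_Qfun: "(Qfun has_real_derivative - phi x) (at x)"
proof -
  have "((\<lambda>u. integral {x - 1..u} phi) has_real_derivative phi x) (at x within {x - 1..x + 1})"
    by (rule integral_has_real_derivative) (auto intro: continuous_on_phi)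
  then have "((\<lambda>u. integral {x - 1..u} phi) has_real_derivative phi x) (at x)"
    by (subst (asm) at_within_interior) auto
  then have "((\<lambda>u. Qfun (x - 1) - integral {x - 1..u} phi) has_real_derivative - phi x) (at x)"
    by (auto intro!: derivative_eq_intros)
  then show ?thesis
  proof (rule has_field_derivative_transform_within_open)
    show "open {x - 1<..}" "x \<in> {x - 1<..}" by auto
    fix u assume "u \<in> {x - 1<..}"
    then show "Qfun (x - 1) - integral {x - 1..u} phi = Qfun u"
      using Qfun_diff[of "x - 1" u] by simp
  qed
qed

lemma Qfun_minus: "Qfun (- x) = 1 - Qfun x"
proof -
  have "Qfun (- x) = (\<integral>t. indicator {- x..} t * phi t \<partial>lborel)" by (simp add: Qfun_def)
  also have "\<dots> = (\<integral>t. indicator {- x..} (- t) * phi (- t) \<partial>lborel)"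
    using lborel_integral_real_affine[of "-1" "\<lambda>t. indicator {- x..} t * phi t" 0] by simp
  also have "\<dots> = (\<integral>t. indicator {..x} t * phi t \<partial>lborel)"
    by (intro Bochner_Integration.integral_cong) (auto split: split_indicator)
  also have "\<dots> = (LINT t:{..<x}|lborel. phi t)"
    unfolding set_lebesgue_integral_def real_scaleR_def
    by (rule integral_cong_AE, measurable) (use AE_lborel_singleton[of x] in \<open>eventually_elim, auto split: split_indicator\<close>)
  finally have 1: "Qfun (- x) = (LINT t:{..<x}|lborel. phi t)" .
  have "(LINT t:{..<x} \<union> {x..}|lborel. phi t) = (LINT t:{..<x}|lborel. phi t) + Qfun x"
    unfolding Qfun_altdef by (rule set_integral_Un) (auto intro: set_integrable_phi)
  moreover have "{..<x} \<union> {x..} = UNIV" by auto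
  ultimately show ?thesis using 1 integral_phi by (simp add: set_lebesgue_integral_def)
qed

lemma Qfun_strict_antimono: "a < b \<Longrightarrow> Qfun b < Qfun a"
  using DERIV_neg_imp_decreasing[of a b Qfun] DERIV_Qfun phi_pos by (metis neg_less_0_iff_less)

lemma Qfun_nonneg: "Qfun x \<ge> 0"
  unfolding Qfun_def by (intro integral_nonneg_AE) (auto)

lemma Qfun_pos: "Qfun x > 0"
  using Qfun_strict_antimono[of x "x + 1"] Qfun_nonneg[of "x + 1"] by linarith

text \<open>By \<open>Qfun_minus\<close> this is the standard normal distribution function; it
  removes the minus signs from the channel law.\<close>

definition Phi :: "real \<Rightarrow> real" where "Phi t = Qfun (- t)"

lemma Phi_minus: "Phi (- t) = 1 - Phi t"
  by (simp add: Phi_def Qfun_minus)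

lemma Phi_pos [simp]: "Phi t > 0" by (simp add: Phi_def Qfun_pos)

lemma Phi_nonneg [simp]: "Phi t \<ge> 0" using Phi_pos[of t] by linarith

lemma Phi_ne_0 [simp]: "Phi t \<noteq> 0" using Phi_pos[of t] by linarith

lemma Phi_less_1 [simp]: "Phi t < 1" using Phi_pos[of "- t"] by (simp only: Phi_minus)

lemma Phi_le_1 [simp]: "Phi t \<le> 1" using Phi_less_1[of t] by linarith

lemma Phi_strict_mono: "a < b \<Longrightarrow> Phi a < Phi b"
  by (simp add: Phi_def Qfun_strict_antimono)

lemma Phi_mono: "a \<le> b \<Longrightarrow> Phi a \<le> Phi b"
  using Phi_strict_mono[of a b] by (cases "a = b") auto

lemma Phi_0 [simp]: "Phi 0 = 1 / 2" using Phi_minus[of 0] by simp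

lemma DERIV_Phi: "(Phi has_real_derivative phi t) (at t)"
proof -
  have "((\<lambda>t. Qfun (- t)) has_real_derivative (- phi (- t) * - 1)) (at t)"
    by (rule DERIV_chain2[OF DERIV_Qfun]) (auto intro!: derivative_eq_intros)
  then show ?thesis by (simp add: Phi_def[abs_def])
qed

lemma continuous_on_Phi: "continuous_on A Phi"
  by (meson DERIV_Phi DERIV_isCont continuous_at_imp_continuous_on)

lemma Phi_measurable [measurable]: "Phi \<in> borel_measurable borel"
  by (intro borel_measurable_continuous_onI continuous_on_Phi)

text \<open>The mean value theorem, with \<open>phi\<close> decreasing in the absolute value of its
  argument. Both the Mills bound and the drift of the score rest on it.\<close>

lemma Phi_increment_ge:
  assumes "a \<le> b" "\<bar>a\<bar> \<le> c" "\<bar>b\<bar> \<le> c"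
  shows "Phi b - Phi a \<ge> (b - a) * phi c"
proof (cases "a = b")
  case False
  with assms have "a < b" by simp
  then obtain z where z: "a < z" "z < b" "Phi b - Phi a = (b - a) * phi z"
    using MVT2[of a b Phi phi] DERIV_Phi by blast
  have "phi c \<le> phi z" by (rule phi_mono) (use z assms in auto)
  then show ?thesis using z \<open>a < b\<close> by (simp add: mult_left_mono)
qed simp

lemma Phi_product_le: "Phi t * (1 - Phi t) \<le> 1 / 4"
proof -
  have "0 \<le> (Phi t - 1/2)^2" by simp
  then show ?thesis by (simp add: power2_eq_square algebra_simps)
qed

text \<open>The derivative of \<open>ln (Phi t)\<close>, an inverse Mills ratio. It is the scalar
  part of the score of one folded observation.\<close>

definition mills :: "real \<Rightarrow> real" where "mills t = phi t / Phi t"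

lemma mills_pos [simp]: "mills t > 0" by (simp add: mills_def)

lemma mills_nonneg [simp]: "mills t \<ge> 0" using mills_pos[of t] by linarith

text \<open>For \<open>t < 0\<close> the mass of \<open>[-1/(1-t), 0] + t\<close> alone already gives the right order.\<close>
lemma mills_le: "mills t \<le> 8 * (1 + \<bar>t\<bar>)"
proof (cases "t \<ge> 0")
  case True
  then have "Phi t \<ge> 1/2" using Phi_mono[of 0 t] by simp
  then have "mills t \<le> 1 / (1/2)" unfolding mills_def using phi_le_1 by (intro frac_le) auto
  with True show ?thesis by simp
next
  case False
  define s where "s = - t"
  have s: "s > 0" using False by (simp add: s_def)
  define d where "d = 1 / (s + 1)"
  have d: "0 < d" "d \<le> 1" "s * d \<le> 1" using s by (auto simp: d_def field_simps)
  have "Phi t \<ge> Phi t - Phi (t - d)" by simp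
  also have "Phi t - Phi (t - d) \<ge> (t - (t - d)) * phi (s + d)"
    by (rule Phi_increment_ge) (use d s in \<open>auto simp: s_def\<close>)
  finally have 1: "Phi t \<ge> d * phi (s + d)" by simp
  \<comment> \<open>Since \<open>s * d \<le> 1\<close> and \<open>d \<le> 1\<close>, enlarging
    \<open>s\<close> by \<open>d\<close> costs \<open>phi\<close> at most the factor
    \<open>exp (3/2)\<close>, which is below 8 because its square is below 27.\<close>
  have "(s + d)^2 / 2 \<le> s^2 / 2 + 3/2"
    using d mult_mono[of d 1 d 1] by (simp add: power2_eq_square algebra_simps)
  then have "exp (- (s^2) / 2 + - (3/2)) \<le> exp (- ((s + d)^2) / 2)" by simp
  then have "exp (- (s^2) / 2) * exp (- (3/2)) \<le> exp (- ((s + d)^2) / 2)"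
    by (subst (asm) exp_add)
  then have 2: "phi s * exp (- (3/2)) \<le> phi (s + d)"
    unfolding phi_def times_divide_eq_left by (intro divide_right_mono) auto
  have e: "exp (3/2) \<le> (8::real)"
  proof -
    have "exp (3/2::real) ^ 2 = exp 3" by (simp add: power2_eq_square flip: exp_add)
    also have "exp 3 = exp (1::real) ^ 3" by (simp add: power3_eq_cube flip: exp_add)
    also have "\<dots> \<le> 3 ^ 3" using exp_le by (intro power_mono) auto
    also have "\<dots> \<le> (8::real)^2" by simp
    finally show ?thesis by (rule power2_le_imp_le) simp
  qed
  have "phi t = exp (3/2) * (phi s * exp (- (3/2)))"
  proof -
    have "exp (3/2) * exp (- (3/2)) = (1::real)" by (simp flip: exp_add)
    then have "exp (3/2) * (phi s * exp (- (3/2))) = phi s" by (metis mult.commute mult.left_commute mult_1_right)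
    then show ?thesis by (simp add: s_def)
  qed
  also have "\<dots> \<le> exp (3/2) * phi (s + d)" using 2 by simp
  also have "\<dots> \<le> 8 * phi (s + d)" by (rule mult_right_mono[OF e]) simp
  also have "\<dots> = 8 * (1 + s) * (d * phi (s + d))" using s by (simp add: d_def field_simps)
  also have "\<dots> \<le> 8 * (1 + s) * Phi t" using 1 s by (intro mult_left_mono) auto
  finally show ?thesis using s unfolding mills_def s_def by (simp add: divide_le_eq)
qed

lemma DERIV_ln_Phi: "((\<lambda>t. ln (Phi t)) has_real_derivative mills t) (at t)"
  unfolding mills_def by (auto intro!: derivative_eq_intros DERIV_Phi)

lemma DERIV_mills: "(mills has_real_derivative - mills t * (t + mills t)) (at t)"
  unfolding mills_def[abs_def]
  by (auto intro!: derivative_eq_intros DERIV_Phi DERIV_phi simp: field_simps power2_eq_square)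

text \<open>Minus the second derivative of \<open>ln (Phi t)\<close>, that is, the observed
  information of one folded sample along its own direction.\<close>

definition curv :: "real \<Rightarrow> real" where "curv t = mills t * (t + mills t)"

lemma DERIV_curv:
  "(curv has_real_derivative (mills t - curv t * (t + 2 * mills t))) (at t)"
  unfolding curv_def[abs_def]
  by (auto intro!: derivative_eq_intros DERIV_mills simp: algebra_simps)

lemma curv_abs_le: "\<bar>curv t\<bar> \<le> 72 * (1 + \<bar>t\<bar>)^2"
proof -
  have "\<bar>curv t\<bar> = mills t * \<bar>t + mills t\<bar>" by (simp add: curv_def abs_mult)
  also have "\<dots> \<le> (8 * (1 + \<bar>t\<bar>)) * (9 * (1 + \<bar>t\<bar>))"
    using mills_le[of t] mills_nonneg[of t] abs_triangle_ineq[of t "mills t"] by (intro mult_mono) auto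
  also have "\<dots> = 72 * (1 + \<bar>t\<bar>)^2" by (simp add: power2_eq_square algebra_simps)
  finally show ?thesis .
qed

text \<open>The third derivative of \<open>ln (Phi t)\<close>, up to sign, grows at most cubically,
  so Taylor remainders have finite Gaussian expectation. The constant is 8 + 72 * 17.\<close>

lemma curv_deriv_abs_le: "\<bar>mills t - curv t * (t + 2 * mills t)\<bar> \<le> 1232 * (1 + \<bar>t\<bar>)^3"
proof -
  have "\<bar>mills t - curv t * (t + 2 * mills t)\<bar> \<le> \<bar>mills t\<bar> + \<bar>curv t\<bar> * \<bar>t + 2 * mills t\<bar>"
    unfolding abs_mult[symmetric] by linarith
  also have "\<dots> \<le> 8 * (1 + \<bar>t\<bar>)^3 + (72 * (1 + \<bar>t\<bar>)^2) * (17 * (1 + \<bar>t\<bar>))"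
  proof (intro add_mono mult_mono)
    have "(1 + \<bar>t\<bar>)^1 \<le> (1 + \<bar>t\<bar>)^3" by (rule power_increasing) auto
    then show "\<bar>mills t\<bar> \<le> 8 * (1 + \<bar>t\<bar>)^3" using mills_le[of t] by simp
    show "\<bar>t + 2 * mills t\<bar> \<le> 17 * (1 + \<bar>t\<bar>)" 
      using mills_le[of t] mills_nonneg[of t] abs_triangle_ineq[of t "2 * mills t"] by simp
  qed (auto intro: curv_abs_le)
  also have "\<dots> = 1232 * (1 + \<bar>t\<bar>)^3" by (simp add: power2_eq_square power3_eq_cube algebra_simps)
  finally show ?thesis .
qed

text \<open>The linear growth of \<open>mills\<close> is fed into the mean value theorem on the
  interval from 0 to t. Quadratic growth makes log-likelihoods integrable under the
  Gaussian.\<close>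

lemma ln_Phi_abs_le: "\<bar>ln (Phi t)\<bar> \<le> 9 * (1 + \<bar>t\<bar>)^2"
proof -
  have l2: "\<bar>ln (1/2::real)\<bar> \<le> 1" using ln_2_less_1 by (simp add: ln_div)
  have "\<exists>z. \<bar>z\<bar> \<le> \<bar>t\<bar> \<and> ln (Phi t) - ln (Phi 0) = t * mills z"
  proof (cases "t = 0")
    case True then show ?thesis by (intro exI[of _ 0]) simp
  next
    case False
    show ?thesis
    proof (cases "t > 0")
      case True
      obtain z where "0 < z" "z < t" "ln (Phi t) - ln (Phi 0) = (t - 0) * mills z"
        using MVT2[OF True, of "\<lambda>t. ln (Phi t)" mills] DERIV_ln_Phi by blast
      then show ?thesis by (intro exI[of _ z]) auto
    next
      case F: False
      with False have "t < 0" by simp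
      obtain z where "t < z" "z < 0" "ln (Phi 0) - ln (Phi t) = (0 - t) * mills z"
        using MVT2[OF \<open>t < 0\<close>, of "\<lambda>t. ln (Phi t)" mills] DERIV_ln_Phi by blast
      then show ?thesis by (intro exI[of _ z]) auto
    qed
  qed
  then obtain z where z: "\<bar>z\<bar> \<le> \<bar>t\<bar>" "ln (Phi t) - ln (Phi 0) = t * mills z" by blast
  have "\<bar>t * mills z\<bar> = \<bar>t\<bar> * mills z" by (simp add: abs_mult)
  then have "\<bar>ln (Phi t)\<bar> \<le> 1 + \<bar>t\<bar> * mills z"
    using z(2) l2 unfolding Phi_0 by linarith
  also have "\<dots> \<le> 1 + \<bar>t\<bar> * (8 * (1 + \<bar>t\<bar>))"
    using mills_le[of z] z(1) by (intro add_left_mono mult_left_mono) auto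
  also have "\<dots> \<le> 9 * (1 + \<bar>t\<bar>)^2"
  proof -
    have "1 + a * (8 * (1 + a)) \<le> 9 * (1 + a)^2" if "a \<ge> 0" for a :: real
    proof -
      have "a * a \<ge> 0" by simp
      then show ?thesis using that unfolding power2_eq_square by (simp add: algebra_simps)
    qed
    then show ?thesis by simp
  qed
  finally show ?thesis .
qed

text \<open>The Lagrange remainder of order three, with its factor 1/6 given away. The estimate is
  uniform for arguments in [-c, c]; later c is a multiple of the norm of the channel vector.\<close>

lemma ln_Phi_taylor:
  assumes "\<bar>a\<bar> \<le> c" "\<bar>b\<bar> \<le> c"
  shows "\<bar>ln (Phi b) - ln (Phi a) - mills a * (b - a) + curv a * (b - a)^2 / 2\<bar>
           \<le> 1232 * (1 + c)^3 * \<bar>b - a\<bar>^3"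
proof (cases "a = b")
  case False
  define diff where "diff m = (if m = 0 then (\<lambda>t. ln (Phi t)) else if m = 1 then mills
      else if m = 2 then (\<lambda>t. - curv t) else (\<lambda>t. - (mills t - curv t * (t + 2 * mills t))))" for m :: nat
  have D: "\<forall>m t. m < 3 \<and> min a b \<le> t \<and> t \<le> max a b \<longrightarrow> (diff m has_real_derivative diff (Suc m) t) (at t)"
  proof (intro allI impI)
    fix m :: nat and t :: real
    assume "m < 3 \<and> min a b \<le> t \<and> t \<le> max a b"
    then consider "m = 0" | "m = 1" | "m = 2" by linarith
    then show "(diff m has_real_derivative diff (Suc m) t) (at t)"
    proof cases
      case 1 then show ?thesis using DERIV_ln_Phi by (simp add: diff_def)
    next
      case 2 then show ?thesis using DERIV_mills[of t] by (simp add: diff_def curv_def)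
    next
      case 3 then show ?thesis using DERIV_minus[OF DERIV_curv[of t]] by (simp add: diff_def)
    qed
  qed
  have "\<exists>t. (if b < a then b < t \<and> t < a else a < t \<and> t < b) \<and>
      ln (Phi b) = (\<Sum>m<3. diff m a / fact m * (b - a)^m) + diff 3 t / fact 3 * (b - a)^3"
    by (rule Taylor[where a = "min a b" and b = "max a b" and n = 3, OF _ _ D]) (use False in \<open>auto simp: diff_def\<close>)
  then obtain t where t: "if b < a then b < t \<and> t < a else a < t \<and> t < b"
    "ln (Phi b) = (\<Sum>m<3. diff m a / fact m * (b - a)^m) + diff 3 t / fact 3 * (b - a)^3" by blast
  have tc: "\<bar>t\<bar> \<le> c" using t(1) assms by (auto split: if_splits)
  have "ln (Phi b) - ln (Phi a) - mills a * (b - a) + curv a * (b - a)^2 / 2 = diff 3 t / 6 * (b - a)^3"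
    using t(2) by (simp add: diff_def eval_nat_numeral fact_numeral)
  also have "\<bar>\<dots>\<bar> = \<bar>mills t - curv t * (t + 2 * mills t)\<bar> / 6 * \<bar>b - a\<bar>^3"
    by (simp add: diff_def abs_mult power_abs abs_minus_commute)
  also have "\<dots> \<le> 1232 * (1 + c)^3 * \<bar>b - a\<bar>^3"
  proof (intro mult_right_mono)
    have gen: "X / 6 \<le> 1232 * q" if "X \<le> 1232 * p" "p \<le> q" "0 \<le> p" for X p q :: real
      using that by linarith
    have "(1 + \<bar>t\<bar>)^3 \<le> (1 + c)^3" using tc by (intro power_mono) auto
    then show "\<bar>mills t - curv t * (t + 2 * mills t)\<bar> / 6 \<le> 1232 * (1 + c)^3"
      by (rule gen[OF curv_deriv_abs_le]) auto
  qed auto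
  finally show ?thesis .
qed simp

lemma continuous_on_mills: "continuous_on A mills"
  by (meson DERIV_mills DERIV_isCont continuous_at_imp_continuous_on)

lemma mills_measurable [measurable]: "mills \<in> borel_measurable borel"
  by (intro borel_measurable_continuous_onI continuous_on_mills)

lemma curv_measurable [measurable]: "curv \<in> borel_measurable borel"
  unfolding curv_def[abs_def] by measurable

section \<open>The function xi and its growth\<close>

lemma xi_altdef: "xi s = (phi s)^2 / (Phi s * (1 - Phi s))"
  using Qfun_minus[of s] by (simp add: xi_def Phi_def mult.commute)

text \<open>As a product of two Mills ratios, \<open>xi\<close> inherits positivity, continuity and
  quadratic growth.\<close>

lemma xi_eq_mills: "xi s = mills s * mills (- s)"
  by (simp add: xi_altdef mills_def Phi_minus power2_eq_square)

lemma xi_pos [simp]: "xi s > 0" by (simp add: xi_eq_mills)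

lemma xi_nonneg [simp]: "xi s \<ge> 0" using xi_pos[of s] by linarith

lemma xi_le: "xi s \<le> 64 * (1 + \<bar>s\<bar>)^2"
proof -
  have "xi s \<le> (8 * (1 + \<bar>s\<bar>)) * (8 * (1 + \<bar>-s\<bar>))"
    unfolding xi_eq_mills using mills_le[of s] mills_le[of "-s"] by (intro mult_mono) auto
  also have "\<dots> = 64 * (1 + \<bar>s\<bar>)^2" by (simp add: power2_eq_square algebra_simps)
  finally show ?thesis .
qed

lemma continuous_on_xi: "continuous_on A xi"
  unfolding xi_eq_mills[abs_def]
  by (intro continuous_intros continuous_on_compose2[OF continuous_on_mills[of UNIV]]) auto

lemma xi_measurable [measurable]: "xi \<in> borel_measurable borel"
  by (intro borel_measurable_continuous_onI continuous_on_xi)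

subsection \<open>Lebesgue measure under linear maps\<close>

lemma orthogonal_transformation_measurable:
  fixes T :: "'a::euclidean_space \<Rightarrow> 'a"
  assumes "orthogonal_transformation T"
  shows "T \<in> borel_measurable borel"
  using assms by (intro borel_measurable_continuous_onI linear_continuous_on)
    (simp add: linear_conv_bounded_linear[symmetric] orthogonal_transformation_linear)

lemma orthogonal_transformation_inv_simps:
  fixes T :: "'a::euclidean_space \<Rightarrow> 'a"
  assumes "orthogonal_transformation T"
  shows "T (inv T x) = x" "inv T (T y) = y"
proof -
  have b: "bij T"
    using orthogonal_transformation_inj[OF assms] orthogonal_transformation_surj[OF assms] by (rule bijI)
  show 1: "T (inv T x) = x" for x using b by (simp add: bij_is_surj surj_f_inv_f)
  show 2: "inv T (T y) = y" for y using b by (simp add: bij_is_inj)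
qed

text \<open>An isometry permutes balls of equal radius, and by Vitali every open set is a disjoint union
  of balls up to a null set.\<close>
lemma lborel_distr_orthogonal:
  fixes T :: "'a::euclidean_space \<Rightarrow> 'a"
  assumes T: "orthogonal_transformation T"
  shows "distr lborel borel T = lborel"
proof (rule sym, rule measure_eqI_generator_eq)
  note [measurable] = orthogonal_transformation_measurable[OF T]
  note Ti = orthogonal_transformation_inv_simps[OF T]
  let ?E = "Collect open :: 'a set set"
  show "Int_stable ?E" by (auto simp: Int_stable_def)
  show "?E \<subseteq> Pow UNIV" "sets lborel = sigma_sets UNIV ?E" "sets (distr lborel borel T) = sigma_sets UNIV ?E"
    by (simp_all add: borel_def)
  let ?A = "\<lambda>i::nat. ball (0::'a) (real i)"
  show "range ?A \<subseteq> ?E" by auto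
  show "(\<Union>i. ?A i) = UNIV" using reals_Archimedean2 by auto
  show "emeasure lborel (?A i) \<noteq> \<infinity>" for i by (simp add: emeasure_ball)
  fix U :: "'a set" assume "U \<in> ?E"
  then have U: "open U" by simp
  define K where "K = {(a, r). r > 0 \<and> ball a r \<subseteq> U}"
  have "\<exists>i. i \<in> K \<and> x \<in> ball (fst i) (snd i) \<and> snd i < d" if x: "x \<in> U" and d: "0 < d" for x d
  proof -
    obtain e where e: "e > 0" "ball x e \<subseteq> U" using U x by (meson openE)
    show ?thesis
      using e d by (intro exI[of _ "(x, min e (d/2))"]) (auto simp: K_def)
  qed
  from Vitali_covering_theorem_balls[OF this]
  obtain C where C: "countable C" "C \<subseteq> K"
     "pairwise (\<lambda>i j. disjnt (ball (fst i) (snd i)) (ball (fst j) (snd j))) C"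
     "negligible (U - (\<Union>i \<in> C. ball (fst i) (snd i)))" by blast
  define W where "W = (\<Union>i \<in> C. ball (fst i) (snd i))"
  have WU: "W \<subseteq> U" using C(2) by (force simp: W_def K_def)
  have Wb [measurable]: "W \<in> sets borel" unfolding W_def by (intro borel_open open_UN) auto
  have Ub [measurable]: "U \<in> sets borel" using U by simp
  have disj: "disjoint_family_on (\<lambda>i. ball (fst i) (snd i)) C"
    using C(3) by (auto simp: disjoint_family_on_def pairwise_def disjnt_def)
  have null: "U - W \<in> null_sets lborel"
    using C(4) unfolding W_def[symmetric] negligible_iff_null_sets
    by (subst (asm) null_sets_completion_iff) auto
  \<comment> \<open>Preimages are rewritten as images under \<open>inv T\<close> because
    differentiable images of negligible sets are negligible; this shows that the part of
    \<open>U\<close> missed by the balls also has a null preimage.\<close>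
  have Tset: "T -` X = inv T ` X" for X
    by (auto simp: Ti image_iff intro!: exI[of _ "T _"]) (metis Ti(2))
  have "negligible (inv T ` (U - W))"
    by (rule negligible_differentiable_image_negligible)
      (use C(4) orthogonal_transformation_inv[OF T] in \<open>auto simp: W_def intro!: linear_imp_differentiable_on orthogonal_transformation_linear\<close>)
  then have null': "T -` (U - W) \<in> null_sets lborel"
    unfolding Tset[symmetric] negligible_iff_null_sets
    by (subst (asm) null_sets_completion_iff) (auto simp: measurable_sets_borel[OF orthogonal_transformation_measurable[OF T]])
  have ball: "T -` ball a r = ball (inv T a) r" for a r
  proof -
    have "dist a (T x) = dist (inv T a) x" for x
      using T by (metis Ti(1) orthogonal_transformation_isometry)
    then show ?thesis by (auto simp: mem_ball)
  qed
  have "emeasure lborel U = emeasure lborel (W \<union> (U - W))" using WU by (simp add: Un_absorb1)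
  also have "\<dots> = emeasure lborel W" using null by (intro emeasure_Un_null_set) auto
  also have "\<dots> = (\<integral>\<^sup>+i. emeasure lborel (ball (fst i) (snd i)) \<partial>count_space C)"
    unfolding W_def by (rule emeasure_UN_countable) (use C disj in auto)
  also have "\<dots> = (\<integral>\<^sup>+i. emeasure lborel (T -` ball (fst i) (snd i)) \<partial>count_space C)"
    using C(2) by (intro nn_integral_cong) (auto simp: ball emeasure_ball K_def)
  also have "\<dots> = emeasure lborel (\<Union>i\<in>C. T -` ball (fst i) (snd i))"
  proof (rule emeasure_UN_countable[symmetric])
    show "disjoint_family_on (\<lambda>i. T -` ball (fst i) (snd i)) C"
      using disj unfolding disjoint_family_on_def vimage_Int[symmetric] by simp
  qed (use C in \<open>auto simp: ball\<close>)
  also have "(\<Union>i\<in>C. T -` ball (fst i) (snd i)) = T -` W" by (auto simp: W_def)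
  also have "emeasure lborel (T -` W) = emeasure lborel (T -` W \<union> T -` (U - W))"
    using null' by (intro emeasure_Un_null_set[symmetric]) (auto simp: measurable_sets_borel[OF orthogonal_transformation_measurable[OF T]])
  also have "T -` W \<union> T -` (U - W) = T -` U" using WU by auto
  finally show "emeasure lborel U = emeasure (distr lborel borel T) U"
    by (simp add: emeasure_distr)
qed

lemma nn_integral_lborel_orthogonal:
  fixes T :: "'a::euclidean_space \<Rightarrow> 'a"
  assumes "orthogonal_transformation T" and [measurable]: "f \<in> borel_measurable borel"
  shows "(\<integral>\<^sup>+x. f (T x) \<partial>lborel) = (\<integral>\<^sup>+x. f x \<partial>lborel)"
proof -
  note [measurable] = orthogonal_transformation_measurable[OF assms(1)]
  show ?thesis
    by (subst (2) lborel_distr_orthogonal[OF assms(1), symmetric]) (simp add: nn_integral_distr)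
qed

text \<open>The product formula over \<open>Basis\<close>, reindexed along the bijection between
  coordinates and the vectors \<open>axis i 1\<close>; \<open>ix\<close> is its inverse.\<close>

lemma nn_integral_lborel_cart_prod:
  fixes f :: "'n::finite \<Rightarrow> real \<Rightarrow> ennreal"
  assumes [measurable]: "\<And>i. f i \<in> borel_measurable borel"
  shows "(\<integral>\<^sup>+(x::real^'n). (\<Prod>i\<in>UNIV. f i (x $ i)) \<partial>lborel) = (\<Prod>i\<in>UNIV. (\<integral>\<^sup>+t. f i t \<partial>lborel))"
proof -
  define ix where "ix b = (THE i. b = axis i (1::real))" for b :: "real^'n"
  have ix: "ix (axis i 1) = i" for i by (auto simp: ix_def axis_eq_axis)
  have bij: "bij_betw (\<lambda>i. axis i (1::real) :: real^'n) UNIV Basis"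
    by (auto simp: bij_betw_def inj_on_def axis_eq_axis Basis_vec_def)
  have "(\<integral>\<^sup>+(x::real^'n). (\<Prod>b\<in>Basis. f (ix b) (x \<bullet> b)) \<partial>lborel) = (\<Prod>b\<in>Basis. (\<integral>\<^sup>+t. f (ix b) t \<partial>lborel))"
    by (rule nn_integral_lborel_prod) auto
  then show ?thesis
    by (simp add: prod.reindex_bij_betw[OF bij, symmetric] ix inner_axis)
qed

definition dil :: "('n \<Rightarrow> real) \<Rightarrow> real^'n \<Rightarrow> real^'n" where
  "dil c x = (\<chi> i. c i * x $ i)"

lemma dil_nth [simp]: "dil c x $ i = c i * x $ i" by (simp add: dil_def)

lemma dil_measurable [measurable]: "dil c \<in> borel_measurable (borel :: (real^'n::finite) measure)"
  unfolding dil_def[abs_def]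
  by (intro borel_measurable_continuous_onI continuous_intros)

lemma linear_dil: "linear (dil c)"
  by (rule linearI) (auto simp: vec_eq_iff algebra_simps)

lemma nn_integral_lborel_dil:
  fixes c :: "'n::finite \<Rightarrow> real" and f :: "real^'n \<Rightarrow> ennreal"
  assumes c: "\<And>i. c i > 0" and [measurable]: "f \<in> borel_measurable borel"
  shows "(\<integral>\<^sup>+x. f x \<partial>lborel) = ennreal (\<Prod>i\<in>UNIV. c i) * (\<integral>\<^sup>+x. f (dil c x) \<partial>lborel)"
proof -
  define ix where "ix b = (THE i. b = axis i (1::real))" for b :: "real^'n"
  have ix: "ix (axis i 1) = i" for i by (auto simp: ix_def axis_eq_axis)
  have bij: "bij_betw (\<lambda>i. axis i (1::real) :: real^'n) UNIV Basis"
    by (auto simp: bij_betw_def inj_on_def axis_eq_axis Basis_vec_def)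
  have d: "(0 + (\<Sum>j\<in>Basis. (c (ix j) * (x \<bullet> j)) *\<^sub>R j)) = dil c x" for x :: "real^'n"
    by (simp add: sum.reindex_bij_betw[OF bij, symmetric] ix inner_axis)
      (simp add: vec_eq_iff axis_def if_distrib cong: if_cong)
  have p: "(\<Prod>j\<in>(Basis :: (real^'n) set). \<bar>c (ix j)\<bar>) = (\<Prod>i\<in>UNIV. c i)"
    using c by (simp add: prod.reindex_bij_betw[OF bij, symmetric] ix less_imp_le)
  have "lborel = density (distr lborel borel (dil c :: real^'n \<Rightarrow> _)) (\<lambda>_. ennreal (\<Prod>i\<in>UNIV. c i))"
    using lborel_affine_euclidean[of "\<lambda>b. c (ix b)" "0::real^'n"] c unfolding d p by (simp add: less_imp_neq[symmetric])
  then have "(\<integral>\<^sup>+x. f x \<partial>lborel) = (\<integral>\<^sup>+x. f x \<partial>density (distr lborel borel (dil c)) (\<lambda>_. ennreal (\<Prod>i\<in>UNIV. c i)))"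
    by simp
  also have "\<dots> = ennreal (\<Prod>i\<in>UNIV. c i) * (\<integral>\<^sup>+x. f (dil c x) \<partial>lborel)"
    by (simp add: nn_integral_density nn_integral_distr nn_integral_cmult)
  finally show ?thesis .
qed

text \<open>A rotation preserves Lebesgue measure and a positive diagonal map scales it by the
  product of its entries. The whitening map is a composition of the two.\<close>

lemma nn_integral_lborel_linear:
  fixes c :: "'n::finite \<Rightarrow> real" and f :: "real^'n \<Rightarrow> ennreal"
  assumes c: "\<And>i. c i > 0" and T: "orthogonal_transformation T" and [measurable]: "f \<in> borel_measurable borel"
  shows "(\<integral>\<^sup>+x. f x \<partial>lborel) = ennreal (\<Prod>i\<in>UNIV. c i) * (\<integral>\<^sup>+x. f (T (dil c x)) \<partial>lborel)"
proof -
  note [measurable] = orthogonal_transformation_measurable[OF T]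
  have "(\<integral>\<^sup>+x. f x \<partial>lborel) = (\<integral>\<^sup>+x. f (T x) \<partial>lborel)"
    by (simp add: nn_integral_lborel_orthogonal[OF T])
  also have "\<dots> = ennreal (\<Prod>i\<in>UNIV. c i) * (\<integral>\<^sup>+x. f (T (dil c x)) \<partial>lborel)"
    by (rule nn_integral_lborel_dil) (use c in auto)
  finally show ?thesis .
qed

subsection \<open>The standard Gaussian vector\<close>

lemma sets_gauss [simp, measurable_cong]: "sets (gauss_vec :: (real^'n::finite) measure) = sets borel"
  by (simp add: gauss_vec_def)

lemma space_gauss [simp]: "space (gauss_vec :: (real^'n::finite) measure) = UNIV"
  by (simp add: gauss_vec_def)

lemma gauss_density_eq_prod:
  fixes h :: "real^'n::finite"
  shows "(2 * pi) powr (- (real CARD('n)) / 2) * exp (- ((norm h)^2) / 2) = (\<Prod>i\<in>UNIV. phi (h $ i))"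
proof -
  have "(norm h)^2 = (\<Sum>i\<in>UNIV. (h $ i)^2)"
    by (simp add: norm_vec_def L2_set_def sum_nonneg)
  then have "exp (- ((norm h)^2) / 2) = (\<Prod>i\<in>UNIV. exp (- ((h $ i)^2) / 2))"
    by (simp add: exp_sum[symmetric] sum_negf sum_divide_distrib[symmetric])
  moreover have "(2 * pi) powr (- (real CARD('n)) / 2) = (\<Prod>i\<in>(UNIV::'n set). 1 / sqrt (2 * pi))"
  proof -
    have "1 / sqrt (2 * pi) = inverse ((2 * pi) powr (1/2))"
      by (subst powr_half_sqrt) (auto simp: divide_inverse)
    also have "\<dots> = (2 * pi) powr (- (1/2))" by (rule powr_minus[symmetric])
    finally have "(\<Prod>i\<in>(UNIV::'n set). 1 / sqrt (2 * pi)) = ((2 * pi) powr (- (1/2))) ^ CARD('n)"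
      by (simp only: prod_constant)
    also have "\<dots> = (2 * pi) powr (- (1/2) * CARD('n))"
      by (subst powr_realpow[symmetric]) (auto simp: powr_powr)
    finally show ?thesis by simp
  qed
  ultimately have "(2 * pi) powr (- (real CARD('n)) / 2) * exp (- ((norm h)^2) / 2)
      = (\<Prod>i\<in>(UNIV::'n set). 1 / sqrt (2 * pi)) * (\<Prod>i\<in>UNIV. exp (- ((h $ i)^2) / 2))" by simp
  also have "\<dots> = (\<Prod>i\<in>UNIV. phi (h $ i))"
    unfolding prod.distrib[symmetric] phi_def by simp
  finally show ?thesis .
qed

lemma nn_integral_gauss:
  fixes f :: "real^'n::finite \<Rightarrow> ennreal"
  assumes [measurable]: "f \<in> borel_measurable borel"
  shows "(\<integral>\<^sup>+h. f h \<partial>gauss_vec) = (\<integral>\<^sup>+h. (\<Prod>i\<in>UNIV. ennreal (phi (h $ i))) * f h \<partial>lborel)"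
  unfolding gauss_vec_def gauss_density_eq_prod by (simp add: nn_integral_density prod_ennreal prod_nonneg)

lemma nn_integral_gauss_prod:
  fixes f :: "'n::finite \<Rightarrow> real \<Rightarrow> ennreal"
  assumes [measurable]: "\<And>i. f i \<in> borel_measurable borel"
  shows "(\<integral>\<^sup>+(h::real^'n). (\<Prod>i\<in>UNIV. f i (h $ i)) \<partial>gauss_vec) = (\<Prod>i\<in>UNIV. (\<integral>\<^sup>+t. ennreal (phi t) * f i t \<partial>lborel))"
  using nn_integral_lborel_cart_prod[of "\<lambda>i t. ennreal (phi t) * f i t"]
  by (simp add: nn_integral_gauss prod.distrib[symmetric] del: prod_ennreal)

lemma nn_integral_phi: "(\<integral>\<^sup>+t. ennreal (phi t) \<partial>lborel) = 1"
  using integral_phi by (subst nn_integral_eq_integral) auto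

lemma prob_space_gauss: "prob_space (gauss_vec :: (real^'n::finite) measure)"
proof
  have "emeasure gauss_vec (space (gauss_vec::(real^'n) measure)) = (\<integral>\<^sup>+(h::real^'n). (\<Prod>i\<in>(UNIV::'n set). 1) \<partial>gauss_vec)"
    by simp
  also have "\<dots> = 1" by (subst nn_integral_gauss_prod) (auto simp: nn_integral_phi)
  finally show "emeasure gauss_vec (space (gauss_vec::(real^'n) measure)) = 1" .
qed

interpretation gauss: prob_space "gauss_vec :: (real^'n::finite) measure"
  by (rule prob_space_gauss)

lemma measure_gauss_UNIV [simp]: "measure (gauss_vec :: (real^'n::finite) measure) UNIV = 1"
  using prob_space.prob_space[OF prob_space_gauss[where 'n = 'n]] by simp

text \<open>The density depends on the norm only, and Lebesgue measure itself is invariant by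
  \<open>lborel_distr_orthogonal\<close>.\<close>

lemma gauss_distr_orthogonal:
  fixes T :: "real^'n::finite \<Rightarrow> real^'n"
  assumes T: "orthogonal_transformation T"
  shows "distr gauss_vec borel T = gauss_vec"
proof -
  note [measurable] = orthogonal_transformation_measurable[OF T]
  let ?g = "\<lambda>h::real^'n. ennreal ((2 * pi) powr (- (real CARD('n)) / 2) * exp (- ((norm h)^2) / 2))"
  have "density (distr lborel borel T) ?g = distr (density lborel (\<lambda>x. ?g (T x))) borel T"
    by (rule density_distr) auto
  then show ?thesis
    unfolding lborel_distr_orthogonal[OF T] orthogonal_transformation_norm[OF T] gauss_vec_def by simp
qed

lemma integral_gauss_orthogonal:
  fixes T :: "real^'n::finite \<Rightarrow> real^'n" and f :: "real^'n \<Rightarrow> 'b::{banach, second_countable_topology}"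
  assumes T: "orthogonal_transformation T" and [measurable]: "f \<in> borel_measurable borel"
  shows "(\<integral>h. f (T h) \<partial>gauss_vec) = (\<integral>h. f h \<partial>gauss_vec)"
proof -
  note [measurable] = orthogonal_transformation_measurable[OF T]
  show ?thesis
    by (subst (2) gauss_distr_orthogonal[OF T, symmetric]) (simp add: integral_distr)
qed

lemma orthogonal_transformation_uminus: "orthogonal_transformation (uminus :: real^'n::finite \<Rightarrow> _)"
  using orthogonal_transformation_neg[of "\<lambda>x::real^'n. x"] by simp

lemma integral_gauss_uminus:
  fixes f :: "real^'n::finite \<Rightarrow> 'b::{banach, second_countable_topology}"
  assumes [measurable]: "f \<in> borel_measurable borel"
  shows "(\<integral>h. f (- h) \<partial>gauss_vec) = (\<integral>h. f h \<partial>gauss_vec)"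
  by (rule integral_gauss_orthogonal[OF orthogonal_transformation_uminus]) auto

text \<open>Reflection turns the integral into its own negative. This is what removes first-order
  terms and several second-order terms in the expansions below.\<close>

lemma integral_gauss_odd:
  fixes f :: "real^'n::finite \<Rightarrow> real"
  assumes [measurable]: "f \<in> borel_measurable borel" and "\<And>h. f (- h) = - f h"
  shows "(\<integral>h. f h \<partial>gauss_vec) = 0"
  using integral_gauss_uminus[of f] assms(2) by simp

text \<open>The unit vector \<open>axis j 1\<close> is rotated onto \<open>v\<close>.\<close>
lemma gauss_marginal:
  fixes v :: "real^'n::finite"
  assumes "norm v = 1"
  shows "distr gauss_vec borel (\<lambda>h. h \<bullet> v) = std_normal_distribution"
proof -
  obtain j :: 'n where True by simp
  have "norm (axis j (1::real)) = norm v" using assms by simp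
  then obtain T :: "real^'n \<Rightarrow> real^'n" where T: "orthogonal_transformation T" "T (axis j 1) = v"
    using orthogonal_transformation_exists by blast
  note [measurable] = orthogonal_transformation_measurable[OF T(1)]
    orthogonal_transformation_measurable[OF orthogonal_transformation_inv[OF T(1)]]
  have "distr gauss_vec borel (\<lambda>h. h \<bullet> v) = distr (distr gauss_vec borel T) borel (\<lambda>h. h \<bullet> v)"
    by (simp add: gauss_distr_orthogonal[OF T(1)])
  also have "\<dots> = distr gauss_vec borel (\<lambda>h. T h \<bullet> T (axis j 1))"
    by (subst distr_distr) (auto simp: o_def T)
  also have "\<dots> = distr gauss_vec borel (\<lambda>h. h $ j)"
    using T(1) by (simp add: orthogonal_transformation_def inner_axis)
  also have "\<dots> = std_normal_distribution"
  proof (rule measure_eqI)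
    fix A assume "A \<in> sets (distr gauss_vec borel (\<lambda>h::real^'n. h $ j))"
    then have [measurable]: "A \<in> sets borel" by simp
    have "emeasure (distr gauss_vec borel (\<lambda>h::real^'n. h $ j)) A = (\<integral>\<^sup>+(h::real^'n). indicator A (h $ j) \<partial>gauss_vec)"
      by (subst nn_integral_indicator[symmetric], simp, subst nn_integral_distr) auto
    also have "\<dots> = (\<integral>\<^sup>+(h::real^'n). (\<Prod>i\<in>UNIV. (if i = j then indicator A else (\<lambda>_. 1)) (h $ i)) \<partial>gauss_vec)"
      by (intro nn_integral_cong, subst prod.remove[of _ j]) (auto simp: prod.neutral)
    also have "\<dots> = (\<Prod>i\<in>UNIV. (\<integral>\<^sup>+t. ennreal (phi t) * (if i = j then indicator A else (\<lambda>_. 1)) t \<partial>lborel))"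
      by (rule nn_integral_gauss_prod) auto
    also have "\<dots> = (\<integral>\<^sup>+t. ennreal (phi t) * indicator A t \<partial>lborel)"
      by (subst prod.remove[of _ j]) (auto simp: prod.neutral nn_integral_phi)
    also have "\<dots> = emeasure std_normal_distribution A"
      by (simp add: emeasure_density phi_eq_std_normal_density)
    finally show "emeasure (distr gauss_vec borel (\<lambda>h::real^'n. h $ j)) A = emeasure std_normal_distribution A" .
  qed simp
  finally show ?thesis .
qed

text \<open>Only the component of \<open>h\<close> along \<open>v\<close> matters, so the
  one-dimensional characteristic function is evaluated at the frequency
  \<open>norm v\<close>.\<close>

lemma gauss_char:
  fixes v :: "real^'n::finite"
  shows "(\<integral>h. iexp (h \<bullet> v) \<partial>gauss_vec) = complex_of_real (exp (- ((norm v)^2) / 2))"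
proof (cases "v = 0")
  case True then show ?thesis by (simp add: scaleR_conv_of_real)
next
  case False
  define w where "w = v /\<^sub>R norm v"
  have w: "norm w = 1" "v = norm v *\<^sub>R w" using False by (auto simp: w_def)
  have "complex_of_real (exp (- ((norm v)^2) / 2)) = char std_normal_distribution (norm v)"
    by (simp add: char_std_normal_distribution)
  also have "\<dots> = (\<integral>h. iexp (norm v * (h \<bullet> w)) \<partial>gauss_vec)"
    unfolding gauss_marginal[OF w(1), symmetric] char_def by (subst integral_distr) auto
  also have "(\<lambda>h. norm v * (h \<bullet> w)) = (\<lambda>h. h \<bullet> v)"
    by (metis w(2) inner_scaleR_right)
  finally show ?thesis by simp
qed

lemma integrable_gauss_exp: "integrable gauss_vec (\<lambda>h::real^'n::finite. exp ((norm h)^2 / 4))"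
proof (rule integrableI_bounded)
  have n: "(norm h)^2 = (\<Sum>i\<in>UNIV. (h $ i)^2)" for h :: "real^'n"
    by (simp add: norm_vec_def L2_set_def sum_nonneg)
  have "(\<integral>\<^sup>+(h::real^'n). ennreal (norm (exp ((norm h)^2 / 4))) \<partial>gauss_vec)
      = (\<integral>\<^sup>+(h::real^'n). (\<Prod>i\<in>UNIV. ennreal (exp ((h $ i)^2 / 4))) \<partial>gauss_vec)"
    by (simp add: n prod_ennreal exp_sum[symmetric] sum_divide_distrib)
  also have "\<dots> = (\<Prod>i\<in>(UNIV::'n set). (\<integral>\<^sup>+t. ennreal (phi t) * ennreal (exp (t^2 / 4)) \<partial>lborel))"
    by (rule nn_integral_gauss_prod) auto
  \<comment> \<open>Multiplying the standard density by \<open>exp (t^2 / 4)\<close> gives, up to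
    the factor \<open>sqrt 2\<close>, a normal density of variance 2.\<close>
  also have "(\<lambda>t. ennreal (phi t) * ennreal (exp (t^2 / 4))) = (\<lambda>t. ennreal (sqrt 2) * ennreal (normal_density 0 (sqrt 2) t))"
  proof
    fix t :: real
    have "phi t * exp (t^2 / 4) = sqrt 2 * normal_density 0 (sqrt 2) t"
      by (simp add: phi_def normal_density_def real_sqrt_mult field_simps flip: exp_add)
    then show "ennreal (phi t) * ennreal (exp (t^2 / 4)) = ennreal (sqrt 2) * ennreal (normal_density 0 (sqrt 2) t)"
      by (simp add: ennreal_mult[symmetric])
  qed
  also have "(\<integral>\<^sup>+t. ennreal (sqrt 2) * ennreal (normal_density 0 (sqrt 2) t) \<partial>lborel) = ennreal (sqrt 2)"
    using integral_normal_density[of "sqrt 2" 0] integrable_normal_density[of "sqrt 2" 0]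
    by (subst nn_integral_cmult, simp, subst nn_integral_eq_integral) (auto simp: normal_density_nonneg)
  also have "(\<Prod>i\<in>(UNIV::'n set). ennreal (sqrt 2)) < \<infinity>"
    by (simp add: ennreal_power)
  finally show "(\<integral>\<^sup>+(h::real^'n). ennreal (norm (exp ((norm h)^2 / 4))) \<partial>gauss_vec) < \<infinity>" .
qed simp

text \<open>Of the admissible exponent 1/4 one half stays in the integrand; the other half absorbs
  the polynomial through \<open>s ^ p \<le> fact p * exp s\<close>.\<close>

lemma integrable_gauss_poly_exp:
  "integrable gauss_vec (\<lambda>h::real^'n::finite. (1 + norm h)^p * exp ((norm h)^2 / 8))"
proof (rule Bochner_Integration.integrable_bound)
  let ?C = "fact p * exp (5::real)"
  show "integrable gauss_vec (\<lambda>h::real^'n. ?C * exp ((norm h)^2 / 4))"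
    by (intro integrable_mult_right integrable_gauss_exp)
  show "AE h::real^'n in gauss_vec. norm ((1 + norm h)^p * exp ((norm h)^2 / 8)) \<le> norm (?C * exp ((norm h)^2 / 4))"
  proof (rule AE_I2)
    fix h :: "real^'n"
    define s where "s = 1 + norm h"
    have s: "s \<ge> 0" by (simp add: s_def)
    have "(\<Sum>n\<in>{p}. s ^ n /\<^sub>R fact n) \<le> (\<Sum>n. s ^ n /\<^sub>R fact n)"
      by (rule sum_le_suminf) (use s sums_summable[OF exp_converges[of s]] in auto)
    then have "s ^ p / fact p \<le> exp s"
      using sums_unique[OF exp_converges[of s]] by (simp add: divide_inverse mult.commute)
    then have "s ^ p \<le> fact p * exp s" by (simp add: field_simps)
    \<comment> \<open>The square of \<open>norm h - 4\<close> is nonnegative.\<close>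
    also have "s \<le> 5 + (norm h)^2 / 8"
    proof -
      have "0 \<le> (norm h - 4)^2" by simp
      then show ?thesis by (simp add: s_def power2_eq_square algebra_simps)
    qed
    then have "fact p * exp s \<le> fact p * (exp 5 * exp ((norm h)^2 / 8))" by (simp flip: exp_add)
    finally have "s ^ p * exp ((norm h)^2 / 8) \<le> fact p * (exp 5 * exp ((norm h)^2 / 8)) * exp ((norm h)^2 / 8)"
      by (rule mult_right_mono) simp
    also have "\<dots> = ?C * exp ((norm h)^2 / 4)" by (simp add: mult.assoc flip: exp_add)
    finally show "norm ((1 + norm h)^p * exp ((norm h)^2 / 8)) \<le> norm (?C * exp ((norm h)^2 / 4))"
      using s by (simp add: s_def abs_mult)
  qed
qed simp

lemma integrable_gauss_poly: "integrable gauss_vec (\<lambda>h::real^'n::finite. (1 + norm h)^p)"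
proof (rule Bochner_Integration.integrable_bound[OF integrable_gauss_poly_exp])
  show "AE h::real^'n in gauss_vec. norm ((1 + norm h)^p) \<le> norm ((1 + norm h)^p * exp ((norm h)^2 / 8))"
  proof (rule AE_I2)
    fix h :: "real^'n"
    have "(1 + norm h)^p * 1 \<le> (1 + norm h)^p * exp ((norm h)^2 / 8)"
      by (intro mult_left_mono) auto
    then show "norm ((1 + norm h)^p) \<le> norm ((1 + norm h)^p * exp ((norm h)^2 / 8))"
      by (simp add: abs_mult)
  qed
qed simp

lemma integrable_gauss_poly_bound:
  fixes f :: "real^'n::finite \<Rightarrow> 'b::{banach, second_countable_topology}"
  assumes [measurable]: "f \<in> borel_measurable borel" and "\<And>h. norm (f h) \<le> C * (1 + norm h)^p"
  shows "integrable gauss_vec f"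
proof (rule Bochner_Integration.integrable_bound[OF integrable_mult_right[OF integrable_gauss_poly, of C p]])
  show "AE h in gauss_vec. norm (f h) \<le> norm (C * (1 + norm h) ^ p)"
    using assms(2) by (intro AE_I2) (metis abs_ge_self order_trans real_norm_def)
qed simp

subsection \<open>The functions zeta\<close>

lemma one_plus_inner_le: "1 + \<bar>h \<bullet> x\<bar> \<le> (1 + norm x) * (1 + norm h)" for h x :: "'a::real_inner"
  using Cauchy_Schwarz_ineq2[of h x] by (simp add: algebra_simps) (smt (verit) norm_ge_zero)

lemma integrable_phi_poly_bound:
  fixes f :: "real \<Rightarrow> real"
  assumes [measurable]: "f \<in> borel_measurable borel" and f: "\<And>s. \<bar>f s\<bar> \<le> C * (1 + \<bar>s\<bar>)^p"
  shows "integrable lborel (\<lambda>s. f s * phi s)"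
proof (rule Bochner_Integration.integrable_bound)
  let ?g = "\<lambda>s. \<bar>C\<bar> * 2^p * (std_normal_density s * \<bar>s\<bar>^0 + std_normal_density s * \<bar>s\<bar>^p)"
  show "integrable lborel ?g"
    by (intro integrable_mult_right Bochner_Integration.integrable_add integrable_std_normal_moment_abs)
  show "AE s in lborel. norm (f s * phi s) \<le> norm (?g s)"
  proof (rule AE_I2)
    fix s :: real
    have "(1 + \<bar>s\<bar>)^p \<le> 2^p * (1 + \<bar>s\<bar>^p)"
    proof (cases "\<bar>s\<bar> \<le> 1")
      case True
      then have "(1 + \<bar>s\<bar>)^p \<le> 2^p" by (intro power_mono) auto
      also have "\<dots> \<le> 2^p * (1 + \<bar>s\<bar>^p)" by simp
      finally show ?thesis .
    next
      case False
      then have "(1 + \<bar>s\<bar>)^p \<le> (2 * \<bar>s\<bar>)^p" by (intro power_mono) auto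
      also have "\<dots> \<le> 2^p * (1 + \<bar>s\<bar>^p)" by (simp add: power_mult_distrib)
      finally show ?thesis .
    qed
    then have "\<bar>C\<bar> * (1 + \<bar>s\<bar>)^p \<le> \<bar>C\<bar> * (2^p * (1 + \<bar>s\<bar>^p))" by (rule mult_left_mono) simp
    moreover have "\<bar>f s\<bar> \<le> \<bar>C\<bar> * (1 + \<bar>s\<bar>)^p"
      using f[of s] by (rule order_trans) (intro mult_right_mono, auto)
    ultimately have "\<bar>f s\<bar> * phi s \<le> \<bar>C\<bar> * (2^p * (1 + \<bar>s\<bar>^p)) * phi s"
      by (intro mult_right_mono) auto
    also have "\<dots> = ?g s" by (simp add: phi_eq_std_normal_density algebra_simps)
    finally have "\<bar>f s\<bar> * phi s \<le> ?g s" .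
    then show "norm (f s * phi s) \<le> norm (?g s)" by (simp add: abs_mult)
  qed
qed simp

lemma xi_scaled_le: "xi (t * s) \<le> 64 * (1 + \<bar>t\<bar>)^2 * (1 + \<bar>s\<bar>)^2"
proof -
  have "1 + \<bar>t * s\<bar> \<le> (1 + \<bar>t\<bar>) * (1 + \<bar>s\<bar>)" using one_plus_inner_le[of s t] by (simp add: mult.commute)
  then have "(1 + \<bar>t * s\<bar>)^2 \<le> ((1 + \<bar>t\<bar>) * (1 + \<bar>s\<bar>))^2" by (intro power_mono) auto
  then show ?thesis using xi_le[of "t * s"] unfolding power_mult_distrib by linarith
qed

lemma zeta_integrand_le: "\<bar>s ^ k * xi (t * s)\<bar> \<le> 64 * (1 + \<bar>t\<bar>)^2 * (1 + \<bar>s\<bar>)^(k + 2)"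
proof -
  have "\<bar>s\<bar> ^ k * xi (t * s) \<le> (1 + \<bar>s\<bar>)^k * (64 * (1 + \<bar>t\<bar>)^2 * (1 + \<bar>s\<bar>)^2)"
    by (intro mult_mono power_mono xi_scaled_le) auto
  also have "\<dots> = 64 * (1 + \<bar>t\<bar>)^2 * (1 + \<bar>s\<bar>)^(k + 2)" by (simp only: power_add mult_ac)
  finally show ?thesis by (simp add: abs_mult power_abs)
qed

lemma zeta_nat: "zeta (int k) t = (\<integral>s. s ^ k * xi (t * s) * phi s \<partial>lborel)"
  by (simp add: zeta_def)

lemma integrable_zeta: "integrable lborel (\<lambda>s. s ^ k * xi (t * s) * phi s)"
  by (rule integrable_phi_poly_bound[OF _ zeta_integrand_le]) measurable

lemma zeta_even_pos: "zeta (int (2 * k)) t > 0"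
proof -
  let ?f = "\<lambda>s. s ^ (2 * k) * xi (t * s) * phi s"
  have nn: "?f s \<ge> 0" for s by simp
  then have "zeta (int (2 * k)) t \<ge> 0" unfolding zeta_nat by (intro integral_nonneg_AE) auto
  moreover have "zeta (int (2 * k)) t \<noteq> 0"
  proof
    assume "zeta (int (2 * k)) t = 0"
    then have "AE s in lborel. ?f s = 0"
      unfolding zeta_nat by (subst (asm) integral_nonneg_eq_0_iff_AE) (use integrable_zeta nn in auto)
    then have "AE s in lborel. s = (0::real)"
      by eventually_elim (auto simp: less_imp_neq[symmetric])
    moreover have "AE s in lborel. s \<noteq> (0::real)" by (rule AE_lborel_singleton)
    ultimately have "AE s::real in lborel. False" by eventually_elim auto
    then show False by (simp add: ae_filter_eq_bot_iff trivial_limit_def[symmetric])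
  qed
  ultimately show ?thesis by simp
qed

lemma zeta_0_pos [simp]: "zeta 0 t > 0" and zeta_2_pos [simp]: "zeta 2 t > 0"
  using zeta_even_pos[of 0 t] zeta_even_pos[of 1 t] by simp_all

lemma zeta_ne_0 [simp]: "zeta 0 t \<noteq> 0" "zeta 2 t \<noteq> 0"
  using zeta_0_pos[of t] zeta_2_pos[of t] by linarith+

text \<open>Dominated convergence along sequences; the bound B of a convergent sequence makes the
  polynomial bound of the integrand uniform.\<close>

lemma continuous_on_zeta: "continuous_on A (zeta (int k))"
proof (rule continuous_at_imp_continuous_on, rule ballI)
  fix t :: real
  show "isCont (zeta (int k)) t"
    unfolding continuous_at_sequentially
  proof (intro allI impI)
    fix u assume u: "u \<longlonglongrightarrow> t"
    obtain B where B: "\<And>n. \<bar>u n\<bar> \<le> B"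
      using convergent_imp_Bseq[OF convergentI[OF u]] by (auto simp: Bseq_def)
    have "(\<lambda>n. \<integral>s. s ^ k * xi (u n * s) * phi s \<partial>lborel) \<longlonglongrightarrow> (\<integral>s. s ^ k * xi (t * s) * phi s \<partial>lborel)"
    proof (rule integral_dominated_convergence[where w = "\<lambda>s. (64 * (1 + B)^2 * (1 + \<bar>s\<bar>)^(k + 2)) * phi s"])
      show "integrable lborel (\<lambda>s. (64 * (1 + B)^2 * (1 + \<bar>s\<bar>)^(k + 2)) * phi s)"
        by (rule integrable_phi_poly_bound[where C = "64 * (1 + B)^2" and p = "k + 2"]) (auto simp: abs_mult)
      show "AE s in lborel. (\<lambda>n. s ^ k * xi (u n * s) * phi s) \<longlonglongrightarrow> s ^ k * xi (t * s) * phi s"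
        by (intro AE_I2 tendsto_mult tendsto_const isCont_tendsto_compose[of _ xi] u)
          (use continuous_on_xi[of UNIV] in \<open>auto simp: continuous_on_eq_continuous_at\<close>)
      show "AE s in lborel. norm (s ^ k * xi (u n * s) * phi s) \<le> (64 * (1 + B)^2 * (1 + \<bar>s\<bar>)^(k + 2)) * phi s" for n
      proof (rule AE_I2)
        fix s
        have "\<bar>s ^ k * xi (u n * s)\<bar> \<le> 64 * (1 + \<bar>u n\<bar>)^2 * (1 + \<bar>s\<bar>)^(k + 2)" by (rule zeta_integrand_le)
        also have "\<dots> \<le> 64 * (1 + B)^2 * (1 + \<bar>s\<bar>)^(k + 2)"
          using B[of n] by (intro mult_right_mono mult_left_mono power_mono) auto
        finally show "norm (s ^ k * xi (u n * s) * phi s) \<le> (64 * (1 + B)^2 * (1 + \<bar>s\<bar>)^(k + 2)) * phi s"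
          by (subst real_norm_def, subst abs_mult) (simp add: mult_right_mono)
      qed
    qed auto
    then show "(zeta (int k) \<circ> u) \<longlonglongrightarrow> zeta (int k) t" by (simp add: zeta_nat o_def)
  qed
qed

lemma continuous_on_zeta_0: "continuous_on A (zeta 0)" and continuous_on_zeta_2: "continuous_on A (zeta 2)"
  using continuous_on_zeta[of A 0] continuous_on_zeta[of A 2] by simp_all

lemma zeta_measurable [measurable]:
  "zeta 0 \<in> borel_measurable borel" "zeta 2 \<in> borel_measurable borel"
  by (intro borel_measurable_continuous_onI continuous_on_zeta_0 continuous_on_zeta_2)+

subsection \<open>The Fisher information\<close>

text \<open>The Fisher information as a bilinear form. Being free of coordinates, it can be
  evaluated in a basis adapted to \<open>x\<close>.\<close>

definition finfo :: "real^'n::finite \<Rightarrow> real^'n \<Rightarrow> real^'n \<Rightarrow> real" where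
  "finfo x a b = (\<integral>h. (h \<bullet> a) * (h \<bullet> b) * xi (h \<bullet> x) \<partial>gauss_vec)"

lemma integrable_finfo: "integrable gauss_vec (\<lambda>h::real^'n::finite. (h \<bullet> a) * (h \<bullet> b) * xi (h \<bullet> x))"
proof (rule integrable_gauss_poly_bound)
  fix h :: "real^'n"
  have "xi (h \<bullet> x) \<le> 64 * (1 + \<bar>h \<bullet> x\<bar>)^2" by (rule xi_le)
  also have "\<dots> \<le> 64 * ((1 + norm x) * (1 + norm h))^2"
    using one_plus_inner_le[of h x] by (intro mult_left_mono power_mono) auto
  finally have "xi (h \<bullet> x) \<le> 64 * ((1 + norm x) * (1 + norm h))^2" .
  moreover have "\<bar>h \<bullet> c\<bar> \<le> norm c * (1 + norm h)" for c
    using Cauchy_Schwarz_ineq2[of h c] by (simp add: algebra_simps) (smt (verit) norm_ge_zero)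
  ultimately have "\<bar>h \<bullet> a\<bar> * \<bar>h \<bullet> b\<bar> * xi (h \<bullet> x) \<le>
      (norm a * (1 + norm h)) * (norm b * (1 + norm h)) * (64 * ((1 + norm x) * (1 + norm h))^2)"
    by (intro mult_mono) auto
  then show "norm ((h \<bullet> a) * (h \<bullet> b) * xi (h \<bullet> x)) \<le> 64 * norm a * norm b * (1 + norm x)^2 * (1 + norm h)^4"
    by (simp add: abs_mult power_mult_distrib algebra_simps eval_nat_numeral)
qed measurable

lemma score_eq: "score y h x i = y * h $ i * mills (y * (h \<bullet> x))"
proof -
  have "((\<lambda>t. ln (Phi (y * (h \<bullet> x) + t * (y * h $ i)))) has_real_derivative mills (y * (h \<bullet> x) + 0 * (y * h $ i)) * (y * h $ i)) (at 0)"
    by (rule DERIV_chain2[OF DERIV_ln_Phi]) (auto intro!: derivative_eq_intros)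
  moreover have "ln (Qfun (- y * (h \<bullet> (x + t *\<^sub>R axis i 1)))) = ln (Phi (y * (h \<bullet> x) + t * (y * h $ i)))" for t
    by (simp add: Phi_def inner_add_right inner_axis algebra_simps)
  ultimately show ?thesis
    unfolding score_def by (auto intro!: DERIV_imp_deriv simp: mult.commute)
qed

text \<open>The two outputs contribute \<open>phi^2 / Phi\<close> and
  \<open>phi^2 / (1 - Phi)\<close>; as the denominators add up to 1, the sum is
  \<open>xi\<close>.\<close>

lemma fisher_nth: "fisher x $ i $ j = finfo x (axis i 1) (axis j 1)"
proof -
  have "(\<Sum>y\<in>{-1, 1::real}. Qfun (- y * (h \<bullet> x)) * score y h x i * score y h x j)
      = (h \<bullet> axis i 1) * (h \<bullet> axis j 1) * xi (h \<bullet> x)" for h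
  proof -
    define t where "t = h \<bullet> x"
    have p: "Phi t > 0" "1 - Phi t > 0" by simp_all
    have 1: "(\<Sum>y\<in>{-1, 1::real}. Qfun (- y * (h \<bullet> x)) * score y h x i * score y h x j) =
       Phi (- t) * (h $ i * mills (- t)) * (h $ j * mills (- t)) + Phi t * (h $ i * mills t) * (h $ j * mills t)"
      by (simp add: score_eq Phi_def t_def)
    also have "\<dots> = h $ i * h $ j * ((phi t)^2 / (1 - Phi t) + (phi t)^2 / Phi t)"
    proof -
      have "q * (a * (f / q)) * (b * (f / q)) + p' * (a * (f / p')) * (b * (f / p')) = a * b * (f^2 / q + f^2 / p')"
        if "q > 0" "p' > 0" for a b f p' q :: real
        using that by (simp add: field_simps power2_eq_square)
      from this[OF p(2) p(1)] show ?thesis by (simp add: mills_def Phi_minus)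
    qed
    also have "(phi t)^2 / (1 - Phi t) + (phi t)^2 / Phi t = xi t"
    proof -
      have "f / q + f / p' = f / (p' * q)" if "q > 0" "p' > 0" "p' + q = 1" for f p' q :: real
      proof -
        have "f / q + f / p' = f * (p' + q) / (p' * q)" using that(1,2) by (simp add: field_simps)
        then show ?thesis by (simp only: that(3) mult_1_right)
      qed
      from this[OF p(2) p(1)] show ?thesis by (simp add: xi_altdef)
    qed
    finally show ?thesis by (simp add: inner_axis t_def)
  qed
  then show ?thesis by (simp add: fisher_def finfo_def)
qed

lemma finfo_orthogonal:
  fixes x :: "real^'n::finite" and T :: "real^'n \<Rightarrow> real^'n"
  assumes T: "orthogonal_transformation T"
  shows "finfo (T x) (T a) (T b) = finfo x a b"
proof -
  have "finfo x a b = (\<integral>h. (T h \<bullet> T a) * (T h \<bullet> T b) * xi (T h \<bullet> T x) \<partial>gauss_vec)"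
    unfolding finfo_def using T by (simp add: orthogonal_transformation_def)
  also have "\<dots> = finfo (T x) (T a) (T b)"
    unfolding finfo_def by (rule integral_gauss_orthogonal[OF T]) measurable
  finally show ?thesis by simp
qed

text \<open>One of i, j differs from k. Reflecting that coordinate fixes the point on the k-th axis
  and flips the sign of exactly one argument of the form.\<close>

lemma finfo_axis_off_diagonal:
  fixes k i j :: "'n::finite"
  assumes "i \<noteq> j"
  shows "finfo (r *\<^sub>R axis k 1) (axis i 1) (axis j 1) = 0"
proof -
  obtain m where m: "m \<in> {i, j}" "m \<noteq> k" using assms by (cases "i = k") auto
  let ?T = "dil (\<lambda>l. if l = m then -1 else 1) :: real^'n \<Rightarrow> real^'n"
  have T: "orthogonal_transformation ?T"
    unfolding orthogonal_transformation_def by (auto simp: linear_dil inner_vec_def intro!: sum.cong)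
  have "finfo (r *\<^sub>R axis k 1) (axis i 1) (axis j 1) = finfo (?T (r *\<^sub>R axis k 1)) (?T (axis i 1)) (?T (axis j 1))"
    by (rule finfo_orthogonal[OF T, symmetric])
  also have "?T (r *\<^sub>R axis k 1) = r *\<^sub>R axis k 1"
    using m by (auto simp: vec_eq_iff axis_def)
  also have "?T (axis i 1) = (if i = m then - axis i 1 else axis i 1)" by (auto simp: vec_eq_iff axis_def)
  also have "?T (axis j 1) = (if j = m then - axis j 1 else axis j 1)" by (auto simp: vec_eq_iff axis_def)
  also have "finfo (r *\<^sub>R axis k 1) (if i = m then - axis i 1 else axis i 1) (if j = m then - axis j 1 else axis j 1)
      = - finfo (r *\<^sub>R axis k 1) (axis i 1) (axis j 1)"
    using m assms by (auto simp: finfo_def)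
  finally show ?thesis by simp
qed

text \<open>Along the axis of the point everything depends on one Gaussian coordinate, which gives
  \<open>zeta 2\<close>. In any other direction the squared coordinate is independent of the
  argument of \<open>xi\<close>, so its mean 1 splits off and \<open>zeta 0\<close> remains.\<close>

lemma finfo_axis_diagonal:
  fixes k i :: "'n::finite"
  shows "finfo (r *\<^sub>R axis k 1) (axis i 1) (axis i 1) = (if i = k then zeta 2 r else zeta 0 r)"
proof (cases "i = k")
  case True
  have "finfo (r *\<^sub>R axis k 1) (axis k 1) (axis k 1) = (\<integral>h. (\<lambda>s. s^2 * xi (r * s)) (h \<bullet> (axis k 1 :: real^'n)) \<partial>gauss_vec)"
    by (simp add: finfo_def power2_eq_square)
  also have "\<dots> = (\<integral>s. s^2 * xi (r * s) \<partial>std_normal_distribution)"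
    unfolding gauss_marginal[of "axis k 1 :: real^'n", simplified, symmetric] by (subst integral_distr) auto
  also have "\<dots> = zeta 2 r"
    using zeta_nat[of 2 r] by (subst integral_density) (auto simp: phi_eq_std_normal_density mult.commute normal_density_nonneg)
  finally show ?thesis using True by simp
next
  case False
  let ?f = "\<lambda>l s. if l = i then ennreal (s^2) else if l = k then ennreal (xi (r * s)) else 1"
  have eq: "(\<Prod>l\<in>UNIV. ?f l (h $ l)) = ennreal ((h \<bullet> axis i 1) * (h \<bullet> axis i 1) * xi (h \<bullet> (r *\<^sub>R axis k 1)))" for h :: "real^'n"
  proof -
    have "(\<Prod>l\<in>UNIV. ?f l (h $ l)) = ?f i (h $ i) * (?f k (h $ k) * (\<Prod>l\<in>UNIV - {i} - {k}. ?f l (h $ l)))"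
      using False by (subst prod.remove[of _ i], simp, simp, subst prod.remove[of _ k]) auto
    also have "(\<Prod>l\<in>UNIV - {i} - {k}. ?f l (h $ l)) = 1" by (intro prod.neutral) auto
    finally show ?thesis using False by (simp add: inner_axis ennreal_mult[symmetric] power2_eq_square)
  qed
  have "ennreal (finfo (r *\<^sub>R axis k 1) (axis i 1) (axis i 1)) =
      (\<integral>\<^sup>+h. ennreal ((h \<bullet> axis i 1) * (h \<bullet> axis i 1) * xi (h \<bullet> (r *\<^sub>R axis k 1))) \<partial>gauss_vec)"
    unfolding finfo_def by (rule nn_integral_eq_integral[symmetric, OF integrable_finfo]) auto
  also have "\<dots> = (\<Prod>l\<in>UNIV. (\<integral>\<^sup>+t. ennreal (phi t) * ?f l t \<partial>lborel))"
    unfolding eq[symmetric] by (rule nn_integral_gauss_prod) auto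
  also have "\<dots> = (\<integral>\<^sup>+t. ennreal (phi t) * ennreal (t^2) \<partial>lborel) *
      ((\<integral>\<^sup>+t. ennreal (phi t) * ennreal (xi (r * t)) \<partial>lborel) *
       (\<Prod>l\<in>UNIV - {i} - {k}. (\<integral>\<^sup>+t. ennreal (phi t) * ?f l t \<partial>lborel)))"
    using False by (subst prod.remove[of _ i], simp, simp, subst prod.remove[of _ k]) auto
  also have "(\<Prod>l\<in>UNIV - {i} - {k}. (\<integral>\<^sup>+t. ennreal (phi t) * ?f l t \<partial>lborel)) = 1"
    by (intro prod.neutral) (auto simp: nn_integral_phi)
  also have "(\<integral>\<^sup>+t. ennreal (phi t) * ennreal (t^2) \<partial>lborel) = 1"
    using integral_std_normal_moment_even[of 1] integrable_std_normal_moment[of 2]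
    by (subst ennreal_mult[symmetric], simp, simp, subst nn_integral_eq_integral) (auto simp: phi_eq_std_normal_density normal_density_nonneg)
  also have "(\<integral>\<^sup>+t. ennreal (phi t) * ennreal (xi (r * t)) \<partial>lborel) = ennreal (zeta 0 r)"
    using integrable_zeta[of 0 r] zeta_nat[of 0 r]
    by (subst ennreal_mult[symmetric], simp, simp, subst nn_integral_eq_integral) (auto simp: mult.commute)
  finally have "ennreal (finfo (r *\<^sub>R axis k 1) (axis i 1) (axis i 1)) = ennreal (zeta 0 r)" by simp
  moreover have "finfo (r *\<^sub>R axis k 1) (axis i 1) (axis i 1) \<ge> 0"
    unfolding finfo_def by (intro integral_nonneg_AE AE_I2) auto
  moreover have "zeta 0 r \<ge> 0" using zeta_0_pos[of r] by linarith
  ultimately show ?thesis using False by simp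
qed

text \<open>In the basis \<open>T (axis i 1)\<close>, whose \<open>k\<close>-th vector points along \<open>x\<close>, the Fisher information is diagonal.\<close>
definition polar_frame :: "'n \<Rightarrow> real^'n::finite \<Rightarrow> (real^'n \<Rightarrow> real^'n) \<Rightarrow> bool" where
  "polar_frame k x T \<longleftrightarrow> orthogonal_transformation T \<and>
     (\<forall>i j. finfo x (T (axis i 1)) (T (axis j 1)) =
       (if i = j then if i = k then zeta 2 (norm x) else zeta 0 (norm x) else 0))"

text \<open>A rotation that takes \<open>norm x *\<^sub>R axis k 1\<close> to \<open>x\<close>
  transports the diagonal form. The point 0 is no exception, since the multiple of the axis is then
  0 as well.\<close>

lemma polar_frame_exists:
  fixes x :: "real^'n::finite" and k :: 'n
  shows "\<exists>T. polar_frame k x T"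
proof -
  have "norm (norm x *\<^sub>R axis k (1::real) :: real^'n) = norm x" by simp
  then obtain T :: "real^'n \<Rightarrow> real^'n" where T: "orthogonal_transformation T" "T (norm x *\<^sub>R axis k 1) = x"
    using orthogonal_transformation_exists by blast
  have "finfo x (T (axis i 1)) (T (axis j 1)) =
       (if i = j then if i = k then zeta 2 (norm x) else zeta 0 (norm x) else 0)" for i j
    using finfo_orthogonal[OF T(1), of "norm x *\<^sub>R axis k 1" "axis i 1" "axis j 1"]
      finfo_axis_off_diagonal[of i j "norm x" k] finfo_axis_diagonal[of "norm x" k i]
    unfolding T(2) by (cases "i = j"; cases "i = k") simp_all
  with T(1) show ?thesis unfolding polar_frame_def by blast
qed

lemma det_orthogonal_congruence:
  fixes T :: "real^'n \<Rightarrow> real^'n::finite" and A :: "real^'n^'n"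
  assumes T: "orthogonal_transformation T"
  shows "det (transpose (matrix T) ** A ** matrix T) = det A"
proof -
  have "\<bar>det (matrix T)\<bar> = 1" using T by simp
  then have "det (matrix T) * det (matrix T) = 1" by (metis abs_mult_self_eq mult_1)
  then show ?thesis by (simp add: det_mul)
qed

lemma finfo_bilinear:
  "finfo x (\<Sum>i\<in>UNIV. a i *\<^sub>R u i) (\<Sum>j\<in>UNIV. b j *\<^sub>R v j)
    = (\<Sum>i\<in>(UNIV::'a::finite set). \<Sum>j\<in>(UNIV::'a set). a i * b j * finfo x (u i) (v j))"
proof -
  have "finfo x (\<Sum>i\<in>UNIV. a i *\<^sub>R u i) (\<Sum>j\<in>UNIV. b j *\<^sub>R v j)
      = (\<integral>h. (\<Sum>i\<in>UNIV. \<Sum>j\<in>UNIV. a i * b j * ((h \<bullet> u i) * (h \<bullet> v j) * xi (h \<bullet> x))) \<partial>gauss_vec)"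
    unfolding finfo_def
    unfolding inner_sum_right inner_scaleR_right sum_product
    unfolding sum_distrib_right
    by (intro Bochner_Integration.integral_cong refl sum.cong) (simp only: mult_ac)
  also have "\<dots> = (\<Sum>i\<in>UNIV. \<Sum>j\<in>UNIV. a i * b j * finfo x (u i) (v j))"
    unfolding finfo_def by (simp add: integrable_finfo)
  finally show ?thesis .
qed

text \<open>Congruence with the polar frame leaves the determinant unchanged and yields a diagonal
  matrix, with one radial entry and the remaining ones tangential.\<close>

lemma det_fisher:
  fixes x :: "real^'n::finite"
  shows "det (fisher x) = zeta 0 (norm x) ^ (CARD('n) - 1) * zeta 2 (norm x)"
proof -
  obtain k :: 'n where True by simp
  obtain T :: "real^'n \<Rightarrow> real^'n" where "polar_frame k x T"
    using polar_frame_exists by blast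
  then have T: "orthogonal_transformation T"
    and f: "\<And>i j. finfo x (T (axis i 1)) (T (axis j 1)) =
       (if i = j then if i = k then zeta 2 (norm x) else zeta 0 (norm x) else 0)"
    unfolding polar_frame_def by simp_all
  let ?D = "transpose (matrix T) ** fisher x ** matrix T"
  have Ta: "T (axis i 1) = (\<Sum>a\<in>UNIV. (T (axis i 1) $ a) *\<^sub>R axis a 1)" for i
    by (simp add: vec_eq_iff axis_def if_distrib cong: if_cong)
  have D: "?D $ i $ j = finfo x (T (axis i 1)) (T (axis j 1))" for i j
  proof -
    have "?D $ i $ j = (\<Sum>b\<in>UNIV. \<Sum>a\<in>UNIV. T (axis i 1) $ a * finfo x (axis a 1) (axis b 1) * T (axis j 1) $ b)"
      by (simp add: matrix_matrix_mult_def transpose_def matrix_def fisher_nth sum_distrib_right)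
    also have "\<dots> = (\<Sum>a\<in>UNIV. \<Sum>b\<in>UNIV. T (axis i 1) $ a * T (axis j 1) $ b * finfo x (axis a 1) (axis b 1))"
      by (subst sum.swap) (intro sum.cong refl, simp only: mult_ac)
    also have "\<dots> = finfo x (\<Sum>a\<in>UNIV. (T (axis i 1) $ a) *\<^sub>R axis a 1) (\<Sum>a\<in>UNIV. (T (axis j 1) $ a) *\<^sub>R axis a 1)"
      by (rule finfo_bilinear[symmetric])
    also have "\<dots> = finfo x (T (axis i 1)) (T (axis j 1))"
      by (simp only: Ta[symmetric])
    finally show ?thesis .
  qed
  have "det (fisher x) = det ?D" by (rule det_orthogonal_congruence[OF T, symmetric])
  also have "\<dots> = (\<Prod>i\<in>UNIV. ?D $ i $ i)" by (rule det_diagonal) (simp add: D f)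
  also have "\<dots> = (\<Prod>i\<in>UNIV. if i = k then zeta 2 (norm x) else zeta 0 (norm x))" by (simp add: D f)
  also have "\<dots> = zeta 2 (norm x) * (\<Prod>i\<in>UNIV - {k}. if i = k then zeta 2 (norm x) else zeta 0 (norm x))"
    by (subst prod.remove[of _ k]) auto
  also have "(\<Prod>i\<in>UNIV - {k}. if i = k then zeta 2 (norm x) else zeta 0 (norm x)) = (\<Prod>i\<in>UNIV - {k}. zeta 0 (norm x))"
    by (intro prod.cong) auto
  finally show ?thesis by (simp add: card_Diff_singleton)
qed

text \<open>The square root of the Fisher determinant at radius r, see
  \<open>sqrt_det_fisher\<close>: the Jeffreys density before normalisation.\<close>

definition jeffreys_weight :: "nat \<Rightarrow> real \<Rightarrow> real" where
  "jeffreys_weight n r = zeta 0 r powr ((real n - 1) / 2) * zeta 2 r powr (1/2)"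

lemma jeffreys_weight_pos [simp]: "jeffreys_weight n r > 0"
  using zeta_0_pos[of r] zeta_2_pos[of r] by (simp add: jeffreys_weight_def)

lemma jeffreys_weight_ne_0 [simp]: "jeffreys_weight n r \<noteq> 0" using jeffreys_weight_pos[of n r] by linarith

lemma jeffreys_weight_nonneg [simp]: "jeffreys_weight n r \<ge> 0" using jeffreys_weight_pos[of n r] by linarith

lemma continuous_on_jeffreys_weight: "continuous_on A (jeffreys_weight n)"
  unfolding jeffreys_weight_def using zeta_0_pos zeta_2_pos
  by (intro continuous_on_mult continuous_on_powr continuous_on_zeta_0 continuous_on_zeta_2 continuous_on_const)
    (metis less_irrefl)+

lemma jeffreys_weight_measurable [measurable]: "jeffreys_weight n \<in> borel_measurable borel"
  by (intro borel_measurable_continuous_onI continuous_on_jeffreys_weight)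

lemma sqrt_det_fisher:
  fixes x :: "real^'n::finite"
  shows "sqrt (det (fisher x)) = jeffreys_weight CARD('n) (norm x)"
proof -
  let ?n = "CARD('n)"
  have n: "real (?n - 1) = real ?n - 1" by (simp add: of_nat_diff Suc_leI)
  have "zeta 0 (norm x) ^ (?n - 1) = zeta 0 (norm x) powr (real ?n - 1)"
    using powr_realpow[OF zeta_0_pos[of "norm x"], of "?n - 1"] n by simp
  then have "sqrt (zeta 0 (norm x) ^ (?n - 1)) = zeta 0 (norm x) powr ((real ?n - 1) / 2)"
    by (simp add: powr_half_sqrt[symmetric] powr_powr)
  moreover have "sqrt (zeta 2 (norm x)) = zeta 2 (norm x) powr (1/2)"
    by (rule powr_half_sqrt[symmetric]) (use zeta_2_pos[of "norm x"] in linarith)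
  ultimately show ?thesis by (simp add: det_fisher jeffreys_weight_def real_sqrt_mult)
qed

subsection \<open>Polar coordinates\<close>

text \<open>Both measures are determined by their values on half-lines. There the left side is the
  volume of a ball, and the right-hand density is the derivative of \<open>V * r ^ n\<close> with V
  the volume of the unit ball.\<close>

lemma lborel_distr_norm:
  "distr (lborel :: 'a::euclidean_space measure) borel norm =
     density lborel (\<lambda>r. ennreal (indicator {0..} r * real DIM('a) * unit_ball_vol (real DIM('a)) * r ^ (DIM('a) - 1)))"
    (is "?L = density lborel ?k")
proof (rule measure_eqI_generator_eq)
  let ?E = "range (\<lambda>a::real. {..a})"
  show "Int_stable ?E" by (auto simp: Int_stable_def min_def intro!: exI[of _ "min _ _"])
  show "?E \<subseteq> Pow UNIV" by simp
  have "sets (borel::real measure) = sigma_sets UNIV ?E"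
    by (subst borel_eq_atMost) simp
  then show "sets ?L = sigma_sets UNIV ?E" "sets (density lborel ?k) = sigma_sets UNIV ?E" by simp_all
  show "range (\<lambda>i::nat. {..real i}) \<subseteq> ?E" by auto
  show "(\<Union>i::nat. {..real i}) = UNIV" using real_arch_simple by auto
  have L: "emeasure ?L {..a} = emeasure lborel (cball (0::'a) a)" for a
    by (subst emeasure_distr) (auto intro!: arg_cong[where f = "emeasure lborel"])
  show "emeasure ?L {..real i} \<noteq> \<infinity>" for i :: nat by (simp add: L emeasure_cball)
  fix X assume "X \<in> ?E"
  then obtain a where X: "X = {..a}" by auto
  show "emeasure ?L X = emeasure (density lborel ?k) X"
  proof (cases "a \<ge> 0")
    case True
    let ?n = "DIM('a)" let ?V = "unit_ball_vol (real DIM('a))"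
    have "emeasure (density lborel ?k) {..a} = (\<integral>\<^sup>+r. ennreal (real ?n * ?V * r ^ (?n - 1)) * indicator {0..a} r \<partial>lborel)"
      by (subst emeasure_density) (auto intro!: nn_integral_cong split: split_indicator)
    also have "\<dots> = ennreal (?V * a ^ ?n - ?V * 0 ^ ?n)"
    proof (rule nn_integral_FTC_Icc[where F = "\<lambda>r. ?V * r ^ ?n"])
      fix r :: real
      show "((\<lambda>r. ?V * r ^ ?n) has_real_derivative real ?n * ?V * r ^ (?n - 1)) (at r)"
        by (auto intro!: derivative_eq_intros)
    qed (use True in \<open>auto intro!: mult_nonneg_nonneg unit_ball_vol_nonneg\<close>)
    also have "\<dots> = emeasure ?L {..a}" using True by (simp add: L emeasure_cball)
    finally show ?thesis unfolding X by simp
  next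
    case False
    have "emeasure (density lborel ?k) {..a} = (\<integral>\<^sup>+r. ?k r * indicator {..a} r \<partial>lborel)"
      by (rule emeasure_density) auto
    also have "\<dots> = (\<integral>\<^sup>+(r::real). 0 \<partial>lborel)"
      by (rule nn_integral_cong) (use False in \<open>auto split: split_indicator\<close>)
    finally have "emeasure (density lborel ?k) {..a} = 0" by simp
    with False show ?thesis unfolding X by (simp add: L)
  qed
qed

lemma vol_ball_eq: "vol_ball n = unit_ball_vol (real n)"
  by (simp add: vol_ball_def unit_ball_vol_def)

text \<open>The normalising constant of Jeffreys' prior on the ball of radius R. It is kept as a
  function of R because the upper bound varies the radius.\<close>

definition jeffreys_mass :: "nat \<Rightarrow> real \<Rightarrow> real" where
  "jeffreys_mass n R = vol_ball n * (LINT r:{0..R}|lborel. jeffreys_weight n r * real n * r ^ (n - 1))"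

lemma alpha_eq_jeffreys_mass: "alpha snr n * vol_ball n = jeffreys_mass n (sqrt snr)"
  by (simp add: alpha_def jeffreys_mass_def jeffreys_weight_def)

lemma integral_jeffreys_weight_norm:
  "(LINT x:cball 0 R|lborel. jeffreys_weight n (norm (x::real^'n::finite))) = jeffreys_mass n R" if n: "n = CARD('n)"
proof -
  have "(LINT x:cball 0 R|lborel. jeffreys_weight n (norm (x::real^'n))) = (\<integral>x. (\<lambda>r. indicator {..R} r * jeffreys_weight n r) (norm (x::real^'n)) \<partial>lborel)"
    unfolding set_lebesgue_integral_def by (intro Bochner_Integration.integral_cong) (auto split: split_indicator)
  also have "\<dots> = (\<integral>r. indicator {..R} r * jeffreys_weight n r \<partial>(distr (lborel :: (real^'n) measure) borel norm))"
    by (rule integral_distr[symmetric]) auto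
  also have "\<dots> = (\<integral>r. (indicator {0..} r * real n * unit_ball_vol (real n) * r ^ (n - 1)) * (indicator {..R} r * jeffreys_weight n r) \<partial>lborel)"
    unfolding lborel_distr_norm n
    by (subst integral_density) (auto intro!: mult_nonneg_nonneg unit_ball_vol_nonneg simp: zero_le_power split: split_indicator)
  also have "\<dots> = (\<integral>r. unit_ball_vol (real n) * (indicator {0..R} r *\<^sub>R (jeffreys_weight n r * real n * r ^ (n - 1))) \<partial>lborel)"
    by (intro Bochner_Integration.integral_cong) (auto split: split_indicator)
  also have "\<dots> = jeffreys_mass n R" unfolding jeffreys_mass_def set_lebesgue_integral_def vol_ball_eq by simp
  finally show ?thesis .
qed

lemma jeffreys_density_eq:
  fixes x :: "real^'n::finite"
  shows "jeffreys_density snr x = indicator (cball 0 (sqrt snr)) x * jeffreys_weight CARD('n) (norm x) / jeffreys_mass CARD('n) (sqrt snr)"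
  unfolding jeffreys_density_def sqrt_det_fisher integral_jeffreys_weight_norm[OF refl] ..

lemma jeffreys_density_measurable [measurable]:
  "jeffreys_density snr \<in> borel_measurable (borel :: (real^'n::finite) measure)"
  unfolding jeffreys_density_eq[abs_def]
  by (intro borel_measurable_divide borel_measurable_times borel_measurable_indicator) auto

lemma set_integrable_jeffreys_weight_norm: "set_integrable lborel (cball 0 R) (\<lambda>x::real^'n::finite. jeffreys_weight n (norm x))"
  unfolding set_integrable_def
  by (intro borel_integrable_compact compact_cball continuous_on_compose2[OF continuous_on_jeffreys_weight[of UNIV]] continuous_intros) auto

lemma set_integrable_jeffreys_weight_radial: "set_integrable lborel {0..R} (\<lambda>r. jeffreys_weight n r * real n * r ^ (n - 1))"
  unfolding set_integrable_def
  by (intro borel_integrable_compact continuous_intros continuous_on_jeffreys_weight) auto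

lemma jeffreys_mass_pos:
  assumes "R > 0" "n > 0"
  shows "jeffreys_mass n R > 0"
proof -
  let ?f = "\<lambda>r. indicator {0..R} r * (jeffreys_weight n r * real n * r ^ (n - 1))"
  have i: "integrable lborel ?f" using set_integrable_jeffreys_weight_radial[of R n] by (simp add: set_integrable_def)
  have nn: "?f r \<ge> 0" for r by (auto split: split_indicator)
  have "(\<integral>r. ?f r \<partial>lborel) \<noteq> 0"
  proof
    assume "(\<integral>r. ?f r \<partial>lborel) = 0"
    then have "AE r in lborel. ?f r = 0"
      by (subst (asm) integral_nonneg_eq_0_iff_AE) (use i nn in auto)
    then have "AE r in lborel. r \<notin> {0<..R}"
    proof eventually_elim
      case (elim r)
      have "jeffreys_weight n r * real n * r ^ (n - 1) \<noteq> 0" if "r > 0" using that assms jeffreys_weight_pos[of n r] by simp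
      with elim show ?case by (auto split: split_indicator_asm)
    qed
    then have "emeasure lborel {0<..R} = 0"
      by (subst (asm) AE_iff_measurable[where N = "{0<..R}"]) auto
    then show False using assms by simp
  qed
  moreover have "(\<integral>r. ?f r \<partial>lborel) \<ge> 0" using nn by (intro integral_nonneg_AE) auto
  moreover have "vol_ball n > 0" unfolding vol_ball_eq by simp
  ultimately show ?thesis unfolding jeffreys_mass_def set_lebesgue_integral_def by simp
qed

lemma prob_space_jeffreys:
  assumes "snr > 0"
  shows "prob_space (jeffreys snr :: (real^'n::finite) measure)"
proof
  let ?c = "jeffreys_mass CARD('n) (sqrt snr)"
  have c: "?c > 0" using assms by (intro jeffreys_mass_pos) auto
  have i: "integrable lborel (\<lambda>x::real^'n. indicator (cball 0 (sqrt snr)) x * jeffreys_weight CARD('n) (norm x))"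
    using set_integrable_jeffreys_weight_norm[of "sqrt snr" "CARD('n)", where ?'n = 'n] by (simp add: set_integrable_def)
  have "emeasure (jeffreys snr) (space (jeffreys snr :: (real^'n) measure)) =
      (\<integral>\<^sup>+(x::real^'n). ennreal (jeffreys_density snr x) \<partial>lborel)"
    unfolding jeffreys_def by (subst emeasure_density) auto
  also have "\<dots> = ennreal (\<integral>x. jeffreys_density snr (x::real^'n) \<partial>lborel)"
    unfolding jeffreys_density_eq
    by (rule nn_integral_eq_integral) (use i c in auto)
  also have "(\<integral>x. jeffreys_density snr (x::real^'n) \<partial>lborel) = ?c / ?c"
    unfolding jeffreys_density_eq using integral_jeffreys_weight_norm[of "CARD('n)" "sqrt snr", where ?'n = 'n]
    by (simp add: set_lebesgue_integral_def)
  finally show "emeasure (jeffreys snr) (space (jeffreys snr :: (real^'n) measure)) = 1" using c by simp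
qed

lemma jeffreys_in_input_dists:
  assumes "snr > 0"
  shows "(jeffreys snr :: (real^'n::finite) measure) \<in> input_dists snr"
proof -
  have "AE x in (jeffreys snr :: (real^'n) measure). norm x \<le> sqrt snr"
    unfolding jeffreys_def
    by (subst AE_density, measurable) (auto simp: jeffreys_density_eq split: split_indicator)
  moreover have "sets (jeffreys snr :: (real^'n) measure) = sets borel" by (simp add: jeffreys_def)
  ultimately show ?thesis
    using prob_space_jeffreys[OF assms, where 'n = 'n] by (simp add: input_dists_def)
qed

lemma jeffreys_density_orthogonal:
  fixes x :: "real^'n::finite" and f :: "real^'n \<Rightarrow> real^'n"
  assumes "orthogonal_transformation f"
  shows "jeffreys_density snr (f x) = jeffreys_density snr x"
  unfolding jeffreys_density_eq using orthogonal_transformation_norm[OF assms, of x]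
  by (simp add: indicator_def)

lemma jeffreys_distr_norm:
  assumes "snr > 0"
  shows "distr (jeffreys snr :: (real^'n::finite) measure) borel norm
           = density lborel (\<lambda>r. ennreal (mag_density snr CARD('n) r))"
proof -
  let ?n = "CARD('n)" let ?R = "sqrt snr"
  let ?g = "\<lambda>r. indicator {..?R} r * jeffreys_weight ?n r / jeffreys_mass ?n ?R"
  let ?k = "\<lambda>r. indicator {0..} r * real DIM(real^'n) * unit_ball_vol (real DIM(real^'n)) * r ^ (DIM(real^'n) - 1)"
  have c: "jeffreys_mass ?n ?R > 0" using assms by (intro jeffreys_mass_pos) auto
  have V: "vol_ball ?n > 0" unfolding vol_ball_eq by simp
  have "distr (jeffreys snr :: (real^'n) measure) borel norm = distr (density lborel (\<lambda>x::real^'n. ennreal (?g (norm x)))) borel norm"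
    unfolding jeffreys_def jeffreys_density_eq by (simp add: indicator_def)
  also have "\<dots> = density (distr (lborel::(real^'n) measure) borel norm) (\<lambda>r. ennreal (?g r))"
    by (rule density_distr[symmetric]) auto
  also have "\<dots> = density lborel (\<lambda>r. ennreal (?k r) * ennreal (?g r))"
    unfolding lborel_distr_norm by (rule density_density_eq) auto
  also have "\<dots> = density lborel (\<lambda>r. ennreal (mag_density snr ?n r))"
  proof (intro arg_cong[where f = "density lborel"] ext)
    fix r :: real
    have k: "?k r \<ge> 0" by (auto split: split_indicator)
    let ?I = "LINT s:{0..?R}|lborel. mag_weight ?n s"
    have mw: "mag_weight ?n s = jeffreys_weight ?n s * s ^ (?n - 1)" for s by (simp add: mag_weight_def jeffreys_weight_def)
    have "(LINT s:{0..?R}|lborel. jeffreys_weight ?n s * real ?n * s ^ (?n - 1)) = (LINT s:{0..?R}|lborel. real ?n * mag_weight ?n s)"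
      by (simp add: mw mult_ac)
    \<comment> \<open>The factor \<open>vol_ball n * n\<close> of the radial measure also occurs in
      the total mass and cancels.\<close>
    then have I: "jeffreys_mass ?n ?R = vol_ball ?n * (real ?n * ?I)" by (simp add: jeffreys_mass_def)
    have "?k r * ?g r = mag_density snr ?n r"
      unfolding mag_density_def I mw using V by (auto simp: vol_ball_eq[symmetric] field_simps split: split_indicator)
    moreover have "?g r \<ge> 0" using c by (auto split: split_indicator)
    ultimately show "ennreal (?k r) * ennreal (?g r) = ennreal (mag_density snr ?n r)"
      using k by (simp add: ennreal_mult[symmetric])
  qed
  finally show ?thesis .
qed

subsection \<open>Moments of sums of independent copies\<close>

context prob_space
begin

abbreviation iid :: "nat \<Rightarrow> (nat \<Rightarrow> 'a) measure" where
  "iid N \<equiv> PiM {..<N} (\<lambda>_. M)"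

lemma prob_space_iid: "prob_space (iid N)"
  by (rule prob_space_PiM) (rule prob_space_axioms)

lemma iid_component_measurable [measurable]: "i < N \<Longrightarrow> (\<lambda>\<omega>. \<omega> i) \<in> measurable (iid N) M"
  by (rule measurable_component_singleton) simp

lemma integrable_iid_component:
  fixes f :: "'a \<Rightarrow> 'b::{banach, second_countable_topology}"
  assumes "integrable M f" "i < N"
  shows "integrable (iid N) (\<lambda>\<omega>. f (\<omega> i))"
proof -
  have "distr (iid N) M (\<lambda>\<omega>. \<omega> i) = M"
    by (rule distr_PiM_component) (use assms prob_space_axioms in auto)
  then have "integrable (distr (iid N) M (\<lambda>\<omega>. \<omega> i)) f" using assms by simp
  then show ?thesis by (rule integrable_distr[rotated]) (use assms in measurable)
qed

lemma integral_iid_component: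
  fixes f :: "'a \<Rightarrow> 'b::{banach, second_countable_topology}"
  assumes [measurable]: "f \<in> borel_measurable M" and "i < N"
  shows "(\<integral>\<omega>. f (\<omega> i) \<partial>iid N) = (\<integral>x. f x \<partial>M)"
proof -
  have "distr (iid N) M (\<lambda>\<omega>. \<omega> i) = M"
    by (rule distr_PiM_component) (use assms prob_space_axioms in auto)
  then have "(\<integral>x. f x \<partial>M) = (\<integral>x. f x \<partial>distr (iid N) M (\<lambda>\<omega>. \<omega> i))" by simp
  also have "\<dots> = (\<integral>\<omega>. f (\<omega> i) \<partial>iid N)"
    by (rule integral_distr) (use assms in measurable)
  finally show ?thesis by simp
qed

lemma integral_iid_Suc:
  fixes f :: "_ \<Rightarrow> real"
  assumes "integrable (iid (Suc N)) f"
  shows "(\<integral>\<omega>. f \<omega> \<partial>iid (Suc N)) = (\<integral>\<omega>. (\<integral>y. f (fun_upd \<omega> N y) \<partial>M) \<partial>iid N)"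
proof -
  interpret product_sigma_finite "\<lambda>_::nat. M" by standard
  show ?thesis
    using product_integral_insert[of "{..<N}" N f] assms by (simp add: lessThan_Suc)
qed

lemma integral_iid_prod:
  fixes f :: "'a \<Rightarrow> 'b::{real_normed_field, banach, second_countable_topology}"
  assumes "integrable M f"
  shows "(\<integral>\<omega>. (\<Prod>i<N. f (\<omega> i)) \<partial>iid N) = (\<integral>x. f x \<partial>M) ^ N"
    and "integrable (iid N) (\<lambda>\<omega>. \<Prod>i<N. f (\<omega> i))"
proof -
  interpret product_sigma_finite "\<lambda>_::nat. M" by standard
  show "(\<integral>\<omega>. (\<Prod>i<N. f (\<omega> i)) \<partial>iid N) = (\<integral>x. f x \<partial>M) ^ N"
    using product_integral_prod[of "{..<N}" "\<lambda>_. f"] assms by simp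
  show "integrable (iid N) (\<lambda>\<omega>. \<Prod>i<N. f (\<omega> i))"
    using product_integrable_prod[of "{..<N}" "\<lambda>_. f"] assms by simp
qed

text \<open>The sum is at most N times its largest term. The estimate is crude and serves
  integrability only.\<close>

lemma power_sum_le:
  fixes a :: "nat \<Rightarrow> real"
  assumes p: "p > 0"
  shows "\<bar>\<Sum>i<N. a i\<bar> ^ p \<le> real N ^ p * (\<Sum>i<N. \<bar>a i\<bar> ^ p)"
proof (cases "N = 0")
  case False
  define m where "m = Max ((\<lambda>i. \<bar>a i\<bar>) ` {..<N})"
  have m: "\<bar>a i\<bar> \<le> m" if "i < N" for i unfolding m_def using that by (intro Max_ge) auto
  have "m \<in> (\<lambda>i. \<bar>a i\<bar>) ` {..<N}" unfolding m_def by (rule Max_in) (use False in auto)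
  then obtain j where j: "j < N" "m = \<bar>a j\<bar>" by auto
  have "\<bar>\<Sum>i<N. a i\<bar> \<le> (\<Sum>i<N. \<bar>a i\<bar>)" by (rule sum_abs)
  also have "\<dots> \<le> (\<Sum>i<N. m)" using m by (intro sum_mono) auto
  finally have "\<bar>\<Sum>i<N. a i\<bar> ^ p \<le> (real N * m) ^ p" by (intro power_mono) auto
  also have "\<dots> = real N ^ p * \<bar>a j\<bar> ^ p" by (simp add: j(2) power_mult_distrib)
  also have "\<bar>a j\<bar> ^ p \<le> (\<Sum>i<N. \<bar>a i\<bar> ^ p)" using j(1) by (intro member_le_sum) auto
  finally show ?thesis by (simp add: mult_left_mono)
qed (use p in \<open>auto simp: zero_power\<close>)

lemma integrable_iid_sum_power:
  fixes a :: "'a \<Rightarrow> real"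
  assumes [measurable]: "a \<in> borel_measurable M" and p: "integrable M (\<lambda>x. \<bar>a x\<bar> ^ p)"
  shows "integrable (iid N) (\<lambda>\<omega>. (\<Sum>i<N. a (\<omega> i)) ^ p)"
proof (cases "p = 0")
  case True
  interpret iid: prob_space "iid N" by (rule prob_space_iid)
  show ?thesis using True by simp
next
  case False
  show ?thesis
  proof (rule Bochner_Integration.integrable_bound)
    show "integrable (iid N) (\<lambda>\<omega>. real N ^ p * (\<Sum>i<N. \<bar>a (\<omega> i)\<bar> ^ p))"
      by (intro integrable_mult_right Bochner_Integration.integrable_sum integrable_iid_component[OF p]) auto
    show "AE \<omega> in iid N. norm ((\<Sum>i<N. a (\<omega> i)) ^ p) \<le> norm (real N ^ p * (\<Sum>i<N. \<bar>a (\<omega> i)\<bar> ^ p))"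
      using power_sum_le[where N = N and p = p] False by (intro AE_I2) (auto simp: power_abs abs_mult sum_nonneg)
  qed measurable
qed

lemma integrable_lower_power:
  fixes a :: "'a \<Rightarrow> real"
  assumes [measurable]: "a \<in> borel_measurable M" and p: "integrable M (\<lambda>x. \<bar>a x\<bar> ^ p)" and "q \<le> p"
  shows "integrable M (\<lambda>x. \<bar>a x\<bar> ^ q)" "integrable M (\<lambda>x. a x ^ q)"
proof -
  have "norm (\<bar>t\<bar> ^ q) \<le> norm (1 + \<bar>t\<bar> ^ p)" for t :: real
  proof (cases "\<bar>t\<bar> \<le> 1")
    case True
    then have "\<bar>t\<bar> ^ q \<le> 1" by (intro power_le_one) auto
    then show ?thesis by (simp add: add_increasing2)
  next
    case False
    then have "\<bar>t\<bar> ^ q \<le> \<bar>t\<bar> ^ p" using \<open>q \<le> p\<close> by (intro power_increasing) auto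
    then show ?thesis by simp
  qed
  then show 1: "integrable M (\<lambda>x. \<bar>a x\<bar> ^ q)"
    by (intro Bochner_Integration.integrable_bound[OF Bochner_Integration.integrable_add[OF integrable_const[of 1] p]]) auto
  then show "integrable M (\<lambda>x. a x ^ q)"
    by (rule Bochner_Integration.integrable_bound) (auto simp: power_abs)
qed

lemma iid_sum_mean:
  assumes "integrable M a" "(\<integral>x. a x \<partial>M) = 0"
  shows "(\<integral>\<omega>. (\<Sum>i<N. a (\<omega> i)) \<partial>iid N) = (0::real)"
  using assms by (simp add: integrable_iid_component integral_iid_component)

text \<open>Induction on the number of copies: the cross term is linear in the new copy and vanishes
  in the mean.\<close>

lemma iid_sum_second_moment:
  fixes a :: "'a \<Rightarrow> real"
  assumes [measurable]: "a \<in> borel_measurable M" and i2: "integrable M (\<lambda>x. \<bar>a x\<bar> ^ 2)" and 0: "(\<integral>x. a x \<partial>M) = 0"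
  shows "(\<integral>\<omega>. (\<Sum>i<N. a (\<omega> i))^2 \<partial>iid N) = real N * (\<integral>x. (a x)^2 \<partial>M)"
proof (induction N)
  case 0
  interpret iid: prob_space "iid 0" by (rule prob_space_iid)
  show ?case by simp
next
  case (Suc N)
  interpret iid: prob_space "iid N" by (rule prob_space_iid)
  let ?S = "\<lambda>\<omega>. \<Sum>i<N. a (\<omega> i)"
  have ia: "integrable M a" "integrable M (\<lambda>x. (a x)^2)"
    using integrable_lower_power[OF _ i2, of 1] integrable_lower_power[OF _ i2, of 2] by simp_all
  have iS: "integrable (iid N) ?S" "integrable (iid N) (\<lambda>\<omega>. (?S \<omega>)^2)"
    using integrable_iid_sum_power[of a 1 N] integrable_iid_sum_power[of a 2 N] ia i2 by simp_all
  have "(\<integral>\<omega>. (\<Sum>i<Suc N. a (\<omega> i))^2 \<partial>iid (Suc N)) =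
      (\<integral>\<omega>. (\<integral>y. (\<Sum>i<Suc N. a (fun_upd \<omega> N y i))^2 \<partial>M) \<partial>iid N)"
    by (rule integral_iid_Suc[OF integrable_iid_sum_power[OF _ i2]]) measurable
  also have "\<dots> = (\<integral>\<omega>. (\<integral>y. (?S \<omega>)^2 + 2 * ?S \<omega> * a y + (a y)^2 \<partial>M) \<partial>iid N)"
    by (intro Bochner_Integration.integral_cong refl) (simp add: power2_eq_square algebra_simps)
  also have "\<dots> = (\<integral>\<omega>. (?S \<omega>)^2 + (\<integral>x. (a x)^2 \<partial>M) \<partial>iid N)"
    using ia 0 by (simp add: prob_space)
  also have "\<dots> = real (Suc N) * (\<integral>x. (a x)^2 \<partial>M)"
    using iS Suc.IH by (simp add: iid.prob_space algebra_simps)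
  finally show ?case .
qed

lemma square_expectation_le:
  fixes a :: "'a \<Rightarrow> real"
  assumes "integrable M a" "integrable M (\<lambda>x. (a x)^2)"
  shows "(\<integral>x. a x \<partial>M)^2 \<le> (\<integral>x. (a x)^2 \<partial>M)"
proof -
  let ?m = "\<integral>x. a x \<partial>M"
  have "0 \<le> (\<integral>x. (a x - ?m)^2 \<partial>M)" by (intro integral_nonneg_AE) auto
  also have "\<dots> = (\<integral>x. (a x)^2 - 2 * ?m * a x + ?m^2 \<partial>M)"
    by (intro Bochner_Integration.integral_cong refl) (simp add: power2_eq_square algebra_simps)
  also have "\<dots> = (\<integral>x. (a x)^2 \<partial>M) - ?m^2"
    using assms by (simp add: prob_space power2_eq_square)
  finally show ?thesis by simp
qed

text \<open>When a copy is added, the terms of degree 1 in the new copy and of degree 1 in the old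
  sum vanish. The increment is \<open>6 * N * m2^2 + m4\<close>, at most
  \<open>(6 * N + 1) * m4\<close>, whereas \<open>3 * N^2\<close> grows by
  \<open>6 * N + 3\<close>.\<close>

lemma iid_sum_fourth_moment:
  fixes a :: "'a \<Rightarrow> real"
  assumes [measurable]: "a \<in> borel_measurable M" and i4: "integrable M (\<lambda>x. \<bar>a x\<bar> ^ 4)" and 0: "(\<integral>x. a x \<partial>M) = 0"
  shows "(\<integral>\<omega>. (\<Sum>i<N. a (\<omega> i))^4 \<partial>iid N) \<le> 3 * (real N)^2 * (\<integral>x. (a x)^4 \<partial>M)"
proof (induction N)
  case 0
  interpret iid: prob_space "iid 0" by (rule prob_space_iid)
  show ?case by simp
next
  case (Suc N)
  interpret iid: prob_space "iid N" by (rule prob_space_iid)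
  let ?S = "\<lambda>\<omega>. \<Sum>i<N. a (\<omega> i)"
  let ?m = "\<lambda>k. \<integral>x. (a x)^k \<partial>M"
  have ia: "integrable M (\<lambda>x. (a x)^k)" "integrable M (\<lambda>x. \<bar>a x\<bar>^k)" if "k \<le> 4" for k
    using integrable_lower_power[OF _ i4 that] by simp_all
  have iS: "integrable (iid N) (\<lambda>\<omega>. (?S \<omega>)^k)" if "k \<le> 4" for k
    using integrable_iid_sum_power[of a k N] ia[OF that] by simp
  have ia1: "integrable M a" using ia(1)[of 1] by simp
  have iS1: "integrable (iid N) ?S" using iS[of 1] by simp
  have "(\<integral>\<omega>. (\<Sum>i<Suc N. a (\<omega> i))^4 \<partial>iid (Suc N)) =
      (\<integral>\<omega>. (\<integral>y. (\<Sum>i<Suc N. a (fun_upd \<omega> N y i))^4 \<partial>M) \<partial>iid N)"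
    by (rule integral_iid_Suc[OF integrable_iid_sum_power[OF _ i4]]) measurable
  also have "\<dots> = (\<integral>\<omega>. (\<integral>y. (?S \<omega>)^4 + 4 * (?S \<omega>)^3 * a y + 6 * (?S \<omega>)^2 * (a y)^2
      + 4 * ?S \<omega> * (a y)^3 + (a y)^4 \<partial>M) \<partial>iid N)"
    by (intro Bochner_Integration.integral_cong refl) (simp add: eval_nat_numeral algebra_simps)
  also have "\<dots> = (\<integral>\<omega>. (?S \<omega>)^4 + 6 * (?S \<omega>)^2 * ?m 2 + 4 * ?S \<omega> * ?m 3 + ?m 4 \<partial>iid N)"
    using ia 0 ia1 by (simp add: prob_space)
  also have "\<dots> = (\<integral>\<omega>. (?S \<omega>)^4 \<partial>iid N) + 6 * (\<integral>\<omega>. (?S \<omega>)^2 \<partial>iid N) * ?m 2 + 4 * (\<integral>\<omega>. ?S \<omega> \<partial>iid N) * ?m 3 + ?m 4"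
    using iS[of 4] iS[of 2] iS1 by (simp add: iid.prob_space del: Bochner_Integration.integral_sum)
  also have "\<dots> = (\<integral>\<omega>. (?S \<omega>)^4 \<partial>iid N) + 6 * real N * (?m 2)^2 + ?m 4"
    using iid_sum_second_moment[OF _ ia(2) 0, of N] iid_sum_mean[OF ia1 0, of N] by (simp add: power2_eq_square)
  also have "\<dots> \<le> 3 * (real N)^2 * ?m 4 + 6 * real N * ?m 4 + ?m 4"
  proof -
    have "(?m 2)^2 \<le> (\<integral>x. ((a x)^2)^2 \<partial>M)"
      by (rule square_expectation_le) (use ia(1)[of 2] ia(1)[of 4] in \<open>simp_all flip: power_mult\<close>)
    then have "(?m 2)^2 \<le> ?m 4" by (simp flip: power_mult)
    then show ?thesis using Suc.IH by (intro add_mono mult_left_mono) auto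
  qed
  also have "\<dots> \<le> 3 * (real (Suc N))^2 * ?m 4"
  proof -
    have "?m 4 \<ge> 0" by (intro integral_nonneg_AE) auto
    then show ?thesis by (simp add: power2_eq_square algebra_simps)
  qed
  finally show ?case .
qed

text \<open>A law of large numbers in mean with rate \<open>1 / sqrt N\<close>, from the variance
  and \<open>square_expectation_le\<close>.\<close>

lemma iid_mean_abs_deviation:
  fixes a :: "'a \<Rightarrow> real"
  assumes [measurable]: "a \<in> borel_measurable M" and i2: "integrable M (\<lambda>x. \<bar>a x\<bar> ^ 2)" and 0: "(\<integral>x. a x \<partial>M) = 0" and N: "N > 0"
  shows "(\<integral>\<omega>. \<bar>(\<Sum>i<N. a (\<omega> i)) / real N\<bar> \<partial>iid N) \<le> sqrt (\<integral>x. (a x)^2 \<partial>M) / sqrt (real N)"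
proof -
  interpret iid: prob_space "iid N" by (rule prob_space_iid)
  let ?S = "\<lambda>\<omega>. \<Sum>i<N. a (\<omega> i)"
  have ia: "integrable M (\<lambda>x. \<bar>a x\<bar> ^ 1)" using integrable_lower_power[OF _ i2, of 1] by simp
  have iS: "integrable (iid N) ?S" "integrable (iid N) (\<lambda>\<omega>. (?S \<omega>)^2)"
    using integrable_iid_sum_power[OF _ ia, of N] integrable_iid_sum_power[OF _ i2, of N] by simp_all
  have "(\<integral>\<omega>. \<bar>?S \<omega>\<bar> \<partial>iid N)^2 \<le> (\<integral>\<omega>. \<bar>?S \<omega>\<bar>^2 \<partial>iid N)"
    by (rule iid.square_expectation_le) (use iS in auto)
  also have "\<dots> = real N * (\<integral>x. (a x)^2 \<partial>M)" using iid_sum_second_moment[OF _ i2 0, of N] by simp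
  finally have "(\<integral>\<omega>. \<bar>?S \<omega>\<bar> \<partial>iid N) \<le> sqrt (real N) * sqrt (\<integral>x. (a x)^2 \<partial>M)"
    by (simp add: real_le_rsqrt flip: real_sqrt_mult)
  then have "(\<integral>\<omega>. \<bar>?S \<omega>\<bar> \<partial>iid N) / real N \<le> sqrt (real N) * sqrt (\<integral>x. (a x)^2 \<partial>M) / real N"
    by (rule divide_right_mono) simp
  also have "\<dots> = sqrt (\<integral>x. (a x)^2 \<partial>M) / sqrt (real N)"
    using N by (simp add: field_simps)
  finally show ?thesis by simp
qed

end

subsection \<open>Folding the output signs into the channel vectors\<close>

lemma chan_H_eq_iid: "chan_H N = gauss.iid N"
  by (simp add: chan_H_def)

lemma prob_space_chan_H: "prob_space (chan_H N :: (nat \<Rightarrow> real^'n::finite) measure)"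
  unfolding chan_H_eq_iid by (rule gauss.prob_space_iid)

interpretation chan_H: prob_space "chan_H N :: (nat \<Rightarrow> real^'n::finite) measure" for N
  by (rule prob_space_chan_H)

lemma chan_H_component [measurable]:
  "i < N \<Longrightarrow> (\<lambda>K. K i) \<in> measurable (chan_H N) (borel :: (real^'n::finite) measure)"
  unfolding chan_H_eq_iid using gauss.iid_component_measurable[of i N] by simp

text \<open>The density, with respect to \<open>chan_H N\<close>, of the folded vectors \<open>K i = y i *\<^sub>R H i\<close>.\<close>
definition lik :: "nat \<Rightarrow> real^'n::finite \<Rightarrow> (nat \<Rightarrow> real^'n) \<Rightarrow> real" where
  "lik N x K = (\<Prod>i<N. 2 * Phi (K i \<bullet> x))"

lemma lik_pos [simp]: "lik N x K > 0" unfolding lik_def by (intro prod_pos) simp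

lemma lik_nonneg [simp]: "lik N x K \<ge> 0" using lik_pos[of N x K] by linarith

lemma lik_ne_0 [simp]: "lik N x K \<noteq> 0" using lik_pos[of N x K] by linarith

lemma lik_le: "lik N x K \<le> 2 ^ N"
proof -
  have "lik N x K \<le> (\<Prod>i<N. 2)" unfolding lik_def by (intro prod_mono) (auto simp: less_imp_le)
  then show ?thesis by simp
qed

lemma ln_lik: "ln (lik N x K) = (\<Sum>i<N. ln 2 + ln (Phi (K i \<bullet> x)))"
  unfolding lik_def by (subst ln_prod) (auto simp: ln_mult intro!: sum.cong)

lemma lik_measurable [measurable]:
  "(\<lambda>K. lik N x K) \<in> borel_measurable (chan_H N)"
  "(\<lambda>x. lik N x K) \<in> borel_measurable borel"
  unfolding lik_def by measurable

lemma lik_measurable_pair: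
  "(\<lambda>(x, K). lik N x K) \<in> borel_measurable (borel \<Otimes>\<^sub>M chan_H N)"
  "(\<lambda>(K, x). lik N x K) \<in> borel_measurable (chan_H N \<Otimes>\<^sub>M borel)"
  unfolding lik_def split_beta' by measurable

text \<open>Reflection of one vector exchanges \<open>Phi\<close> and \<open>1 - Phi\<close>, so the
  mean of \<open>Phi (k \<bullet> x)\<close> is 1/2 and each factor of the likelihood has mean
  1.\<close>

lemma integral_lik:
  fixes x :: "real^'n::finite"
  shows "(\<integral>K. lik N x K \<partial>chan_H N) = 1" "integrable (chan_H N) (lik N x)"
proof -
  have i: "integrable gauss_vec (\<lambda>k::real^'n. 2 * Phi (k \<bullet> x))"
    by (rule integrable_gauss_poly_bound[where C = 2 and p = 0]) (auto simp: less_imp_le)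
  have "(\<integral>k. Phi (k \<bullet> x) \<partial>gauss_vec) = (\<integral>k. Phi (- k \<bullet> x) \<partial>gauss_vec)"
    using integral_gauss_uminus[of "\<lambda>k. Phi (k \<bullet> x)"] by simp
  also have "\<dots> = (\<integral>k. 1 - Phi (k \<bullet> x) \<partial>gauss_vec)" by (simp add: Phi_minus)
  also have "\<dots> = 1 - (\<integral>k. Phi (k \<bullet> x) \<partial>gauss_vec)"
    using i by simp
  finally have "(\<integral>k. 2 * Phi (k \<bullet> x) \<partial>gauss_vec) = 1" by simp
  then show "(\<integral>K. lik N x K \<partial>chan_H N) = 1" "integrable (chan_H N) (lik N x)"
    using gauss.integral_iid_prod[OF i, of N] unfolding chan_H_eq_iid lik_def[abs_def] by simp_all
qed

text \<open>An integrable bound for the log-likelihood that is uniform over inputs of norm at most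
  R: the summand 1 covers \<open>ln 2\<close>, the rest comes from
  \<open>ln_Phi_abs_le\<close>.\<close>

definition llbound :: "nat \<Rightarrow> real \<Rightarrow> (nat \<Rightarrow> real^'n::finite) \<Rightarrow> real" where
  "llbound N R K = (\<Sum>i<N. 1 + 9 * (1 + R)^2 * (1 + norm (K i))^2)"

lemma llbound_nonneg [simp]: "llbound N R K \<ge> 0"
  unfolding llbound_def by (intro sum_nonneg) auto

lemma llbound_measurable [measurable]: "llbound N R \<in> borel_measurable (chan_H N)"
  unfolding llbound_def by measurable

lemma integrable_llbound: "integrable (chan_H N) (llbound N R :: (nat \<Rightarrow> real^'n::finite) \<Rightarrow> real)"
  unfolding llbound_def chan_H_eq_iid
  by (intro Bochner_Integration.integrable_sum gauss.integrable_iid_component) (auto intro!: integrable_gauss_poly)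

lemma abs_ln_lik_le:
  assumes "norm x \<le> R"
  shows "\<bar>ln (lik N x K)\<bar> \<le> llbound N R K"
  unfolding ln_lik llbound_def
proof (intro order_trans[OF sum_abs] sum_mono)
  fix i
  have "R \<ge> 0" using assms norm_ge_zero[of x] by linarith
  have "1 + \<bar>K i \<bullet> x\<bar> \<le> (1 + norm x) * (1 + norm (K i))" by (rule one_plus_inner_le)
  also have "\<dots> \<le> (1 + R) * (1 + norm (K i))" using assms by (intro mult_right_mono) auto
  finally have "(1 + \<bar>K i \<bullet> x\<bar>)^2 \<le> ((1 + R) * (1 + norm (K i)))^2" by (intro power_mono) auto
  then have "\<bar>ln (Phi (K i \<bullet> x))\<bar> \<le> 9 * (1 + R)^2 * (1 + norm (K i))^2"
    using ln_Phi_abs_le[of "K i \<bullet> x"] unfolding power_mult_distrib by linarith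
  moreover have "\<bar>ln 2 :: real\<bar> \<le> 1" using ln_2_less_1 by simp
  ultimately show "\<bar>ln 2 + ln (Phi (K i \<bullet> x))\<bar> \<le> 1 + 9 * (1 + R)^2 * (1 + norm (K i))^2" by linarith
qed

section \<open>Mixtures over the input and divergences from them\<close>

definition mix :: "nat \<Rightarrow> (real^'n::finite) measure \<Rightarrow> (nat \<Rightarrow> real^'n) \<Rightarrow> real" where
  "mix N mu K = (\<integral>x. lik N x K \<partial>mu)"

text \<open>The divergence, in nats, of the law of N folded vectors at input \<open>x\<close> from
  the mixture of these laws under \<open>mu\<close>.\<close>

definition KL :: "nat \<Rightarrow> (real^'n::finite) measure \<Rightarrow> real^'n \<Rightarrow> real" where
  "KL N mu x = (\<integral>K. lik N x K * ln (lik N x K / mix N mu K) \<partial>chan_H N)"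

text \<open>The radius is a free parameter, so that the same facts serve the channel inputs and the
  comparison priors on a larger ball.\<close>

locale peak_input = prob_space mu for mu :: "(real^'n::finite) measure" +
  fixes R :: real
  assumes sets_mu [measurable_cong]: "sets mu = sets borel"
    and AE_norm: "AE x in mu. norm x \<le> R"
begin

lemma space_mu [simp]: "space mu = UNIV"
  using sets_eq_imp_space_eq[OF sets_mu] by simp

lemma prob_UNIV [simp]: "prob UNIV = 1"
  using prob_space by simp

lemma lik_measurable_mu [measurable]: "(\<lambda>x. lik N x K) \<in> borel_measurable mu"
  using lik_measurable(2) by (simp add: measurable_cong_sets[OF sets_mu refl])

lemma integrable_lik: "integrable mu (\<lambda>x. lik N x K)"
  by (rule integrable_const_bound[of _ "2 ^ N"]) (auto simp: lik_le)

lemma mix_measurable [measurable]: "mix N mu \<in> borel_measurable (chan_H N)"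
  unfolding mix_def
  by (rule borel_measurable_lebesgue_integral) (use lik_measurable_pair(2) in measurable)

lemma mix_ge: "mix N mu K \<ge> exp (- llbound N R K)"
proof -
  have "(\<integral>x. exp (- llbound N R K) \<partial>mu) \<le> (\<integral>x. lik N x K \<partial>mu)"
  proof (rule integral_mono_AE[OF _ integrable_lik])
    show "AE x in mu. exp (- llbound N R K) \<le> lik N x K"
      using AE_norm
    proof eventually_elim
      case (elim x)
      have "- llbound N R K \<le> ln (lik N x K)" using abs_ln_lik_le[OF elim, of N K] by linarith
      then show ?case using ln_ge_iff[OF lik_pos] by blast
    qed
  qed simp
  then show ?thesis by (simp add: mix_def prob_space)
qed

lemma mix_le: "mix N mu K \<le> exp (llbound N R K)"
proof -
  have "(\<integral>x. lik N x K \<partial>mu) \<le> (\<integral>x. exp (llbound N R K) \<partial>mu)"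
  proof (rule integral_mono_AE[OF integrable_lik])
    show "AE x in mu. lik N x K \<le> exp (llbound N R K)"
      using AE_norm
    proof eventually_elim
      case (elim x)
      have "ln (lik N x K) \<le> llbound N R K" using abs_ln_lik_le[OF elim, of N K] by linarith
      then show ?case by (metis exp_le_cancel_iff exp_ln lik_pos)
    qed
  qed simp
  then show ?thesis by (simp add: mix_def prob_space)
qed

lemma mix_pos [simp]: "mix N mu K > 0"
  using mix_ge[of N K] by (meson exp_gt_zero less_le_trans)

lemma mix_nonneg [simp]: "mix N mu K \<ge> 0" using mix_pos[of N K] by linarith

lemma mix_ne_0 [simp]: "mix N mu K \<noteq> 0" using mix_pos[of N K] by linarith

lemma mix_le_2: "mix N mu K \<le> 2 ^ N"
proof -
  have "(\<integral>x. lik N x K \<partial>mu) \<le> (\<integral>x. 2 ^ N \<partial>mu)"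
    by (rule integral_mono[OF integrable_lik]) (auto simp: lik_le)
  then show ?thesis by (simp add: mix_def prob_space)
qed

lemma abs_ln_mix_le: "\<bar>ln (mix N mu K)\<bar> \<le> llbound N R K"
proof -
  have "ln (mix N mu K) \<le> llbound N R K"
    using mix_le[of N K] by (metis ln_exp ln_le_cancel_iff exp_gt_zero mix_pos)
  moreover have "- llbound N R K \<le> ln (mix N mu K)"
    using mix_ge[of N K] by (metis ln_exp ln_le_cancel_iff exp_gt_zero mix_pos)
  ultimately show ?thesis by linarith
qed

lemma abs_kl_integrand_le:
  assumes "norm x \<le> R"
  shows "\<bar>lik N x K * ln (lik N x K / mix N mu K)\<bar> \<le> 2 ^ N * (2 * llbound N R K)"
proof -
  have "\<bar>ln (lik N x K / mix N mu K)\<bar> \<le> 2 * llbound N R K"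
    using abs_ln_mix_le[of N K] abs_ln_lik_le[OF assms, of N K] by (simp add: ln_div)
  then show ?thesis unfolding abs_mult
    by (intro mult_mono) (auto simp: lik_le llbound_nonneg)
qed

lemma kl_integrand_measurable_pair:
  "(\<lambda>(x, K). lik N x K * ln (lik N x K / mix N mu K)) \<in> borel_measurable (mu \<Otimes>\<^sub>M chan_H N)"
proof -
  note [measurable] = lik_measurable_pair(1)[unfolded split_beta']
  show ?thesis unfolding split_beta' by measurable
qed

lemma integrable_kl_integrand:
  assumes "norm x \<le> R"
  shows "integrable (chan_H N) (\<lambda>K. lik N x K * ln (lik N x K / mix N mu K))"
proof (rule Bochner_Integration.integrable_bound)
  show "integrable (chan_H N) (\<lambda>K. 2 ^ N * (2 * llbound N R K))"
    by (intro integrable_mult_right integrable_llbound)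
qed (use abs_kl_integrand_le[OF assms] llbound_nonneg in \<open>auto simp: abs_mult\<close>)

lemma KL_measurable [measurable]: "KL N mu \<in> borel_measurable mu"
  unfolding KL_def
  by (rule chan_H.borel_measurable_lebesgue_integral) (rule kl_integrand_measurable_pair)

end

sublocale peak_input \<subseteq> pair: pair_sigma_finite mu "chan_H N" for N ..

lemma (in peak_input) integrable_kl_integrand_pair:
  fixes nu :: "(real^'n) measure"
  assumes "peak_input nu R'" and "R \<le> R'"
  shows "integrable (mu \<Otimes>\<^sub>M chan_H N) (\<lambda>(x, K). lik N x K * ln (lik N x K / mix N nu K))"
proof -
  interpret nu: peak_input nu R' by fact
  note [measurable] = lik_measurable_pair(1)[unfolded split_beta']
  have s: "sets (nu \<Otimes>\<^sub>M chan_H N) = sets (mu \<Otimes>\<^sub>M chan_H N)"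
    by (intro sets_pair_measure_cong) (simp_all add: sets_mu nu.sets_mu)
  have meas: "(\<lambda>(x, K). lik N x K * ln (lik N x K / mix N nu K)) \<in> borel_measurable (mu \<Otimes>\<^sub>M chan_H N)"
    using nu.kl_integrand_measurable_pair[of N] by (simp add: measurable_cong_sets[OF s refl])
  have ib: "integrable (mu \<Otimes>\<^sub>M chan_H N) (\<lambda>(x, K). 2 ^ N * (2 * llbound N R' K))"
    unfolding split_beta'
    by (rule pair.Fubini_integrable[where N = N]) (auto simp: integrable_llbound)
  have "AE p in mu \<Otimes>\<^sub>M chan_H N. norm (fst p) \<le> R'"
    by (rule pair.AE_pair_measure[where N = N], measurable) (use AE_norm \<open>R \<le> R'\<close> in \<open>auto elim!: eventually_mono\<close>)
  then have "AE p in mu \<Otimes>\<^sub>M chan_H N. norm ((\<lambda>(x, K). lik N x K * ln (lik N x K / mix N nu K)) p)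
      \<le> norm ((\<lambda>(x, K). 2 ^ N * (2 * llbound N R' K)) p)"
  proof eventually_elim
    case (elim p)
    show ?case using nu.abs_kl_integrand_le[OF elim, of N "snd p"] by (simp add: split_beta' abs_mult)
  qed
  then show ?thesis by (rule Bochner_Integration.integrable_bound[OF ib meas])
qed

section \<open>From the channel to the folded observations\<close>

definition signed :: "nat \<Rightarrow> (nat \<Rightarrow> real) \<Rightarrow> (nat \<Rightarrow> real^'n::finite) \<Rightarrow> (nat \<Rightarrow> real^'n)" where
  "signed N y H = (\<lambda>i\<in>{..<N}. y i *\<^sub>R H i)"

lemma signed_measurable [measurable]:
  "signed N y \<in> measurable (chan_H N) (chan_H N :: (nat \<Rightarrow> real^'a::finite) measure)"
  unfolding signed_def
proof (subst (2) chan_H_def, rule measurable_restrict)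
  fix i assume "i \<in> {..<N}"
  then have "(\<lambda>H. y i *\<^sub>R H i) \<in> borel_measurable (chan_H N)"
    by (intro borel_measurable_scaleR borel_measurable_const chan_H_component) simp
  then show "(\<lambda>H. y i *\<^sub>R H i) \<in> measurable (chan_H N) (gauss_vec :: (real^'a) measure)"
    by (simp add: measurable_cong_sets[OF refl sets_gauss])
qed

text \<open>For a fixed output the map is a product of identities and reflections, each of which
  preserves the Gaussian law.\<close>

lemma distr_chan_H_signed:
  assumes y: "y \<in> outputs N"
  shows "distr (chan_H N) (chan_H N) (signed N y) = (chan_H N :: (nat \<Rightarrow> real^'n::finite) measure)"
proof -
  interpret product_sigma_finite "\<lambda>_::nat. gauss_vec :: (real^'n) measure" by standard
  show ?thesis
    unfolding chan_H_def
  proof (rule PiM_eqI)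
    fix A :: "nat \<Rightarrow> (real^'n) set" assume "\<And>i. i \<in> {..<N} \<Longrightarrow> A i \<in> sets gauss_vec"
    then have A: "A i \<in> sets borel" if "i < N" for i using that by simp
    have m: "signed N y \<in> measurable (Pi\<^sub>M {..<N} (\<lambda>_. gauss_vec :: (real^'n) measure)) (Pi\<^sub>M {..<N} (\<lambda>_. gauss_vec))"
      unfolding chan_H_def[symmetric] by (rule signed_measurable)
    have sgn: "y i = 1 \<or> y i = -1" if "i < N" for i
      using y that by (auto simp: outputs_def PiE_iff)
    have B: "(\<lambda>k. y i *\<^sub>R k) -` A i \<in> sets borel" "emeasure gauss_vec ((\<lambda>k. y i *\<^sub>R k) -` A i) = emeasure gauss_vec (A i)"
      if i: "i < N" for i
    proof -
      have um: "uminus -` A i \<in> sets borel"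
        using measurable_sets_borel[of uminus borel "A i"] A[OF i] by simp
      moreover have "emeasure gauss_vec (uminus -` A i) = emeasure gauss_vec (A i)"
      proof -
        have "emeasure gauss_vec (A i) = emeasure (distr gauss_vec borel uminus) (A i)"
          by (simp add: gauss_distr_orthogonal[OF orthogonal_transformation_uminus])
        also have "\<dots> = emeasure gauss_vec (uminus -` A i \<inter> space gauss_vec)"
          by (rule emeasure_distr)
            (use A[OF i] orthogonal_transformation_measurable[OF orthogonal_transformation_uminus] in
              \<open>simp_all add: measurable_cong_sets[OF sets_gauss refl]\<close>)
        finally show ?thesis by simp
      qed
      moreover have "scaleR 1 -` A i = A i" "scaleR (-1) -` A i = uminus -` A i" by auto
      ultimately show "(\<lambda>k. y i *\<^sub>R k) -` A i \<in> sets borel" "emeasure gauss_vec ((\<lambda>k. y i *\<^sub>R k) -` A i) = emeasure gauss_vec (A i)"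
        using sgn[OF i] A[OF i] by auto
    qed
    have "emeasure (distr (Pi\<^sub>M {..<N} (\<lambda>_. gauss_vec)) (Pi\<^sub>M {..<N} (\<lambda>_. gauss_vec)) (signed N y)) (Pi\<^sub>E {..<N} A)
        = emeasure (Pi\<^sub>M {..<N} (\<lambda>_. gauss_vec)) (signed N y -` Pi\<^sub>E {..<N} A \<inter> space (Pi\<^sub>M {..<N} (\<lambda>_. gauss_vec)))"
      by (rule emeasure_distr[OF m]) (use A in auto)
    also have "signed N y -` Pi\<^sub>E {..<N} A \<inter> space (Pi\<^sub>M {..<N} (\<lambda>_. gauss_vec)) = Pi\<^sub>E {..<N} (\<lambda>i. (\<lambda>k. y i *\<^sub>R k) -` A i)"
      by (auto simp: signed_def space_PiM PiE_iff)
    also have "emeasure (Pi\<^sub>M {..<N} (\<lambda>_. gauss_vec)) (Pi\<^sub>E {..<N} (\<lambda>i. (\<lambda>k. y i *\<^sub>R k) -` A i))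
        = (\<Prod>i<N. emeasure gauss_vec ((\<lambda>k. y i *\<^sub>R k) -` A i))"
      by (rule emeasure_PiM) (use B in auto)
    also have "\<dots> = (\<Prod>i<N. emeasure gauss_vec (A i))" using B by (intro prod.cong) auto
    finally show "emeasure (distr (Pi\<^sub>M {..<N} (\<lambda>_. gauss_vec)) (Pi\<^sub>M {..<N} (\<lambda>_. gauss_vec)) (signed N y)) (Pi\<^sub>E {..<N} A)
        = (\<Prod>i<N. emeasure gauss_vec (A i))" .
  qed auto
qed

text \<open>The factor 2 in each term of \<open>lik\<close> normalises it to a density; the power of
  2 that it leaves behind is the number of outputs.\<close>

lemma chan_prob_eq_lik: "chan_prob N y H x = lik N x (signed N y H) / 2 ^ N"
proof -
  have "lik N x (signed N y H) = (\<Prod>i<N. 2 * Qfun (- y i * (H i \<bullet> x)))"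
    unfolding lik_def by (intro prod.cong) (auto simp: signed_def Phi_def)
  then show ?thesis by (simp add: chan_prob_def prod.distrib)
qed

lemma card_outputs: "card (outputs N) = 2 ^ N"
  unfolding outputs_def by (simp add: card_PiE numeral_2_eq_2)

context peak_input
begin

text \<open>Integrating over the input first matches the order of integration in
  \<open>mutual_info\<close>, whereas \<open>KL\<close> integrates over the observations
  first.\<close>

definition posterior_gain :: "nat \<Rightarrow> (real^'n) measure \<Rightarrow> (nat \<Rightarrow> real^'n) \<Rightarrow> real" where
  "posterior_gain N nu K = (\<integral>x. lik N x K * ln (lik N x K / mix N nu K) \<partial>mu)"

lemma
  fixes nu :: "(real^'n) measure"
  assumes "peak_input nu R'" and "R \<le> R'"
  shows integrable_posterior_gain: "integrable (chan_H N) (posterior_gain N nu)"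
    and integral_posterior_gain: "(\<integral>K. posterior_gain N nu K \<partial>chan_H N) = (\<integral>x. KL N nu x \<partial>mu)"
    and integrable_KL: "integrable mu (KL N nu)"
proof -
  note i = integrable_kl_integrand_pair[OF assms, of N]
  show "integrable (chan_H N) (posterior_gain N nu)"
    using pair.integrable_snd[of N "\<lambda>x K. lik N x K * ln (lik N x K / mix N nu K)"] i
    unfolding posterior_gain_def[abs_def] by simp
  show "(\<integral>K. posterior_gain N nu K \<partial>chan_H N) = (\<integral>x. KL N nu x \<partial>mu)"
    using pair.Fubini_integral[of N "\<lambda>x K. lik N x K * ln (lik N x K / mix N nu K)"] i
    unfolding posterior_gain_def[abs_def] KL_def by simp
  show "integrable mu (KL N nu)"
    using pair.integrable_fst[of N "\<lambda>x K. lik N x K * ln (lik N x K / mix N nu K)"] i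
    unfolding KL_def[abs_def] by simp
qed

lemma integrable_kl_integrand_mu:
  fixes nu :: "(real^'n) measure"
  assumes "peak_input nu R'" and "R \<le> R'"
  shows "integrable mu (\<lambda>x. lik N x K * ln (lik N x K / mix N nu K))"
proof -
  interpret nu: peak_input nu R' by fact
  show ?thesis
  proof (rule integrable_const_bound)
    show "AE x in mu. norm (lik N x K * ln (lik N x K / mix N nu K)) \<le> 2 ^ N * (2 * llbound N R' K)"
      using AE_norm by eventually_elim (use \<open>R \<le> R'\<close> nu.abs_kl_integrand_le in auto)
    show "(\<lambda>x. lik N x K * ln (lik N x K / mix N nu K)) \<in> borel_measurable mu"
      by (intro borel_measurable_times borel_measurable_ln borel_measurable_divide lik_measurable_mu borel_measurable_const)
  qed
qed

text \<open>After folding, each of the \<open>2 ^ N\<close> outputs contributes the same integral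
  with weight \<open>1 / 2 ^ N\<close>, because \<open>signed N y\<close> preserves the law of the
  channel. Fubini exchanges the two integrals, and \<open>ln 2\<close> converts nats to
  bits.\<close>

lemma mutual_info_eq_KL: "mutual_info N mu = (\<integral>x. KL N mu x \<partial>mu) / ln 2"
proof -
  have pin: "peak_input mu R" by unfold_locales
  let ?c = "1 / (2 ^ N * ln 2 :: real)"
  have mixy: "(\<integral>x'. chan_prob N y H x' \<partial>mu) = mix N mu (signed N y H) / 2 ^ N" for y H
    unfolding chan_prob_eq_lik mix_def by simp
  have "(\<integral>x. (\<Sum>y\<in>outputs N. chan_prob N y H x *
          log 2 (chan_prob N y H x / (\<integral>x'. chan_prob N y H x' \<partial>mu))) \<partial>mu)
      = (\<Sum>y\<in>outputs N. ?c * posterior_gain N mu (signed N y H))" for H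
  proof -
    have "(\<integral>x. (\<Sum>y\<in>outputs N. chan_prob N y H x *
          log 2 (chan_prob N y H x / (\<integral>x'. chan_prob N y H x' \<partial>mu))) \<partial>mu)
      = (\<integral>x. (\<Sum>y\<in>outputs N. ?c * (lik N x (signed N y H) * ln (lik N x (signed N y H) / mix N mu (signed N y H)))) \<partial>mu)"
      unfolding mixy unfolding chan_prob_eq_lik by (simp add: log_def)
    also have "\<dots> = (\<Sum>y\<in>outputs N. ?c * posterior_gain N mu (signed N y H))"
      unfolding posterior_gain_def
      by (subst Bochner_Integration.integral_sum)
        (auto intro!: integrable_mult_right integrable_kl_integrand_mu[OF pin order_refl])
    finally show ?thesis .
  qed
  then have "mutual_info N mu = (\<integral>H. (\<Sum>y\<in>outputs N. ?c * posterior_gain N mu (signed N y H)) \<partial>chan_H N)"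
    unfolding mutual_info_def by simp
  also have "\<dots> = (\<Sum>y\<in>outputs N. ?c * (\<integral>H. posterior_gain N mu (signed N y H) \<partial>chan_H N))"
  proof -
    have "integrable (chan_H N) (\<lambda>H. posterior_gain N mu (signed N y H))" if "y \<in> outputs N" for y
    proof -
      have "integrable (distr (chan_H N) (chan_H N) (signed N y)) (posterior_gain N mu)"
        unfolding distr_chan_H_signed[OF that] by (rule integrable_posterior_gain[OF pin order_refl])
      then show ?thesis by (rule integrable_distr[rotated]) (rule signed_measurable)
    qed
    then show ?thesis by (subst Bochner_Integration.integral_sum) auto
  qed
  also have "\<dots> = (\<Sum>y\<in>outputs N. ?c * (\<integral>K. posterior_gain N mu K \<partial>chan_H N))"
  proof (intro sum.cong refl arg_cong[where f = "\<lambda>t. ?c * t"])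
    fix y assume y: "y \<in> outputs N"
    have "(\<integral>K. posterior_gain N mu K \<partial>chan_H N) = (\<integral>K. posterior_gain N mu K \<partial>distr (chan_H N) (chan_H N) (signed N y))"
      unfolding distr_chan_H_signed[OF y] ..
    also have "\<dots> = (\<integral>H. posterior_gain N mu (signed N y H) \<partial>chan_H N)"
      by (rule integral_distr) (use integrable_posterior_gain[OF pin order_refl] in auto)
    finally show "(\<integral>H. posterior_gain N mu (signed N y H) \<partial>chan_H N) = (\<integral>K. posterior_gain N mu K \<partial>chan_H N)" by simp
  qed
  also have "\<dots> = (\<integral>x. KL N mu x \<partial>mu) / ln 2"
    by (simp add: card_outputs integral_posterior_gain[OF pin order_refl])
  finally show ?thesis .
qed

end

text \<open>Gibbs' inequality lets the optimal output law be replaced by an arbitrary mixture.\<close>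
lemma (in peak_input) mutual_info_le_KL:
  fixes nu :: "(real^'n) measure"
  assumes nu: "peak_input nu R'" and "R \<le> R'"
  shows "mutual_info N mu \<le> (\<integral>x. KL N nu x \<partial>mu) / ln 2"
proof -
  interpret nu: peak_input nu R' by fact
  have pin: "peak_input mu R" by unfold_locales
  have imix: "integrable (chan_H N) (mix N \<rho>)" "(\<integral>K. mix N \<rho> K \<partial>chan_H N) = 1"
    if "peak_input \<rho> R''" for \<rho> :: "(real^'n) measure" and R''
  proof -
    interpret r: peak_input \<rho> R'' by fact
    note [measurable] = lik_measurable_pair(1)[unfolded split_beta']
    have "integrable (\<rho> \<Otimes>\<^sub>M chan_H N) (\<lambda>(x, K). lik N x K)"
      unfolding split_beta'
      by (rule r.pair.Fubini_integrable[where N = N]) (auto simp: integral_lik)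
    note i = this
    show "integrable (chan_H N) (mix N \<rho>)"
      using r.pair.integrable_snd[of N "\<lambda>x K. lik N x K"] i unfolding mix_def[abs_def] by simp
    show "(\<integral>K. mix N \<rho> K \<partial>chan_H N) = 1"
      using r.pair.Fubini_integral[of N "\<lambda>x K. lik N x K"] i unfolding mix_def by (simp add: integral_lik)
  qed
  \<comment> \<open>Gibbs' inequality is applied pointwise as \<open>ln t \<le> t - 1\<close>. The
    correction \<open>mix N nu K - mix N mu K\<close> integrates to 0 because both mixtures have
    mass 1.\<close>
  have le: "posterior_gain N mu K \<le> posterior_gain N nu K + (mix N nu K - mix N mu K)" for K
  proof -
    let ?l = "ln (mix N nu K / mix N mu K)"
    have "posterior_gain N mu K = (\<integral>x. lik N x K * ln (lik N x K / mix N nu K) + lik N x K * ?l \<partial>mu)"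
      unfolding posterior_gain_def
      by (intro Bochner_Integration.integral_cong refl) (simp add: ln_div algebra_simps)
    also have "\<dots> = posterior_gain N nu K + mix N mu K * ?l"
      unfolding posterior_gain_def mix_def
      by (subst Bochner_Integration.integral_add)
        (use integrable_kl_integrand_mu[OF assms] in \<open>auto simp: integrable_lik mix_def\<close>)
    also have "mix N mu K * ?l \<le> mix N mu K * (mix N nu K / mix N mu K - 1)"
      by (intro mult_left_mono ln_le_minus_one) auto
    also have "\<dots> = mix N nu K - mix N mu K" by (simp add: algebra_simps)
    finally show ?thesis by simp
  qed
  have "(\<integral>x. KL N mu x \<partial>mu) = (\<integral>K. posterior_gain N mu K \<partial>chan_H N)"
    using integral_posterior_gain[OF pin order_refl] by simp
  also have "\<dots> \<le> (\<integral>K. posterior_gain N nu K + (mix N nu K - mix N mu K) \<partial>chan_H N)"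
    by (intro integral_mono le Bochner_Integration.integrable_add Bochner_Integration.integrable_diff
        integrable_posterior_gain[OF assms] integrable_posterior_gain[OF pin order_refl] imix[OF nu] imix[OF pin])
  also have "\<dots> = (\<integral>x. KL N nu x \<partial>mu)"
    using imix[OF nu] imix[OF pin] integrable_posterior_gain[OF assms] integral_posterior_gain[OF assms]
    by simp
  finally show ?thesis unfolding mutual_info_eq_KL by (simp add: divide_right_mono)
qed

lemma peak_inputI:
  assumes "mu \<in> input_dists snr"
  shows "peak_input mu (sqrt snr)"
  using assms unfolding input_dists_def peak_input_def peak_input_axioms_def by simp

declare chan_H_component [measurable del]

lemma measurable_gauss [simp]: "measurable (gauss_vec :: (real^'n::finite) measure) M = measurable borel M"
  by (rule measurable_cong_sets) simp_all

subsection \<open>The law of one folded channel vector\<close>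

text \<open>The law of output times channel vector for one receive antenna with input
  \<open>x\<close>.\<close>

definition folded_law :: "real^'n::finite \<Rightarrow> (real^'n) measure" where
  "folded_law x = density gauss_vec (\<lambda>k. ennreal (2 * Phi (k \<bullet> x)))"

lemma sets_folded_law [simp, measurable_cong]: "sets (folded_law x) = sets borel" by (simp add: folded_law_def)

lemma space_folded_law [simp]: "space (folded_law x) = UNIV" by (simp add: folded_law_def)

lemma integrable_gauss_Phi: "integrable gauss_vec (\<lambda>k::real^'n::finite. Phi (k \<bullet> x))"
  by (rule integrable_gauss_poly_bound[where C = 1 and p = 0]) auto

lemma integral_gauss_Phi: "(\<integral>k. Phi (k \<bullet> (x::real^'n::finite)) \<partial>gauss_vec) = 1 / 2"
proof -
  have "(\<integral>k. Phi (k \<bullet> x) \<partial>gauss_vec) = (\<integral>k. Phi (- k \<bullet> x) \<partial>gauss_vec)"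
    using integral_gauss_uminus[of "\<lambda>k. Phi (k \<bullet> x)"] by simp
  also have "\<dots> = (\<integral>k. 1 - Phi (k \<bullet> x) \<partial>gauss_vec)" by (simp add: Phi_minus)
  also have "\<dots> = 1 - (\<integral>k. Phi (k \<bullet> x) \<partial>gauss_vec)"
    using integrable_gauss_Phi[of x] by simp
  finally show ?thesis by simp
qed

lemma prob_space_folded_law: "prob_space (folded_law (x::real^'n::finite))"
proof
  have "emeasure (folded_law x) (space (folded_law x)) = (\<integral>\<^sup>+k. ennreal (2 * Phi (k \<bullet> x)) \<partial>gauss_vec)"
    unfolding folded_law_def by (subst emeasure_density) auto
  also have "\<dots> = ennreal (\<integral>k. 2 * Phi (k \<bullet> x) \<partial>gauss_vec)"
    by (rule nn_integral_eq_integral) (auto intro!: integrable_gauss_Phi)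
  also have "\<dots> = 1" by (simp add: integral_gauss_Phi)
  finally show "emeasure (folded_law x) (space (folded_law x)) = 1" .
qed

lemma integral_folded_law:
  fixes f :: "real^'n::finite \<Rightarrow> 'b::{banach, second_countable_topology}"
  assumes "f \<in> borel_measurable borel"
  shows "(\<integral>k. f k \<partial>folded_law x) = (\<integral>k. (2 * Phi (k \<bullet> x)) *\<^sub>R f k \<partial>gauss_vec)"
  unfolding folded_law_def using assms by (subst integral_density) auto

lemma integrable_folded_law:
  fixes f :: "real^'n::finite \<Rightarrow> 'b::{banach, second_countable_topology}"
  assumes i: "integrable gauss_vec f"
  shows "integrable (folded_law x) f" "integrable gauss_vec (\<lambda>k. (2 * Phi (k \<bullet> x)) *\<^sub>R f k)"
proof -
  have [measurable]: "f \<in> borel_measurable borel"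
    using borel_measurable_integrable[OF i] by simp
  show 2: "integrable gauss_vec (\<lambda>k. (2 * Phi (k \<bullet> x)) *\<^sub>R f k)"
  proof (rule Bochner_Integration.integrable_bound)
    show "integrable gauss_vec (\<lambda>k. 2 *\<^sub>R norm (f k))" using i by simp
    show "AE k in gauss_vec. norm ((2 * Phi (k \<bullet> x)) *\<^sub>R f k) \<le> norm (2 *\<^sub>R norm (f k))"
      by (intro AE_I2) (auto intro!: mult_left_le_one_le)
  qed measurable
  show "integrable (folded_law x) f"
    unfolding folded_law_def by (subst integrable_density) (use 2 in auto)
qed

lemma integral_folded_law_le:
  fixes f :: "real^'n::finite \<Rightarrow> real"
  assumes i: "integrable gauss_vec f" and nn: "\<And>k. f k \<ge> 0"
  shows "(\<integral>k. f k \<partial>folded_law x) \<le> 2 * (\<integral>k. f k \<partial>gauss_vec)"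
proof -
  have [measurable]: "f \<in> borel_measurable borel"
    using borel_measurable_integrable[OF i] by simp
  have "(\<integral>k. f k \<partial>folded_law x) = (\<integral>k. (2 * Phi (k \<bullet> x)) *\<^sub>R f k \<partial>gauss_vec)" by (rule integral_folded_law) simp
  also have "\<dots> \<le> (\<integral>k. 2 * f k \<partial>gauss_vec)"
    by (rule integral_mono) (use i integrable_folded_law(2)[OF i] nn in \<open>auto intro!: mult_left_le_one_le\<close>)
  finally show ?thesis by simp
qed

text \<open>The gradient of \<open>ln (Phi (k \<bullet> x))\<close> with respect to
  \<open>x\<close>: the score of one folded sample.\<close>

definition score_vec :: "real^'n::finite \<Rightarrow> real^'n \<Rightarrow> real^'n" where
  "score_vec x k = mills (k \<bullet> x) *\<^sub>R k"

lemma score_vec_measurable [measurable]: "score_vec x \<in> borel_measurable borel"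
  unfolding score_vec_def[abs_def] by measurable

lemma score_vec_inner_le: "\<bar>score_vec x k \<bullet> c\<bar> \<le> 8 * (1 + norm x) * norm c * (1 + norm k)^2"
proof -
  have "mills (k \<bullet> x) \<le> 8 * ((1 + norm x) * (1 + norm k))"
    using mills_le[of "k \<bullet> x"] mult_left_mono[OF one_plus_inner_le[of k x], of 8] by linarith
  moreover have "\<bar>k \<bullet> c\<bar> \<le> (1 + norm k) * norm c"
    using Cauchy_Schwarz_ineq2[of k c] by (simp add: algebra_simps) (smt (verit) norm_ge_zero)
  ultimately have "mills (k \<bullet> x) * \<bar>k \<bullet> c\<bar> \<le> (8 * ((1 + norm x) * (1 + norm k))) * ((1 + norm k) * norm c)"
    by (intro mult_mono) auto
  then show ?thesis by (simp add: score_vec_def abs_mult power2_eq_square mult_ac)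
qed

lemma integrable_score_vec: "integrable gauss_vec (\<lambda>k. score_vec x k \<bullet> c)"
  by (rule integrable_gauss_poly_bound[OF _ score_vec_inner_le[of x _ c, folded real_norm_def]]) measurable

lemma abs_score_vec_power_le: "\<bar>score_vec x k \<bullet> c\<bar> ^ p \<le> (8 * (1 + norm x) * norm c) ^ p * (1 + norm k) ^ (2 * p)"
  using power_mono[OF score_vec_inner_le[of x k c], of p] by (simp add: power_mult_distrib power_mult)

lemma integrable_score_vec_power: "integrable gauss_vec (\<lambda>k. \<bar>score_vec x k \<bullet> c\<bar> ^ p)"
  by (rule integrable_gauss_poly_bound[where C = "(8 * (1 + norm x) * norm c) ^ p" and p = "2 * p"])
    (use abs_score_vec_power_le in auto)

lemma integrable_score_vec_product: "integrable gauss_vec (\<lambda>k. (score_vec x k \<bullet> a) * (score_vec x k \<bullet> b))"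
proof (rule Bochner_Integration.integrable_bound)
  show "integrable gauss_vec (\<lambda>k. \<bar>score_vec x k \<bullet> a\<bar>^2 + \<bar>score_vec x k \<bullet> b\<bar>^2)"
    by (intro Bochner_Integration.integrable_add integrable_score_vec_power)
  have "\<bar>s * t\<bar> \<le> s^2 + t^2" for s t :: real
  proof -
    have "2 * \<bar>s * t\<bar> \<le> s^2 + t^2" using sum_squares_bound[of "\<bar>s\<bar>" "\<bar>t\<bar>"] by (simp add: abs_mult)
    then show ?thesis by simp
  qed
  then show "AE k in gauss_vec. norm ((score_vec x k \<bullet> a) * (score_vec x k \<bullet> b)) \<le> norm (\<bar>score_vec x k \<bullet> a\<bar>^2 + \<bar>score_vec x k \<bullet> b\<bar>^2)"
    by (intro AE_I2) simp
qed measurable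

text \<open>The density turns \<open>mills\<close> into \<open>phi\<close>, which is even, and
  leaves an odd integrand.\<close>

lemma folded_law_score_vec_mean: "(\<integral>k. score_vec x k \<bullet> c \<partial>folded_law x) = 0"
proof -
  have "(\<integral>k. score_vec x k \<bullet> c \<partial>folded_law x) = (\<integral>k. 2 * phi (k \<bullet> x) * (k \<bullet> c) \<partial>gauss_vec)"
    by (subst integral_folded_law) (simp_all add: score_vec_def mills_def mult.assoc)
  also have "\<dots> = 0" by (rule integral_gauss_odd) auto
  finally show ?thesis .
qed

text \<open>The integrand is averaged with its reflection; as for \<open>fisher_nth\<close>, the
  fractions with denominators \<open>Phi\<close> and \<open>1 - Phi\<close> combine to
  \<open>xi\<close>.\<close>

lemma folded_law_score_vec_product: "(\<integral>k. (score_vec x k \<bullet> a) * (score_vec x k \<bullet> b) \<partial>folded_law x) = finfo x a b"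
proof -
  define f where "f k = 2 * Phi (k \<bullet> x) * ((score_vec x k \<bullet> a) * (score_vec x k \<bullet> b))" for k
  have [measurable]: "f \<in> borel_measurable borel" unfolding f_def by measurable
  have i: "integrable gauss_vec f"
    using integrable_folded_law(2)[OF integrable_score_vec_product, of x x a b] by (simp add: f_def[abs_def])
  have i': "integrable gauss_vec (\<lambda>k. f (- k))"
  proof -
    have "integrable (distr gauss_vec borel uminus) f"
      using i by (simp add: gauss_distr_orthogonal[OF orthogonal_transformation_uminus])
    then show ?thesis by (subst (asm) integrable_distr_eq) auto
  qed
  have "f k + f (- k) = 2 * ((k \<bullet> a) * (k \<bullet> b) * xi (k \<bullet> x))" for k
  proof -
    have "2 * p' * ((f / p' * a) * (f / p' * b)) + 2 * q * ((f / q * a) * (f / q * b)) = 2 * (a * b * (f^2 / (p' * q)))"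
      if "q > 0" "p' > 0" "p' + q = 1" for f p' q a b :: real
    proof -
      have "2 * p' * ((f / p' * a) * (f / p' * b)) + 2 * q * ((f / q * a) * (f / q * b)) = 2 * (a * b * (f^2 * (p' + q) / (p' * q)))"
        using that(1,2) by (simp add: field_simps power2_eq_square)
      then show ?thesis by (simp only: that(3) mult_1_right)
    qed
    from this[of "1 - Phi (k \<bullet> x)" "Phi (k \<bullet> x)" "phi (k \<bullet> x)" "k \<bullet> a" "k \<bullet> b"]
    show ?thesis by (simp add: f_def score_vec_def mills_def Phi_minus xi_altdef)
  qed
  then have "(\<integral>k. f k \<partial>gauss_vec) + (\<integral>k. f (- k) \<partial>gauss_vec) = 2 * finfo x a b"
    unfolding finfo_def using i i' by (subst Bochner_Integration.integral_add[symmetric]) auto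
  then have "(\<integral>k. f k \<partial>gauss_vec) = finfo x a b"
    using integral_gauss_uminus[of f] by simp
  then show ?thesis by (subst integral_folded_law) (auto simp: f_def)
qed

text \<open>The information identity: expected negative Hessian equals covariance of the score.
  \<open>curv t\<close> is \<open>mills t * t + (mills t)^2\<close>; the first part becomes odd
  under the density, the second is the product of scores.\<close>

lemma folded_law_curv_product: "(\<integral>k. curv (k \<bullet> x) * ((k \<bullet> a) * (k \<bullet> b)) \<partial>folded_law x) = finfo x a b"
proof -
  have i: "integrable gauss_vec (\<lambda>k. mills (k \<bullet> x) * (k \<bullet> x) * ((k \<bullet> a) * (k \<bullet> b)))"
  proof (rule integrable_gauss_poly_bound)
    fix k
    have "\<bar>score_vec x k \<bullet> x\<bar> * (\<bar>k \<bullet> a\<bar> * \<bar>k \<bullet> b\<bar>) \<le> (8 * (1 + norm x) * norm x * (1 + norm k)^2) * ((norm a * (1 + norm k)) * (norm b * (1 + norm k)))"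
    proof (intro mult_mono score_vec_inner_le)
      show "\<bar>k \<bullet> c\<bar> \<le> norm c * (1 + norm k)" for c
        using Cauchy_Schwarz_ineq2[of k c] by (simp add: algebra_simps) (smt (verit) norm_ge_zero)
      then show "\<bar>k \<bullet> b\<bar> \<le> norm b * (1 + norm k)" .
    qed auto
    then show "norm (mills (k \<bullet> x) * (k \<bullet> x) * ((k \<bullet> a) * (k \<bullet> b))) \<le> (8 * (1 + norm x) * norm x * norm a * norm b) * (1 + norm k)^4"
      by (simp add: score_vec_def abs_mult eval_nat_numeral mult_ac)
  qed measurable
  have e: "curv (k \<bullet> x) * ((k \<bullet> a) * (k \<bullet> b)) =
      mills (k \<bullet> x) * (k \<bullet> x) * ((k \<bullet> a) * (k \<bullet> b)) + (score_vec x k \<bullet> a) * (score_vec x k \<bullet> b)" for k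
    by (simp add: curv_def score_vec_def algebra_simps)
  have "(\<integral>k. curv (k \<bullet> x) * ((k \<bullet> a) * (k \<bullet> b)) \<partial>folded_law x)
      = (\<integral>k. mills (k \<bullet> x) * (k \<bullet> x) * ((k \<bullet> a) * (k \<bullet> b)) \<partial>folded_law x) + finfo x a b"
    unfolding e folded_law_score_vec_product[symmetric]
    by (rule Bochner_Integration.integral_add) (intro integrable_folded_law(1) i integrable_score_vec_product)+
  also have "(\<integral>k. mills (k \<bullet> x) * (k \<bullet> x) * ((k \<bullet> a) * (k \<bullet> b)) \<partial>folded_law x)
      = (\<integral>k. 2 * phi (k \<bullet> x) * (k \<bullet> x) * ((k \<bullet> a) * (k \<bullet> b)) \<partial>gauss_vec)"
    by (subst integral_folded_law) (simp_all add: mills_def mult.assoc)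
  also have "\<dots> = 0" by (rule integral_gauss_odd) auto
  finally show ?thesis by simp
qed

subsection \<open>Expansion of the characteristic function of the score\<close>

lemma abs_times_phi_le: "\<bar>t\<bar> * phi t \<le> 1" and square_times_phi_le: "t^2 * phi t \<le> 1"
proof -
  have s: "sqrt (2 * pi) \<ge> 2"
    using pi_gt3 by (intro real_le_rsqrt) simp
  have e: "exp (t^2 / 2) \<ge> 1 + t^2 / 2" by (rule exp_ge_add_one_self)
  \<comment> \<open>D is the reciprocal of \<open>phi t\<close>, and
    \<open>exp u \<ge> 1 + u\<close> together with \<open>sqrt (2 * pi) \<ge> 2\<close> gives
    \<open>D \<ge> 2 + t^2\<close>.\<close>
  define D where "D = exp (t^2 / 2) * sqrt (2 * pi)"
  have "exp (- (t^2) / 2) * exp (t^2 / 2) = 1" by (simp flip: exp_add)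
  moreover have "sqrt (2 * pi) \<noteq> 0" using s by linarith
  moreover have "a / q * (b * q) = a * b" if "q \<noteq> 0" for a b q :: real using that by simp
  ultimately have p: "D * phi t = 1" unfolding D_def phi_def by (metis mult.commute)
  have d: "D \<ge> (1 + t^2 / 2) * 2" unfolding D_def using e s by (intro mult_mono) auto
  have "0 \<le> (\<bar>t\<bar> - 1)^2" by simp
  then have "\<bar>t\<bar> \<le> (1 + t^2 / 2) * 2" by (simp add: power2_eq_square algebra_simps)
  then have "\<bar>t\<bar> \<le> D" using d by linarith
  moreover have "t^2 \<le> D" using d by (simp add: algebra_simps)
  ultimately have "\<bar>t\<bar> * phi t \<le> D * phi t" "t^2 * phi t \<le> D * phi t" by (auto intro: mult_right_mono)
  then show "\<bar>t\<bar> * phi t \<le> 1" "t^2 * phi t \<le> 1" unfolding p .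
qed

text \<open>The second and third derivatives of \<open>Phi\<close> are bounded by 1 and 2, which
  yields the constants 1/2 and 2/6.\<close>

lemma Phi_taylor2: "\<bar>Phi (t + h) - Phi t - phi t * h\<bar> \<le> h^2 / 2"
  and Phi_taylor3: "\<bar>Phi (t + h) - Phi t - phi t * h + t * phi t * h^2 / 2\<bar> \<le> \<bar>h\<bar>^3 / 3"
proof -
  define diff where "diff m = (if m = 0 then Phi else if m = 1 then phi
      else if m = 2 then (\<lambda>t. - t * phi t) else (\<lambda>t. (t^2 - 1) * phi t))" for m :: nat
  have D: "(diff m has_real_derivative diff (Suc m) s) (at s)" if "m < 3" for m s
  proof -
    from that consider "m = 0" | "m = 1" | "m = 2" by linarith
    then show ?thesis
    proof cases
      case 1 then show ?thesis using DERIV_Phi by (simp add: diff_def)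
    next
      case 2 then show ?thesis using DERIV_phi[of s] by (simp add: diff_def)
    next
      case 3
      have "((\<lambda>t. - t * phi t) has_real_derivative (s^2 - 1) * phi s) (at s)"
        by (auto intro!: derivative_eq_intros DERIV_phi simp: algebra_simps power2_eq_square)
      then show ?thesis using 3 by (simp add: diff_def)
    qed
  qed
  have T: "\<exists>s. Phi (t + h) = (\<Sum>m<n. diff m t / fact m * h^m) + diff n s / fact n * h^n"
    if n: "0 < n" "n \<le> 3" and h: "h \<noteq> 0" for n
  proof -
    have "\<exists>s. (if t + h < t then t + h < s \<and> s < t else t < s \<and> s < t + h) \<and>
      Phi (t + h) = (\<Sum>m<n. diff m t / fact m * (t + h - t)^m) + diff n s / fact n * (t + h - t)^n"
      by (rule Taylor[where a = "min t (t + h)" and b = "max t (t + h)"])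
        (use n h D in \<open>auto simp: diff_def\<close>)
    then show ?thesis by auto
  qed
  show "\<bar>Phi (t + h) - Phi t - phi t * h\<bar> \<le> h^2 / 2"
  proof (cases "h = 0")
    case False
    obtain s where s: "Phi (t + h) = (\<Sum>m<2. diff m t / fact m * h^m) + diff 2 s / fact 2 * h^2"
      using T[of 2] False by auto
    have "Phi (t + h) - Phi t - phi t * h = diff 2 s / 2 * h^2"
      using s by (simp add: diff_def eval_nat_numeral)
    also have "\<bar>\<dots>\<bar> = (\<bar>s\<bar> * phi s) * (h^2 / 2)" by (simp add: diff_def abs_mult)
    also have "\<dots> \<le> 1 * (h^2 / 2)" by (intro mult_right_mono abs_times_phi_le) auto
    finally show ?thesis by simp
  qed simp
  show "\<bar>Phi (t + h) - Phi t - phi t * h + t * phi t * h^2 / 2\<bar> \<le> \<bar>h\<bar>^3 / 3"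
  proof (cases "h = 0")
    case False
    obtain s where s: "Phi (t + h) = (\<Sum>m<3. diff m t / fact m * h^m) + diff 3 s / fact 3 * h^3"
      using T[of 3] False by auto
    have "Phi (t + h) - Phi t - phi t * h + t * phi t * h^2 / 2 = diff 3 s / 6 * h^3"
      using s by (simp add: diff_def eval_nat_numeral fact_numeral)
    also have "\<bar>\<dots>\<bar> = \<bar>(s^2 - 1) * phi s\<bar> * (\<bar>h\<bar>^3 / 6)" by (simp add: diff_def abs_mult power_abs)
    also have "\<bar>(s^2 - 1) * phi s\<bar> \<le> s^2 * phi s + phi s"
    proof -
      have "\<bar>s^2 - 1\<bar> \<le> s^2 + 1" by (simp add: abs_le_iff add_increasing)
      then have "\<bar>s^2 - 1\<bar> * phi s \<le> (s^2 + 1) * phi s" by (intro mult_right_mono) auto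
      then show ?thesis by (simp only: abs_mult abs_of_nonneg[OF phi_nonneg] distrib_right mult_1_left)
    qed
    also have "\<dots> \<le> 2" using square_times_phi_le[of s] phi_le_1[of s] by linarith
    finally show ?thesis by (simp add: mult_right_mono)
  qed simp
qed

text \<open>To be read with t, b, a as the inner products of a sample with the input, of the sample
  with a direction of perturbation, and of the score with a frequency. The remainder is cubic in e
  with a polynomial coefficient, hence integrable.\<close>

lemma score_char_pointwise:
  fixes t a b e :: real and P p :: complex
  assumes e: "e \<ge> 0"
  defines "P \<equiv> complex_of_real (2 * Phi t)" and "p \<equiv> complex_of_real (2 * phi t)"
  shows "cmod (complex_of_real (2 * Phi (t + e * b)) * iexp (e * a) - P - of_real e * (p * b + \<i> * a * P)
      - of_real (e^2) * (- (t * phi t * b^2) - Phi t * a^2 + \<i> * (p * b * a))) \<le> 5 * e^3 * (\<bar>a\<bar> + \<bar>b\<bar>)^3"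
proof -
  define X where "X = 2 * Phi (t + e * b) - 2 * Phi t"
  define Y where "Y = iexp (e * a) - 1"
  define E1 where "E1 = X - 2 * phi t * (e * b) + t * phi t * (e * b)^2"
  define E2 where "E2 = Y - \<i> * of_real (e * a) + of_real ((e * a)^2 / 2)"
  have E1: "\<bar>E1\<bar> \<le> \<bar>e * b\<bar>^3"
  proof -
    have "E1 = 2 * (Phi (t + e * b) - Phi t - phi t * (e * b) + t * phi t * (e * b)^2 / 2)"
      by (simp add: E1_def X_def algebra_simps)
    moreover have "E = 2 * Z \<Longrightarrow> \<bar>Z\<bar> \<le> B / 3 \<Longrightarrow> B \<ge> 0 \<Longrightarrow> \<bar>E\<bar> \<le> B" for E Z B :: real by simp
    ultimately show ?thesis using Phi_taylor3[of t "e * b"] by (meson zero_le_power abs_ge_zero)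
  qed
  have X: "\<bar>X - 2 * phi t * (e * b)\<bar> \<le> (e * b)^2"
  proof -
    have "X - 2 * phi t * (e * b) = 2 * (Phi (t + e * b) - Phi t - phi t * (e * b))"
      by (simp add: X_def algebra_simps)
    moreover have "E = 2 * Z \<Longrightarrow> \<bar>Z\<bar> \<le> B / 2 \<Longrightarrow> \<bar>E\<bar> \<le> B" for E Z B :: real by simp
    ultimately show ?thesis using Phi_taylor2[of t "e * b"] by meson
  qed
  have E2: "cmod E2 \<le> \<bar>e * a\<bar>^3 / 6"
    using iexp_approx1[of "e * a" 2] by (simp add: E2_def Y_def eval_nat_numeral fact_numeral algebra_simps)
  have Y1: "cmod Y \<le> \<bar>e * a\<bar>"
    using iexp_approx1[of "e * a" 0] by (simp add: Y_def)
  have Y2: "cmod (Y - \<i> * of_real (e * a)) \<le> (e * a)^2 / 2"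
    using iexp_approx1[of "e * a" 1] by (simp add: Y_def eval_nat_numeral algebra_simps)
  \<comment> \<open>The remainder of a product of two expansions: the remainder of each factor, plus
    the product of the increments minus its second-order part. That difference splits into a
    quadratic times a linear and a linear times a quadratic term.\<close>
  have id: "complex_of_real (2 * Phi (t + e * b)) * iexp (e * a) - P - of_real e * (p * b + \<i> * a * P)
      - of_real (e^2) * (- (t * phi t * b^2) - Phi t * a^2 + \<i> * (p * b * a))
     = of_real E1 + P * E2 + (of_real (X - 2 * phi t * (e * b)) * Y + of_real (2 * phi t * (e * b)) * (Y - \<i> * of_real (e * a)))"
  proof -
    have "iexp (e * a) = 1 + Y" "complex_of_real (2 * Phi (t + e * b)) = P + of_real X"
      by (simp_all add: Y_def X_def P_def)
    then show ?thesis
      unfolding E1_def E2_def by (simp add: P_def p_def algebra_simps power2_eq_square)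
  qed
  have P: "cmod P \<le> 2" by (simp add: P_def)
  have "cmod (of_real E1 + P * E2 + (of_real (X - 2 * phi t * (e * b)) * Y + of_real (2 * phi t * (e * b)) * (Y - \<i> * of_real (e * a))))
     \<le> \<bar>E1\<bar> + cmod P * cmod E2 + (\<bar>X - 2 * phi t * (e * b)\<bar> * cmod Y + \<bar>2 * phi t * (e * b)\<bar> * cmod (Y - \<i> * of_real (e * a)))"
    by (intro norm_triangle_mono) (auto simp only: norm_mult norm_of_real)
  also have "\<dots> \<le> \<bar>e * b\<bar>^3 + 2 * (\<bar>e * a\<bar>^3 / 6) + ((e * b)^2 * \<bar>e * a\<bar> + (2 * \<bar>e * b\<bar>) * ((e * a)^2 / 2))"
  proof (intro add_mono mult_mono E1 P E2 X Y1 Y2)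
    show "\<bar>2 * phi t * (e * b)\<bar> \<le> 2 * \<bar>e * b\<bar>"
      using phi_le_1[of t] by (simp add: abs_mult mult_left_le_one_le)
  qed auto
  also have "\<dots> = e^3 * (\<bar>b\<bar>^3 + \<bar>a\<bar>^3 / 3 + \<bar>b\<bar>^2 * \<bar>a\<bar> + \<bar>b\<bar> * \<bar>a\<bar>^2)"
    using e by (simp add: abs_mult power_mult_distrib algebra_simps eval_nat_numeral)
  also have "\<dots> \<le> e^3 * (5 * (\<bar>a\<bar> + \<bar>b\<bar>)^3)"
  proof -
    have "b'^3 + a'^3 / 3 + b'^2 * a' + b' * a'^2 \<le> 5 * (a' + b')^3" if "a' \<ge> 0" "b' \<ge> 0" for a' b' :: real
    proof -
      have "a'^3 \<ge> 0" "b'^3 \<ge> 0" "b'^2 * a' \<ge> 0" "b' * a'^2 \<ge> 0" using that by auto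
      moreover have "5 * (a' + b')^3 = 5 * a'^3 + 15 * (b' * a'^2) + 15 * (b'^2 * a') + 5 * b'^3"
        by (simp add: eval_nat_numeral algebra_simps)
      ultimately show ?thesis by linarith
    qed
    then have "\<bar>b\<bar>^3 + \<bar>a\<bar>^3 / 3 + \<bar>b\<bar>^2 * \<bar>a\<bar> + \<bar>b\<bar> * \<bar>a\<bar>^2 \<le> 5 * (\<bar>a\<bar> + \<bar>b\<bar>)^3"
      by (meson abs_ge_zero)
    then show ?thesis using e by (intro mult_left_mono) auto
  qed
  finally show ?thesis unfolding id by (simp only: mult_ac)
qed

text \<open>The first-order term vanishes by oddness and by the zero mean of the score. At second
  order the term with \<open>t * phi t\<close> is odd; the others give the mean shift
  \<open>finfo x u c\<close> and the variance \<open>finfo x c c\<close> of the Gaussian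
  limit.\<close>

lemma score_char_expansion:
  fixes x u c :: "real^'n::finite"
  shows "\<exists>C. \<forall>e\<ge>0. cmod ((\<integral>k. complex_of_real (2 * Phi (k \<bullet> (x + e *\<^sub>R u))) * iexp (e * (score_vec x k \<bullet> c)) \<partial>gauss_vec)
     - 1 - of_real (e^2) * (\<i> * finfo x u c - finfo x c c / 2)) \<le> C * e^3"
proof -
  define C1 where "C1 = 8 * (1 + norm x) * norm c + norm u"
  define C where "C = 5 * C1^3 * (\<integral>(k::real^'n). (1 + norm k)^6 \<partial>gauss_vec)"
  define P where "P k = complex_of_real (2 * Phi (k \<bullet> x))" for k
  define p where "p k = complex_of_real (2 * phi (k \<bullet> x))" for k
  define Q1 where "Q1 k = p k * complex_of_real (k \<bullet> u) + \<i> * complex_of_real (score_vec x k \<bullet> c) * P k" for k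
  define Q2 where "Q2 k = - complex_of_real (k \<bullet> x) * phi (k \<bullet> x) * complex_of_real (k \<bullet> u)^2 - Phi (k \<bullet> x) * complex_of_real (score_vec x k \<bullet> c)^2
      + \<i> * (p k * complex_of_real (k \<bullet> u) * complex_of_real (score_vec x k \<bullet> c))" for k
  have iP: "integrable gauss_vec P" "(\<integral>k. P k \<partial>gauss_vec) = 1"
    unfolding P_def by (auto simp: integral_gauss_Phi intro!: integrable_gauss_Phi)
  have iu: "integrable gauss_vec (\<lambda>k. 2 * phi (k \<bullet> x) * (k \<bullet> u))" "(\<integral>k. 2 * phi (k \<bullet> x) * (k \<bullet> u) \<partial>gauss_vec) = 0"
  proof -
    have e: "2 * phi (k \<bullet> x) * (k \<bullet> u) = (2 * Phi (k \<bullet> x)) *\<^sub>R (score_vec x k \<bullet> u)" for k by (simp add: score_vec_def mills_def)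
    show "integrable gauss_vec (\<lambda>k. 2 * phi (k \<bullet> x) * (k \<bullet> u))"
      unfolding e by (rule integrable_folded_law(2)[OF integrable_score_vec])
    show "(\<integral>k. 2 * phi (k \<bullet> x) * (k \<bullet> u) \<partial>gauss_vec) = 0" by (rule integral_gauss_odd) auto
  qed
  have ic: "integrable gauss_vec (\<lambda>k. (score_vec x k \<bullet> c) * (2 * Phi (k \<bullet> x)))" "(\<integral>k. (score_vec x k \<bullet> c) * (2 * Phi (k \<bullet> x)) \<partial>gauss_vec) = 0"
    using integrable_folded_law(2)[OF integrable_score_vec[of x c], of x] folded_law_score_vec_mean[of x c]
    by (simp_all add: integral_folded_law mult.commute)
  have iQ1: "integrable gauss_vec Q1" "(\<integral>k. Q1 k \<partial>gauss_vec) = 0"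
  proof -
    have e: "Q1 = (\<lambda>k. complex_of_real (2 * phi (k \<bullet> x) * (k \<bullet> u)) + \<i> * complex_of_real ((score_vec x k \<bullet> c) * (2 * Phi (k \<bullet> x))))"
      by (auto simp: Q1_def p_def P_def)
    show "integrable gauss_vec Q1" unfolding e
      by (intro Bochner_Integration.integrable_add integrable_mult_right integrable_of_real iu ic)
    show "(\<integral>k. Q1 k \<partial>gauss_vec) = 0" unfolding e
      by (subst Bochner_Integration.integral_add) (auto intro!: integrable_mult_right integrable_of_real iu ic simp only: integral_of_real integral_mult_right_zero iu ic of_real_0 mult_zero_right add_0_right)
  qed
  have i1: "integrable gauss_vec (\<lambda>k. (k \<bullet> x) * phi (k \<bullet> x) * (k \<bullet> u)^2)" "(\<integral>k. (k \<bullet> x) * phi (k \<bullet> x) * (k \<bullet> u)^2 \<partial>gauss_vec) = 0"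
  proof -
    show "integrable gauss_vec (\<lambda>k. (k \<bullet> x) * phi (k \<bullet> x) * (k \<bullet> u)^2)"
    proof (rule integrable_gauss_poly_bound[where C = "norm u ^ 2" and p = 2])
      fix k
      have "\<bar>k \<bullet> u\<bar> \<le> norm u * (1 + norm k)"
        using Cauchy_Schwarz_ineq2[of k u] by (simp add: algebra_simps) (smt (verit) norm_ge_zero)
      then have "\<bar>k \<bullet> u\<bar>^2 \<le> (norm u * (1 + norm k))^2" by (intro power_mono) auto
      then have "(\<bar>k \<bullet> x\<bar> * phi (k \<bullet> x)) * \<bar>k \<bullet> u\<bar>^2 \<le> 1 * (norm u * (1 + norm k))^2"
        by (intro mult_mono abs_times_phi_le) auto
      then show "norm ((k \<bullet> x) * phi (k \<bullet> x) * (k \<bullet> u)^2) \<le> norm u ^ 2 * (1 + norm k)^2"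
        by (simp add: abs_mult power_mult_distrib)
    qed measurable
    show "(\<integral>k. (k \<bullet> x) * phi (k \<bullet> x) * (k \<bullet> u)^2 \<partial>gauss_vec) = 0" by (rule integral_gauss_odd) auto
  qed
  have i2: "integrable gauss_vec (\<lambda>k. (2 * Phi (k \<bullet> x)) * ((score_vec x k \<bullet> a) * (score_vec x k \<bullet> b)))"
      "(\<integral>k. (2 * Phi (k \<bullet> x)) * ((score_vec x k \<bullet> a) * (score_vec x k \<bullet> b)) \<partial>gauss_vec) = finfo x a b" for a b
    using integrable_folded_law(2)[OF integrable_score_vec_product[of x a b], of x] folded_law_score_vec_product[of x a b]
    by (simp_all add: integral_folded_law)
  have iQ2: "integrable gauss_vec Q2" "(\<integral>k. Q2 k \<partial>gauss_vec) = \<i> * finfo x u c - finfo x c c / 2"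
  proof -
    have e: "Q2 = (\<lambda>k. - complex_of_real ((k \<bullet> x) * phi (k \<bullet> x) * (k \<bullet> u)^2)
        - complex_of_real ((2 * Phi (k \<bullet> x)) * ((score_vec x k \<bullet> c) * (score_vec x k \<bullet> c))) / 2
        + \<i> * complex_of_real ((2 * Phi (k \<bullet> x)) * ((score_vec x k \<bullet> u) * (score_vec x k \<bullet> c))))"
    proof
      fix k
      have "2 * phi (k \<bullet> x) * (k \<bullet> u) = 2 * Phi (k \<bullet> x) * (score_vec x k \<bullet> u)" by (simp add: score_vec_def mills_def)
      then have "p k * complex_of_real (k \<bullet> u) = complex_of_real (2 * Phi (k \<bullet> x) * (score_vec x k \<bullet> u))"
        unfolding p_def by (simp only: of_real_mult[symmetric])
      then show "Q2 k = - complex_of_real ((k \<bullet> x) * phi (k \<bullet> x) * (k \<bullet> u)^2)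
        - complex_of_real ((2 * Phi (k \<bullet> x)) * ((score_vec x k \<bullet> c) * (score_vec x k \<bullet> c))) / 2
        + \<i> * complex_of_real ((2 * Phi (k \<bullet> x)) * ((score_vec x k \<bullet> u) * (score_vec x k \<bullet> c)))"
        unfolding Q2_def by (simp add: power2_eq_square)
    qed
    show "integrable gauss_vec Q2" unfolding e
      by (intro Bochner_Integration.integrable_add Bochner_Integration.integrable_diff Bochner_Integration.integrable_minus
          integrable_mult_right integrable_divide integrable_of_real i1 i2)
    show "(\<integral>k. Q2 k \<partial>gauss_vec) = \<i> * finfo x u c - finfo x c c / 2" unfolding e
      apply (subst Bochner_Integration.integral_add)
        apply (intro Bochner_Integration.integrable_diff Bochner_Integration.integrable_minus integrable_divide integrable_of_real i1 i2)
       apply (intro integrable_mult_right integrable_of_real i2)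
      apply (subst Bochner_Integration.integral_diff)
        apply (intro Bochner_Integration.integrable_minus integrable_of_real i1)
       apply (intro integrable_divide integrable_of_real i2)
      apply (simp only: integral_of_real integral_mult_right_zero integral_divide_zero Bochner_Integration.integral_minus i1 i2)
      apply simp
      done
  qed
  have "cmod ((\<integral>k. complex_of_real (2 * Phi (k \<bullet> (x + e *\<^sub>R u))) * iexp (e * (score_vec x k \<bullet> c)) \<partial>gauss_vec)
     - 1 - of_real (e^2) * (\<i> * finfo x u c - finfo x c c / 2)) \<le> C * e^3" if e: "e \<ge> 0" for e
  proof -
    let ?f = "\<lambda>k. complex_of_real (2 * Phi (k \<bullet> (x + e *\<^sub>R u))) * iexp (e * (score_vec x k \<bullet> c))"
    have if': "integrable gauss_vec ?f"
      by (rule integrable_gauss_poly_bound[where C = 2 and p = 0]) (auto simp: norm_mult)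
    have pw: "cmod (?f k - P k - of_real e * Q1 k - of_real (e^2) * Q2 k) \<le> 5 * C1^3 * e^3 * (1 + norm k)^6" for k
    proof -
      have "cmod (?f k - P k - of_real e * Q1 k - of_real (e^2) * Q2 k) \<le> 5 * e^3 * (\<bar>score_vec x k \<bullet> c\<bar> + \<bar>k \<bullet> u\<bar>)^3"
        using score_char_pointwise[OF e, of "k \<bullet> x" "k \<bullet> u" "score_vec x k \<bullet> c"]
        by (simp add: P_def p_def Q1_def Q2_def inner_add_right)
      also have "\<bar>score_vec x k \<bullet> c\<bar> + \<bar>k \<bullet> u\<bar> \<le> C1 * (1 + norm k)^2"
      proof -
        have "\<bar>k \<bullet> u\<bar> \<le> norm u * norm k" using Cauchy_Schwarz_ineq2[of k u] by (simp add: mult.commute)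
        also have "\<dots> \<le> norm u * (1 + norm k)^2"
          by (intro mult_left_mono) (auto simp: power2_eq_square algebra_simps)
        finally show ?thesis using score_vec_inner_le[of x k c] by (simp add: C1_def algebra_simps)
      qed
      then have "(\<bar>score_vec x k \<bullet> c\<bar> + \<bar>k \<bullet> u\<bar>)^3 \<le> (C1 * (1 + norm k)^2)^3" by (intro power_mono) auto
      then have "5 * e^3 * (\<bar>score_vec x k \<bullet> c\<bar> + \<bar>k \<bullet> u\<bar>)^3 \<le> 5 * e^3 * (C1 * (1 + norm k)^2)^3"
        using e by (intro mult_left_mono) auto
      finally show ?thesis by (simp add: power_mult_distrib mult_ac flip: power_mult)
    qed
    have "(\<integral>k. ?f k \<partial>gauss_vec) - 1 - of_real (e^2) * (\<i> * finfo x u c - finfo x c c / 2)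
        = (\<integral>k. ?f k - P k - of_real e * Q1 k - of_real (e^2) * Q2 k \<partial>gauss_vec)"
      using if' iP iQ1 iQ2 by simp
    also have "cmod \<dots> \<le> (\<integral>k. 5 * C1^3 * e^3 * (1 + norm k)^6 \<partial>(gauss_vec :: (real^'n) measure))"
      by (rule Bochner_Integration.integral_norm_bound_integral) (use if' iP iQ1 iQ2 pw in \<open>auto intro!: integrable_gauss_poly\<close>)
    also have "\<dots> = C * e^3" by (simp add: C_def)
    finally show ?thesis .
  qed
  then show ?thesis by blast
qed

text \<open>The power is compared with that of \<open>exp (z / N)\<close>, since N-th powers of two
  numbers in the unit disc differ by at most N times their distance. The sign of \<open>Re z\<close>
  puts the comparison point into the disc, and no complex logarithm is involved.\<close>

lemma tendsto_power_exp_complex: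
  fixes psi :: "nat \<Rightarrow> complex"
  assumes lim: "(\<lambda>N. of_nat N * (psi N - 1)) \<longlonglongrightarrow> z" and le: "\<And>N. cmod (psi N) \<le> 1" and z: "Re z \<le> 0"
  shows "(\<lambda>N. psi N ^ N) \<longlonglongrightarrow> exp z"
proof -
  let ?w = "\<lambda>N. exp (z / of_nat N)"
  have w: "cmod (?w N) \<le> 1" for N
    using z by (simp add: divide_nonpos_nonneg)
  have bound: "cmod (of_nat N * (?w N - 1) - z) \<le> exp (cmod z) * (cmod z)^2 / real N" if "N > 0" for N
  proof -
    have "cmod (?w N - (\<Sum>k\<le>1. (z / of_nat N)^k / fact k)) \<le> exp \<bar>Re (z / of_nat N)\<bar> * cmod (z / of_nat N)^Suc 1 / fact 1"
      by (rule Taylor_exp)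
    also have "\<dots> = exp \<bar>Re (z / of_nat N)\<bar> * (cmod z / real N)^2"
      by (simp add: norm_divide power2_eq_square)
    also have "\<dots> \<le> exp (cmod z) * (cmod z / real N)^2"
    proof (intro mult_right_mono)
      have "\<bar>Re (z / of_nat N)\<bar> \<le> cmod (z / of_nat N)" by (rule abs_Re_le_cmod)
      also have "\<dots> \<le> cmod z" using that by (simp add: norm_divide divide_le_eq mult_le_cancel_left1)
      finally show "exp \<bar>Re (z / of_nat N)\<bar> \<le> exp (cmod z)" by simp
    qed simp
    finally have "cmod (?w N - 1 - z / of_nat N) \<le> exp (cmod z) * (cmod z / real N)^2" by (simp add: diff_diff_eq)
    then have le: "real N * cmod (?w N - 1 - z / of_nat N) \<le> real N * (exp (cmod z) * (cmod z / real N)^2)"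
      by (rule mult_left_mono) simp
    have "of_nat N * (?w N - 1) - z = of_nat N * (?w N - 1 - z / of_nat N)"
      using that by (simp add: algebra_simps)
    then have "cmod (of_nat N * (?w N - 1) - z) = real N * cmod (?w N - 1 - z / of_nat N)"
      by (simp only: norm_mult norm_of_nat)
    also note le
    also have "real N * (exp (cmod z) * (cmod z / real N)^2) = exp (cmod z) * (cmod z)^2 / real N"
      using that by (simp add: power2_eq_square)
    finally show ?thesis .
  qed
  have "(\<lambda>N. of_nat N * (?w N - 1) - z) \<longlonglongrightarrow> 0"
  proof (rule Lim_null_comparison)
    show "eventually (\<lambda>N. cmod (of_nat N * (?w N - 1) - z) \<le> exp (cmod z) * (cmod z)^2 / real N) sequentially"
      using eventually_gt_at_top[of 0] by eventually_elim (rule bound)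
    show "(\<lambda>N. exp (cmod z) * (cmod z)^2 / real N) \<longlonglongrightarrow> 0" by (rule lim_const_over_n)
  qed
  from tendsto_diff[OF tendsto_diff[OF lim tendsto_const[of z]] this]
  have "(\<lambda>N. of_nat N * (psi N - ?w N)) \<longlonglongrightarrow> 0" by (simp add: algebra_simps)
  then have "(\<lambda>N. psi N ^ N - ?w N ^ N) \<longlonglongrightarrow> 0"
    by (rule tendsto_0_le[where K = 1])
      (use norm_power_diff[OF le w] in \<open>auto simp: norm_mult\<close>)
  moreover have "eventually (\<lambda>N. psi N ^ N - ?w N ^ N = psi N ^ N - exp z) sequentially"
    using eventually_gt_at_top[of 0] by eventually_elim (simp flip: exp_of_nat_mult)
  ultimately have "(\<lambda>N. psi N ^ N - exp z) \<longlonglongrightarrow> 0"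
    by (rule Lim_transform_eventually)
  then show ?thesis by (simp add: LIM_zero_iff)
qed

subsection \<open>Exponential decay away from the true parameter\<close>

lemma exp_le_quadratic: "exp y \<le> 1 + y + y^2 / 2 * exp \<bar>y\<bar>" for y :: real
proof -
  obtain t where t: "\<bar>t\<bar> \<le> \<bar>y\<bar>" "exp y = (\<Sum>m<2. y ^ m / fact m) + exp t / fact 2 * y ^ 2"
    using Maclaurin_exp_le[of y 2] by blast
  have "exp t * (y^2 / 2) \<le> exp \<bar>y\<bar> * (y^2 / 2)" using t(1) by (intro mult_right_mono) auto
  then show ?thesis using t(2) by (simp add: eval_nat_numeral mult_ac)
qed

text \<open>Symmetrising under \<open>k \<mapsto> -k\<close> makes the integrand nonnegative, since \<open>Phi\<close> is increasing.\<close>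
lemma score_drift:
  assumes R: "R \<ge> 0"
  shows "\<exists>c>0. \<forall>x x' :: real^'n::finite. norm x \<le> R \<longrightarrow> norm x' \<le> R \<longrightarrow>
     (\<integral>k. 2 * Phi (k \<bullet> x') * (score_vec x k \<bullet> (x' - x)) \<partial>gauss_vec) \<ge> c * (norm (x' - x))^2"
proof -
  \<comment> \<open>A rotation invariant weight that bounds two factors from below: one
    \<open>phi\<close> comes from the increment of \<open>Phi\<close>, the other from the
    score.\<close>
  define \<omega> where "\<omega> k = (phi (R * norm k))^2" for k :: "real^'n"
  obtain j :: 'n where True by simp
  define c where "c = (\<integral>k. (k \<bullet> (axis j 1 :: real^'n))^2 * \<omega> k \<partial>gauss_vec)"
  have \<omega>m [measurable]: "\<omega> \<in> borel_measurable borel" unfolding \<omega>_def[abs_def] by measurable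
  have i\<omega>: "integrable gauss_vec (\<lambda>k. (k \<bullet> v)^2 * \<omega> k)" for v :: "real^'n"
  proof (rule integrable_gauss_poly_bound[where C = "norm v ^ 2" and p = 2])
    fix k
    have "\<bar>k \<bullet> v\<bar> \<le> norm v * (1 + norm k)"
      using Cauchy_Schwarz_ineq2[of k v] by (simp add: algebra_simps) (smt (verit) norm_ge_zero)
    then have "\<bar>k \<bullet> v\<bar>^2 \<le> (norm v * (1 + norm k))^2" by (intro power_mono) auto
    moreover have "\<omega> k \<le> 1" using phi_le_1 by (auto simp: \<omega>_def intro!: power_le_one)
    moreover have "\<omega> k \<ge> 0" by (simp add: \<omega>_def)
    ultimately have "\<bar>k \<bullet> v\<bar>^2 * \<omega> k \<le> (norm v * (1 + norm k))^2 * 1" by (intro mult_mono) auto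
    then show "norm ((k \<bullet> v)^2 * \<omega> k) \<le> norm v ^ 2 * (1 + norm k)^2"
      using \<open>\<omega> k \<ge> 0\<close> by (simp add: abs_mult power_mult_distrib)
  qed measurable
  \<comment> \<open>As the weight is invariant, the quadratic form is a multiple of the squared
    norm, and the constant does not depend on the direction.\<close>
  have iso: "(\<integral>k. (k \<bullet> v)^2 * \<omega> k \<partial>gauss_vec) = (norm v)^2 * c" for v :: "real^'n"
  proof -
    have "norm (norm v *\<^sub>R axis j (1::real) :: real^'n) = norm v" by simp
    then obtain T :: "real^'n \<Rightarrow> real^'n" where T: "orthogonal_transformation T" "T (norm v *\<^sub>R axis j 1) = v"
      using orthogonal_transformation_exists by blast
    have "(\<integral>k. (k \<bullet> v)^2 * \<omega> k \<partial>gauss_vec) = (\<integral>k. (T k \<bullet> v)^2 * \<omega> (T k) \<partial>gauss_vec)"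
      by (rule integral_gauss_orthogonal[OF T(1), symmetric]) measurable
    also have "\<dots> = (\<integral>k. (norm v)^2 * ((k \<bullet> axis j 1)^2 * \<omega> k) \<partial>gauss_vec)"
    proof (rule Bochner_Integration.integral_cong[OF refl])
      fix k
      have "T k \<bullet> v = T k \<bullet> T (norm v *\<^sub>R axis j 1)" using T(2) by simp
      also have "\<dots> = norm v * (k \<bullet> axis j 1)" using T(1) by (simp add: orthogonal_transformation_def)
      finally show "(T k \<bullet> v)^2 * \<omega> (T k) = (norm v)^2 * ((k \<bullet> axis j 1)^2 * \<omega> k)"
        by (simp add: \<omega>_def orthogonal_transformation_norm[OF T(1)] power_mult_distrib)
    qed
    finally show ?thesis by (simp add: c_def)
  qed
  have "c > 0"
  proof (rule ccontr)
    assume "\<not> c > 0"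
    moreover have "c \<ge> 0" unfolding c_def \<omega>_def by (intro integral_nonneg_AE) auto
    ultimately have "c = 0" by simp
    then have ae: "AE k in gauss_vec. (k \<bullet> (axis j 1 :: real^'n))^2 * \<omega> k = 0"
      unfolding c_def by (subst (asm) integral_nonneg_eq_0_iff_AE) (use i\<omega> in \<open>auto simp: \<omega>_def\<close>)
    have nz: "\<omega> k \<noteq> 0" for k unfolding \<omega>_def using phi_pos by (metis less_irrefl zero_eq_power2)
    from ae have "AE k in gauss_vec. k \<bullet> (axis j 1 :: real^'n) = 0" by eventually_elim (use nz in auto)
    then have ae': "AE t in distr gauss_vec borel (\<lambda>k::real^'n. k \<bullet> axis j 1). t = 0"
      by (subst AE_distr_iff) auto
    have "distr gauss_vec borel (\<lambda>k::real^'n. k \<bullet> axis j 1) = std_normal_distribution"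
      by (rule gauss_marginal) simp
    from ae'[unfolded this] have "AE t in std_normal_distribution. t = 0" .
    then have "AE t in lborel. t = (0::real)"
      by (subst (asm) AE_density) (auto elim!: eventually_mono simp: normal_density_pos)
    moreover have "AE t in lborel. t \<noteq> (0::real)" by (rule AE_lborel_singleton)
    ultimately have "AE t::real in lborel. False" by eventually_elim auto
    then show False by (simp add: ae_filter_eq_bot_iff trivial_limit_def[symmetric])
  qed
  moreover have "(\<integral>k. 2 * Phi (k \<bullet> x') * (score_vec x k \<bullet> (x' - x)) \<partial>gauss_vec) \<ge> (4 * c) * (norm (x' - x))^2"
    if x: "norm x \<le> R" and x': "norm x' \<le> R" for x x' :: "real^'n"
  proof -
    define d where "d = x' - x"
    define f where "f k = Phi (k \<bullet> x') * (score_vec x k \<bullet> d)" for k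
    have [measurable]: "f \<in> borel_measurable borel" unfolding f_def by measurable
    have if': "integrable gauss_vec f"
      using integrable_folded_law(2)[OF integrable_score_vec[of x d], of x'] by (simp add: f_def[abs_def] mult.assoc)
    have im: "integrable gauss_vec (\<lambda>k. f (- k))"
    proof -
      have "integrable (distr gauss_vec borel uminus) f"
        using if' by (simp add: gauss_distr_orthogonal[OF orthogonal_transformation_uminus])
      then show ?thesis by (subst (asm) integrable_distr_eq) auto
    qed
    have pw: "4 * ((k \<bullet> d)^2 * \<omega> k) \<le> f k + f (- k)" for k
    proof -
      define a where "a = k \<bullet> x" define b where "b = k \<bullet> x'"
      have ab: "k \<bullet> d = b - a" by (simp add: a_def b_def d_def inner_diff_right)
      have aR: "\<bar>a\<bar> \<le> R * norm k" "\<bar>b\<bar> \<le> R * norm k"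
        using Cauchy_Schwarz_ineq2[of k x] Cauchy_Schwarz_ineq2[of k x'] mult_left_mono[OF x, of "norm k"] mult_left_mono[OF x', of "norm k"]
        by (simp_all add: a_def b_def mult.commute)
      let ?p = "Phi a" let ?m = "phi (R * norm k)"
      have "f k + f (- k) = (b - a) * (Phi b * (phi a / ?p) - (1 - Phi b) * (phi a / (1 - ?p)))"
        unfolding f_def score_vec_def mills_def
        by (simp add: ab[symmetric] a_def[symmetric] b_def[symmetric] Phi_minus algebra_simps)
      also have "\<dots> = (phi a / (?p * (1 - ?p))) * ((b - a) * (Phi b - ?p))"
      proof -
        have "e * (B * (f / p') - (1 - B) * (f / q)) = (f / (p' * q)) * (e * (B - p'))"
          if "p' > 0" "q > 0" "q = 1 - p'" for e B f p' q :: real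
        proof -
          have "B * (f / p') - (1 - B) * (f / q) = f * (B * q - (1 - B) * p') / (p' * q)"
            using that(1,2) by (simp add: field_simps)
          also have "B * q - (1 - B) * p' = B - p'" unfolding that(3) by (simp add: algebra_simps)
          finally show ?thesis by simp
        qed
        from this[of ?p "1 - ?p"] show ?thesis by simp
      qed
      \<comment> \<open>The factor 4 stems from \<open>p * (1 - p) \<le> 1/4\<close>. The second
        factor is nonnegative for either order of a and b, because \<open>Phi\<close>
        increases.\<close>
      also have "\<dots> \<ge> (4 * ?m) * ((b - a)^2 * ?m)"
      proof (rule mult_mono)
        have pp: "?p * (1 - ?p) > 0" by simp
        have "4 * ?m * (?p * (1 - ?p)) \<le> 4 * ?m * (1/4)"
          using Phi_product_le[of a] by (intro mult_left_mono) auto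
        also have "\<dots> \<le> phi a" using phi_mono[of a "R * norm k"] aR R by simp
        finally show "4 * ?m \<le> phi a / (?p * (1 - ?p))" using pp by (simp only: pos_le_divide_eq)
        show "(b - a)^2 * ?m \<le> (b - a) * (Phi b - ?p)"
        proof (cases "a \<le> b")
          case True
          have "(b - a) * ((b - a) * ?m) \<le> (b - a) * (Phi b - ?p)"
            using Phi_increment_ge[OF True aR] True by (intro mult_left_mono) auto
          then show ?thesis by (simp add: power2_eq_square mult.assoc)
        next
          case False
          have "(a - b) * ((a - b) * ?m) \<le> (a - b) * (Phi a - Phi b)"
            using Phi_increment_ge[of b a, OF _ aR(2) aR(1)] False by (intro mult_left_mono) auto
          then show ?thesis by (simp add: power2_eq_square algebra_simps)
        qed
      qed (auto simp: less_imp_le)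
      finally show ?thesis unfolding ab \<omega>_def by (simp add: power2_eq_square mult_ac)
    qed
    have "4 * ((norm d)^2 * c) = (\<integral>k. 4 * ((k \<bullet> d)^2 * \<omega> k) \<partial>gauss_vec)" by (simp add: iso)
    also have "\<dots> \<le> (\<integral>k. f k + f (- k) \<partial>gauss_vec)"
      by (rule integral_mono) (use i\<omega> if' im pw in auto)
    also have "\<dots> = 2 * (\<integral>k. f k \<partial>gauss_vec)"
      using if' im integral_gauss_uminus[of f] by simp
    also have "\<dots> = (\<integral>k. 2 * Phi (k \<bullet> x') * (score_vec x k \<bullet> (x' - x)) \<partial>gauss_vec)"
      by (simp add: f_def d_def mult.assoc)
    finally show ?thesis by (simp add: d_def mult_ac)
  qed
  ultimately show ?thesis by (intro exI[of _ "4 * c"]) simp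
qed

text \<open>To first order the exponential moment decreases by \<open>\<tau>\<close> times the
  drift, while the corrections are of order \<open>\<tau>^2\<close> times the squared distance; a
  small \<open>\<tau>\<close> lets the drift win. The factor with D is a reserve for the Gaussian
  cost of linearising \<open>exp (-|S|^2/2)\<close> in \<open>gpart_le\<close>.\<close>

lemma score_chernoff:
  assumes R: "R \<ge> 0" and D: "D \<ge> 0"
  shows "\<exists>\<tau>>0. \<exists>c>0. \<forall>x x' :: real^'n::finite. norm x \<le> R \<longrightarrow> norm x' \<le> R \<longrightarrow>
     integrable gauss_vec (\<lambda>k. 2 * Phi (k \<bullet> x') * exp (- \<tau> * (score_vec x k \<bullet> (x' - x)))) \<and>
     (\<integral>k. 2 * Phi (k \<bullet> x') * exp (- \<tau> * (score_vec x k \<bullet> (x' - x))) \<partial>gauss_vec) * exp (\<tau>^2 * D * (norm (x' - x))^2)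
       \<le> exp (- c * (norm (x' - x))^2)"
proof -
  obtain c0 where c0: "c0 > 0" "\<And>x x' :: real^'n. norm x \<le> R \<Longrightarrow> norm x' \<le> R \<Longrightarrow>
     (\<integral>k. 2 * Phi (k \<bullet> x') * (score_vec x k \<bullet> (x' - x)) \<partial>gauss_vec) \<ge> c0 * (norm (x' - x))^2"
    using score_drift[OF R, where 'n = 'n] by blast
  define E where "E k = (1 + norm k)^4 * exp ((norm k)^2 / 8)" for k :: "real^'n"
  have iE: "integrable gauss_vec E" unfolding E_def[abs_def] by (rule integrable_gauss_poly_exp)
  have Em [measurable]: "E \<in> borel_measurable borel" unfolding E_def[abs_def] by measurable
  define B where "B = 8 * (1 + R)"
  have B: "B > 0" using R by (simp add: B_def)
  define C0 where "C0 = B^2 * exp (1/8) * (\<integral>k. E k \<partial>gauss_vec)"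
  have C0: "C0 \<ge> 0" unfolding C0_def E_def by (intro mult_nonneg_nonneg integral_nonneg_AE) auto
  \<comment> \<open>The first bound keeps \<open>\<tau> * |m k|\<close> below
    \<open>1/8 + (norm k)^2 / 8\<close>, within the integrable exponents; \<open>2 * R + 1\<close>
    instead of the diameter keeps the denominator positive for R = 0. The second bound gives
    \<open>\<tau> * (C0 + D) \<le> c0 / 2\<close>.\<close>
  define \<tau> where "\<tau> = min (1 / (16 * (2 * R + 1) * B)) (c0 / (2 * (C0 + D + 1)))"
  have \<tau>0: "\<tau> > 0" using R B C0 D c0 by (simp add: \<tau>_def add_nonneg_pos)
  have \<tau>1: "\<tau> * ((2 * R + 1) * B) \<le> 1 / 16"
  proof -
    have p: "(2 * R + 1) * B > 0" using R B by simp
    have "\<tau> * ((2 * R + 1) * B) \<le> 1 / (16 * (2 * R + 1) * B) * ((2 * R + 1) * B)"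
      by (rule mult_right_mono) (use p in \<open>auto simp: \<tau>_def\<close>)
    also have "\<dots> = 1 / 16"
    proof -
      have "1 / (16 * q) * q = 1 / 16" if "q > 0" for q :: real using that by simp
      from this[OF p] show ?thesis by (simp only: mult.assoc)
    qed
    finally show ?thesis .
  qed
  have \<tau>2: "\<tau> * (C0 + D) \<le> c0 / 2"
  proof -
    have "\<tau> * (C0 + D) \<le> c0 / (2 * (C0 + D + 1)) * (C0 + D)"
      by (rule mult_right_mono) (use C0 D in \<open>auto simp: \<tau>_def\<close>)
    also have "\<dots> \<le> c0 / 2"
      using C0 D c0 by (simp add: divide_le_eq add_nonneg_pos mult_left_mono)
    finally show ?thesis .
  qed
  have main: "integrable gauss_vec (\<lambda>k. 2 * Phi (k \<bullet> x') * exp (- \<tau> * (score_vec x k \<bullet> (x' - x)))) \<and>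
     (\<integral>k. 2 * Phi (k \<bullet> x') * exp (- \<tau> * (score_vec x k \<bullet> (x' - x))) \<partial>gauss_vec) * exp (\<tau>^2 * D * (norm (x' - x))^2)
       \<le> exp (- (\<tau> * c0 / 2) * (norm (x' - x))^2)"
    if x: "norm x \<le> R" and x': "norm x' \<le> R" for x x' :: "real^'n"
  proof -
    define d where "d = x' - x"
    define m where "m k = score_vec x k \<bullet> d" for k
    have mm [measurable]: "m \<in> borel_measurable borel" unfolding m_def by measurable
    have dR: "norm d \<le> 2 * R + 1" unfolding d_def using norm_triangle_ineq4[of x' x] x x' by simp
    have mB: "\<bar>m k\<bar> \<le> B * norm d * (1 + norm k)^2" for k
    proof -
      have "\<bar>m k\<bar> \<le> 8 * (1 + norm x) * norm d * (1 + norm k)^2" unfolding m_def by (rule score_vec_inner_le)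
      also have "\<dots> \<le> B * norm d * (1 + norm k)^2"
        unfolding B_def using x by (intro mult_right_mono mult_left_mono) auto
      finally show ?thesis .
    qed
    have em: "\<tau> * \<bar>m k\<bar> \<le> 1/8 + (norm k)^2 / 8" for k
    proof -
      have "\<tau> * \<bar>m k\<bar> \<le> \<tau> * (B * (2 * R + 1) * (1 + norm k)^2)"
        using \<tau>0 dR B by (intro mult_left_mono order_trans[OF mB] mult_right_mono mult_left_mono) auto
      also have "\<dots> = (\<tau> * ((2 * R + 1) * B)) * (1 + norm k)^2" by (simp only: mult_ac)
      also have "\<dots> \<le> 1/16 * (1 + norm k)^2" by (rule mult_right_mono[OF \<tau>1]) simp
      also have "(1 + norm k)^2 \<le> 2 + 2 * (norm k)^2"
        using sum_squares_bound[of 1 "norm k"] by (simp add: power2_eq_square algebra_simps)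
      finally show ?thesis by simp
    qed
    have q: "(m k)^2 * exp (\<tau> * \<bar>m k\<bar>) \<le> (norm d)^2 * (B^2 * exp (1/8) * E k)" for k
    proof -
      have "\<bar>m k\<bar>^2 \<le> (B * norm d * (1 + norm k)^2)^2" by (intro power_mono mB) auto
      moreover have "exp (\<tau> * \<bar>m k\<bar>) \<le> exp (1/8) * exp ((norm k)^2 / 8)"
        using em[of k] by (simp flip: exp_add)
      ultimately have "\<bar>m k\<bar>^2 * exp (\<tau> * \<bar>m k\<bar>) \<le> (B * norm d * (1 + norm k)^2)^2 * (exp (1/8) * exp ((norm k)^2 / 8))"
        by (intro mult_mono) auto
      also have "\<dots> = (norm d)^2 * (B^2 * exp (1/8) * E k)"
        by (simp add: E_def power_mult_distrib mult_ac flip: power_mult)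
      finally show ?thesis by simp
    qed
    have im: "integrable gauss_vec m" unfolding m_def[abs_def] by (rule integrable_score_vec)
    define U where "U k = 1 - \<tau> * m k + \<tau>^2 / 2 * ((norm d)^2 * (B^2 * exp (1/8) * E k))" for k
    have iU: "integrable gauss_vec U" unfolding U_def[abs_def]
      by (intro Bochner_Integration.integrable_add Bochner_Integration.integrable_diff integrable_mult_right im iE) simp
    have le: "exp (- \<tau> * m k) \<le> U k" for k
    proof -
      have "exp (- \<tau> * m k) \<le> 1 + (- \<tau> * m k) + (- \<tau> * m k)^2 / 2 * exp \<bar>- \<tau> * m k\<bar>" by (rule exp_le_quadratic)
      also have "\<dots> = 1 - \<tau> * m k + \<tau>^2 / 2 * ((m k)^2 * exp (\<tau> * \<bar>m k\<bar>))"
        using \<tau>0 by (simp add: abs_mult power_mult_distrib)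
      also have "\<dots> \<le> U k" unfolding U_def by (intro add_left_mono mult_left_mono q) auto
      finally show ?thesis .
    qed
    have ie: "integrable gauss_vec (\<lambda>k. exp (- \<tau> * m k))"
      by (rule Bochner_Integration.integrable_bound[OF iU]) (use le in \<open>auto intro: order_trans[OF _ abs_ge_self]\<close>)
    have ie2: "integrable gauss_vec (\<lambda>k. 2 * Phi (k \<bullet> x') * exp (- \<tau> * m k))"
      using integrable_folded_law(2)[OF ie, of x'] by simp
    have i1: "integrable gauss_vec (\<lambda>k. 2 * Phi (k \<bullet> x') * m k)" "integrable gauss_vec (\<lambda>k. 2 * Phi (k \<bullet> x'))"
        "integrable gauss_vec (\<lambda>k. 2 * Phi (k \<bullet> x') * E k)"
      using integrable_folded_law(2)[OF im, of x'] integrable_gauss_Phi[of x'] integrable_folded_law(2)[OF iE, of x'] by simp_all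
    let ?K = "\<tau>^2 / 2 * ((norm d)^2 * (B^2 * exp (1/8)))"
    have "(\<integral>k. 2 * Phi (k \<bullet> x') * exp (- \<tau> * m k) \<partial>gauss_vec) \<le> (\<integral>k. 2 * Phi (k \<bullet> x') * U k \<partial>gauss_vec)"
      by (rule integral_mono) (use ie2 integrable_folded_law(2)[OF iU, of x'] le in \<open>auto intro!: mult_left_mono\<close>)
    also have "\<dots> = (\<integral>k. 2 * Phi (k \<bullet> x') - \<tau> * (2 * Phi (k \<bullet> x') * m k) + ?K * (2 * Phi (k \<bullet> x') * E k) \<partial>gauss_vec)"
      unfolding U_def by (intro Bochner_Integration.integral_cong refl) (simp add: algebra_simps)
    also have "\<dots> = (\<integral>k. 2 * Phi (k \<bullet> x') \<partial>gauss_vec) - \<tau> * (\<integral>k. 2 * Phi (k \<bullet> x') * m k \<partial>gauss_vec)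
        + ?K * (\<integral>k. 2 * Phi (k \<bullet> x') * E k \<partial>gauss_vec)"
      by (subst Bochner_Integration.integral_add, intro Bochner_Integration.integrable_diff integrable_mult_right i1, intro integrable_mult_right i1,
          subst Bochner_Integration.integral_diff, intro i1, intro integrable_mult_right i1, simp only: integral_mult_right_zero)
    also have "\<dots> \<le> 1 - \<tau> * (c0 * (norm d)^2) + ?K * (2 * (\<integral>k. E k \<partial>gauss_vec))"
    proof (intro add_mono diff_mono mult_left_mono)
      show "(\<integral>k. 2 * Phi (k \<bullet> x') \<partial>gauss_vec) \<le> 1" by (simp add: integral_gauss_Phi)
      show "c0 * (norm d)^2 \<le> (\<integral>k. 2 * Phi (k \<bullet> x') * m k \<partial>gauss_vec)"
        unfolding m_def d_def by (rule c0(2)[OF x x'])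
      have "(\<integral>k. 2 * Phi (k \<bullet> x') * E k \<partial>gauss_vec) = (\<integral>k. E k \<partial>folded_law x')" by (subst integral_folded_law) auto
      also have "\<dots> \<le> 2 * (\<integral>k. E k \<partial>gauss_vec)" by (rule integral_folded_law_le[OF iE]) (simp add: E_def)
      finally show "(\<integral>k. 2 * Phi (k \<bullet> x') * E k \<partial>gauss_vec) \<le> 2 * (\<integral>k. E k \<partial>gauss_vec)" .
    qed (use \<tau>0 in auto)
    also have "\<dots> = 1 + (- \<tau> * c0 + \<tau>^2 * C0) * (norm d)^2" by (simp add: C0_def algebra_simps)
    also have "\<dots> \<le> exp ((- \<tau> * c0 + \<tau>^2 * C0) * (norm d)^2)" by (rule exp_ge_add_one_self)
    finally have "(\<integral>k. 2 * Phi (k \<bullet> x') * exp (- \<tau> * m k) \<partial>gauss_vec) * exp (\<tau>^2 * D * (norm d)^2)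
        \<le> exp ((- \<tau> * c0 + \<tau>^2 * C0) * (norm d)^2) * exp (\<tau>^2 * D * (norm d)^2)" by (rule mult_right_mono) simp
    also have "\<dots> = exp (\<tau> * (\<tau> * (C0 + D) - c0) * (norm d)^2)"
      by (simp add: power2_eq_square algebra_simps flip: exp_add)
    also have "\<dots> \<le> exp (\<tau> * (- c0 / 2) * (norm d)^2)"
      using \<tau>2 \<tau>0 unfolding exp_le_cancel_iff by (intro mult_right_mono mult_left_mono) auto
    finally show ?thesis using ie2 by (simp add: m_def d_def)
  qed
  show ?thesis
    using main \<tau>0 c0(1) by (intro exI[of _ \<tau>] conjI exI[of _ "\<tau> * c0 / 2"] allI impI) auto
qed

subsection \<open>Whitening\<close>

definition fisher_eig :: "'n \<Rightarrow> real^'n::finite \<Rightarrow> 'n \<Rightarrow> real" where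
  "fisher_eig k x i = (if i = k then zeta 2 (norm x) else zeta 0 (norm x))"

lemma fisher_eig_pos [simp]: "fisher_eig k x i > 0" by (simp add: fisher_eig_def)

lemma fisher_eig_ne_0 [simp]: "fisher_eig k x i \<noteq> 0" using fisher_eig_pos[of k x i] by linarith

text \<open>The map \<open>J\<^sup>-\<^sup>1\<^sup>/\<^sup>2\<close> for the Fisher information matrix \<open>J\<close> at \<open>x\<close>, up to a rotation.\<close>
definition wmap :: "'n \<Rightarrow> real^'n::finite \<Rightarrow> (real^'n \<Rightarrow> real^'n) \<Rightarrow> real^'n \<Rightarrow> real^'n" where
  "wmap k x T v = T (dil (\<lambda>i. 1 / sqrt (fisher_eig k x i)) v)"

context
  fixes k :: "'n::finite" and x :: "real^'n" and T :: "real^'n \<Rightarrow> real^'n"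
  assumes frame: "polar_frame k x T"
begin

lemma frame_orthogonal: "orthogonal_transformation T"
  using frame by (simp add: polar_frame_def)

lemma linear_wmap: "linear (wmap k x T)"
proof -
  have "wmap k x T = T \<circ> dil (\<lambda>i. 1 / sqrt (fisher_eig k x i))" by (auto simp: wmap_def)
  then show ?thesis
    using linear_compose[OF linear_dil orthogonal_transformation_linear[OF frame_orthogonal]] by simp
qed

lemma wmap_measurable [measurable]: "wmap k x T \<in> borel_measurable borel"
  using linear_wmap by (intro borel_measurable_continuous_onI linear_continuous_on) (simp add: linear_conv_bounded_linear)

lemma wmap_eq_sum: "wmap k x T v = (\<Sum>i\<in>UNIV. (v $ i / sqrt (fisher_eig k x i)) *\<^sub>R T (axis i 1))"
proof -
  have "dil (\<lambda>i. 1 / sqrt (fisher_eig k x i)) v = (\<Sum>i\<in>UNIV. (v $ i / sqrt (fisher_eig k x i)) *\<^sub>R axis i 1)"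
    by (simp add: vec_eq_iff axis_def if_distrib cong: if_cong)
  then show ?thesis
    unfolding wmap_def using orthogonal_transformation_linear[OF frame_orthogonal]
    by (simp add: linear_sum linear_scale)
qed

text \<open>In whitened coordinates the Fisher form is the Euclidean inner product, so the limiting
  score is a standard Gaussian vector.\<close>

lemma finfo_wmap: "finfo x (wmap k x T a) (wmap k x T b) = a \<bullet> b"
proof -
  have f: "finfo x (T (axis i 1)) (T (axis j 1)) = (if i = j then fisher_eig k x i else 0)" for i j
    using frame by (simp add: polar_frame_def fisher_eig_def)
  have "finfo x (wmap k x T a) (wmap k x T b)
      = (\<Sum>i\<in>UNIV. \<Sum>j\<in>UNIV. a $ i / sqrt (fisher_eig k x i) * (b $ j / sqrt (fisher_eig k x j)) * (if i = j then fisher_eig k x i else 0))"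
    unfolding wmap_eq_sum finfo_bilinear f ..
  also have "\<dots> = (\<Sum>i\<in>UNIV. a $ i / sqrt (fisher_eig k x i) * (b $ i / sqrt (fisher_eig k x i)) * fisher_eig k x i)"
    by (simp add: if_distrib cong: if_cong)
  also have "\<dots> = a \<bullet> b"
    unfolding inner_vec_def
  proof (intro sum.cong refl)
    fix i
    have "sqrt (fisher_eig k x i) * sqrt (fisher_eig k x i) = fisher_eig k x i" by (simp add: abs_of_pos)
    then show "a $ i / sqrt (fisher_eig k x i) * (b $ i / sqrt (fisher_eig k x i)) * fisher_eig k x i = a $ i \<bullet> b $ i"
      using fisher_eig_pos[of k x i] by (simp add: field_simps abs_of_pos)
  qed
  finally show ?thesis .
qed

lemma norm_wmap: "(norm (wmap k x T v))^2 = (\<Sum>i\<in>UNIV. (v $ i)^2 / fisher_eig k x i)"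
proof -
  have "norm (wmap k x T v) = norm (dil (\<lambda>i. 1 / sqrt (fisher_eig k x i)) v)"
    unfolding wmap_def by (rule orthogonal_transformation_norm[OF frame_orthogonal])
  then show ?thesis
    by (simp add: norm_vec_def L2_set_def sum_nonneg power_divide less_imp_le[OF fisher_eig_pos])
qed

lemma norm_wmap_bounds:
  assumes "\<And>i. fisher_eig k x i \<le> b"
  shows "(norm v)^2 \<le> b * (norm (wmap k x T v))^2"
proof -
  have "(norm v)^2 = (\<Sum>i\<in>UNIV. (v $ i)^2)" by (simp add: norm_vec_def L2_set_def sum_nonneg)
  also have "\<dots> \<le> (\<Sum>i\<in>UNIV. b * ((v $ i)^2 / fisher_eig k x i))"
  proof (rule sum_mono)
    fix i
    have "(v $ i)^2 / fisher_eig k x i * fisher_eig k x i \<le> (v $ i)^2 / fisher_eig k x i * b"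
      by (intro mult_left_mono assms divide_nonneg_pos) auto
    then show "(v $ i)^2 \<le> b * ((v $ i)^2 / fisher_eig k x i)"
      using fisher_eig_pos[of k x i] by (simp add: mult.commute)
  qed
  finally show ?thesis by (simp add: norm_wmap sum_distrib_left)
qed

lemma norm_wmap_le:
  assumes "\<And>i. fisher_eig k x i \<ge> b" and "b > 0"
  shows "(norm (wmap k x T v))^2 \<le> (norm v)^2 / b"
proof -
  have "(norm (wmap k x T v))^2 \<le> (\<Sum>i\<in>UNIV. (v $ i)^2 / b)"
    unfolding norm_wmap using assms by (intro sum_mono frac_le) auto
  also have "\<dots> = (norm v)^2 / b"
    by (simp add: norm_vec_def L2_set_def sum_nonneg sum_divide_distrib)
  finally show ?thesis .
qed

text \<open>The Jacobian of whitening is the reciprocal of the Jeffreys weight. This identity is why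
  Jeffreys' prior yields a limit that does not depend on the input.\<close>

lemma prod_fisher_eig: "(\<Prod>i\<in>UNIV. 1 / sqrt (fisher_eig k x i)) = 1 / jeffreys_weight CARD('n) (norm x)"
proof -
  have "(\<Prod>i\<in>UNIV. fisher_eig k x i) = zeta 2 (norm x) * (\<Prod>i\<in>UNIV - {k}. fisher_eig k x i)"
    by (subst prod.remove[of _ k]) (auto simp: fisher_eig_def)
  also have "(\<Prod>i\<in>UNIV - {k}. fisher_eig k x i) = (\<Prod>i\<in>UNIV - {k}. zeta 0 (norm x))"
    by (intro prod.cong) (auto simp: fisher_eig_def)
  finally have "(\<Prod>i\<in>UNIV. fisher_eig k x i) = det (fisher x)" by (simp add: det_fisher card_Diff_singleton)
  moreover have "(\<Prod>i\<in>UNIV. 1 / sqrt (fisher_eig k x i)) = 1 / sqrt (\<Prod>i\<in>UNIV. fisher_eig k x i)"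
  proof -
    have "sqrt (\<Prod>i\<in>A. f i) = (\<Prod>i\<in>A. sqrt (f i))" for A :: "'n set" and f :: "'n \<Rightarrow> real"
      by (induction A rule: infinite_finite_induct) (auto simp: real_sqrt_mult)
    then show ?thesis by (simp add: prod_dividef)
  qed
  ultimately show ?thesis by (simp add: sqrt_det_fisher)
qed

lemma nn_integral_lborel_wmap:
  assumes N: "N > 0" and [measurable]: "f \<in> borel_measurable borel"
  shows "(\<integral>\<^sup>+y. f y \<partial>lborel) = ennreal (1 / (sqrt (real N) ^ CARD('n) * jeffreys_weight CARD('n) (norm x)))
      * (\<integral>\<^sup>+v. f (x + (1 / sqrt (real N)) *\<^sub>R wmap k x T v) \<partial>lborel)"
proof -
  let ?s = "1 / sqrt (real N)"
  have s: "?s > 0" using N by simp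
  have dils: "dil (\<lambda>_. ?s) y = ?s *\<^sub>R y" for y :: "real^'n" by (simp add: vec_eq_iff)
  have "(\<integral>\<^sup>+y. f y \<partial>lborel) = (\<integral>\<^sup>+y. f y \<partial>distr lborel borel ((+) x))"
    by (simp add: lborel_distr_plus)
  also have "\<dots> = (\<integral>\<^sup>+y. f (x + y) \<partial>lborel)" by (simp add: nn_integral_distr)
  also have "\<dots> = ennreal (\<Prod>i\<in>(UNIV::'n set). ?s) * (\<integral>\<^sup>+y. f (x + dil (\<lambda>_. ?s) y) \<partial>lborel)"
    by (rule nn_integral_lborel_dil) (use s in auto)
  also have "(\<integral>\<^sup>+y. f (x + dil (\<lambda>_. ?s) y) \<partial>lborel) = ennreal (\<Prod>i\<in>UNIV. 1 / sqrt (fisher_eig k x i)) *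
      (\<integral>\<^sup>+v. f (x + dil (\<lambda>_. ?s) (T (dil (\<lambda>i. 1 / sqrt (fisher_eig k x i)) v))) \<partial>lborel)"
    by (rule nn_integral_lborel_linear[OF _ frame_orthogonal]) auto
  finally show ?thesis
    unfolding prod_fisher_eig dils wmap_def[symmetric]
    by (simp add: ennreal_mult[symmetric] mult.assoc[symmetric] power_one_over)
qed

end

subsection \<open>Lower bound for the divergence from a mixture\<close>

interpretation folded_law: prob_space "folded_law x" for x :: "real^'n::finite"
  by (rule prob_space_folded_law)

lemma measurable_folded_law [simp]: "measurable (folded_law x) M = measurable borel M"
  by (rule measurable_cong_sets) simp_all

lemma measurable_iid_sum [measurable]:
  fixes f :: "real^'n::finite \<Rightarrow> real"
  assumes f: "f \<in> borel_measurable borel"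
  shows "(\<lambda>K. \<Sum>l<N. f (K l)) \<in> borel_measurable (chan_H N)"
  using f by (intro borel_measurable_sum measurable_compose[OF chan_H_component]) auto

text \<open>Expectations weighted by the likelihood become expectations over independent samples, to
  which the moment bounds apply.\<close>

lemma iid_folded_law_eq_density:
  "PiM {..<N} (\<lambda>_. folded_law x) = density (chan_H N) (\<lambda>K. ennreal (lik N (x :: real^'n::finite) K))" (is "_ = ?P")
proof -
  interpret p: product_sigma_finite "\<lambda>_::nat. folded_law x" by standard
  interpret g: product_sigma_finite "\<lambda>_::nat. gauss_vec :: (real^'n) measure" by standard
  show ?thesis
  proof (rule sym, rule p.PiM_eqI)
    show "sets ?P = sets (PiM {..<N} (\<lambda>_. folded_law x))"
      unfolding chan_H_def by (simp, intro sets_PiM_cong) auto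
    fix A :: "nat \<Rightarrow> (real^'n) set" assume "\<And>i. i \<in> {..<N} \<Longrightarrow> A i \<in> sets (folded_law x)"
    then have A: "A i \<in> sets borel" if "i < N" for i using that by simp
    have Am: "Pi\<^sub>E {..<N} A \<in> sets (chan_H N)"
      unfolding chan_H_def by (rule sets_PiM_I_finite) (use A in auto)
    have "emeasure ?P (Pi\<^sub>E {..<N} A) = (\<integral>\<^sup>+K. ennreal (lik N x K) * indicator (Pi\<^sub>E {..<N} A) K \<partial>chan_H N)"
      by (rule emeasure_density) (use Am in auto)
    also have "\<dots> = (\<integral>\<^sup>+K. (\<Prod>i<N. ennreal (2 * Phi (K i \<bullet> x)) * indicator (A i) (K i)) \<partial>chan_H N)"
    proof (rule nn_integral_cong)
      fix K assume K: "K \<in> space (chan_H N :: (nat \<Rightarrow> real^'n) measure)"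
      have ind: "(indicator (Pi\<^sub>E {..<N} A) K :: ennreal) = (\<Prod>i<N. indicator (A i) (K i))"
      proof (cases "K \<in> Pi\<^sub>E {..<N} A")
        case True then show ?thesis by (auto intro!: prod.neutral[symmetric] simp: PiE_iff)
      next
        case False
        then obtain i where "i < N" "K i \<notin> A i"
          using K by (auto simp: chan_H_def space_PiM PiE_iff)
        then have "(\<Prod>i<N. (indicator (A i) (K i) :: ennreal)) = 0"
          by (intro prod_zero bexI[of _ i]) auto
        with False show ?thesis by simp
      qed
      have "ennreal (lik N x K) = (\<Prod>i<N. ennreal (2 * Phi (K i \<bullet> x)))"
        unfolding lik_def by (rule prod_ennreal[symmetric]) auto
      then show "ennreal (lik N x K) * indicator (Pi\<^sub>E {..<N} A) K = (\<Prod>i<N. ennreal (2 * Phi (K i \<bullet> x)) * indicator (A i) (K i))"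
        unfolding ind by (simp only: prod.distrib)
    qed
    also have "\<dots> = (\<Prod>i<N. (\<integral>\<^sup>+k. ennreal (2 * Phi (k \<bullet> x)) * indicator (A i) k \<partial>gauss_vec))"
      unfolding chan_H_def by (rule g.product_nn_integral_prod) (use A in auto)
    also have "\<dots> = (\<Prod>i<N. emeasure (folded_law x) (A i))"
      unfolding folded_law_def by (intro prod.cong refl emeasure_density[symmetric]) (use A in auto)
    finally show "emeasure ?P (Pi\<^sub>E {..<N} A) = (\<Prod>i<N. emeasure (folded_law x) (A i))" .
  qed auto
qed

lemma
  fixes f :: "(nat \<Rightarrow> real^'n::finite) \<Rightarrow> real"
  assumes f: "f \<in> borel_measurable (chan_H N)"
  shows integral_lik_times: "(\<integral>K. lik N x K * f K \<partial>chan_H N) = (\<integral>K. f K \<partial>PiM {..<N} (\<lambda>_. folded_law x))"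
    and integrable_lik_times: "integrable (chan_H N) (\<lambda>K. lik N x K * f K) \<longleftrightarrow> integrable (PiM {..<N} (\<lambda>_. folded_law x)) f"
  unfolding iid_folded_law_eq_density using f
  by (subst integral_density, simp_all) (subst integrable_density, simp_all)

lemma integral_pos:
  fixes f :: "'a \<Rightarrow> real"
  assumes "prob_space M" and i: "integrable M f" and pos: "\<And>x. f x > 0"
  shows "(\<integral>x. f x \<partial>M) > 0"
proof -
  interpret prob_space M by fact
  have nn: "AE x in M. 0 \<le> f x" using pos by (auto intro: less_imp_le)
  have "(\<integral>x. f x \<partial>M) \<noteq> 0"
  proof
    assume "(\<integral>x. f x \<partial>M) = 0"
    then have "AE x in M. f x = 0" by (subst (asm) integral_nonneg_eq_0_iff_AE) (use i nn in auto)
    then have "AE x in M. False" by eventually_elim (metis less_irrefl pos)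
    then show False by simp
  qed
  moreover have "(\<integral>x. f x \<partial>M) \<ge> 0" by (rule integral_nonneg_AE[OF nn])
  ultimately show ?thesis by simp
qed

text \<open>The limit experiment is a Gaussian shift: \<open>gshift v\<close> is the expectation of \<open>exp (-|v + Y|\<^sup>2 / 2)\<close>.\<close>
definition gshift :: "real^'n::finite \<Rightarrow> real" where
  "gshift v = (\<integral>Y. exp (- ((norm (v + Y))^2) / 2) \<partial>gauss_vec)"

lemma integrable_gshift: "integrable gauss_vec (\<lambda>Y::real^'n::finite. exp (- ((norm (v + Y))^2) / 2))"
  by (rule integrable_gauss_poly_bound[where C = 1 and p = 0]) auto

lemma gshift_pos: "gshift v > 0"
  unfolding gshift_def by (rule integral_pos[OF prob_space_gauss integrable_gshift]) simp

lemma gshift_measurable [measurable]: "gshift \<in> borel_measurable (borel :: (real^'n::finite) measure)"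
  unfolding gshift_def[abs_def] by (rule gauss.borel_measurable_lebesgue_integral) measurable

lemma emeasure_gauss_UNIV [simp]: "emeasure (gauss_vec :: (real^'n::finite) measure) UNIV = 1"
  using prob_space.emeasure_space_1[OF prob_space_gauss[where 'n = 'n]] by simp

lemma nn_integral_exp_neg_norm:
  "(\<integral>\<^sup>+v. ennreal (exp (- ((norm (v::real^'n::finite))^2) / 2)) \<partial>lborel) = ennreal ((2 * pi) powr (real CARD('n) / 2))"
proof -
  let ?c = "(2 * pi) powr (- (real CARD('n)) / 2)"
  have c: "?c > 0" by simp
  have "(\<integral>\<^sup>+(v::real^'n). 1 \<partial>gauss_vec) = (\<integral>\<^sup>+v. ennreal (?c * exp (- ((norm (v::real^'n))^2) / 2)) \<partial>lborel)"
    unfolding gauss_vec_def by (subst nn_integral_density) auto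
  also have "\<dots> = ennreal ?c * (\<integral>\<^sup>+v. ennreal (exp (- ((norm (v::real^'n))^2) / 2)) \<partial>lborel)"
    by (subst nn_integral_cmult[symmetric]) (auto simp: ennreal_mult)
  finally have 1: "1 = ennreal ?c * (\<integral>\<^sup>+v. ennreal (exp (- ((norm (v::real^'n))^2) / 2)) \<partial>lborel)"
    by simp
  have "ennreal ((2 * pi) powr (real CARD('n) / 2)) * ennreal ?c = 1"
    by (subst ennreal_mult[symmetric]) (auto simp flip: powr_add)
  then have "(\<integral>\<^sup>+v. ennreal (exp (- ((norm (v::real^'n))^2) / 2)) \<partial>lborel)
      = ennreal ((2 * pi) powr (real CARD('n) / 2)) * (ennreal ?c * (\<integral>\<^sup>+v. ennreal (exp (- ((norm (v::real^'n))^2) / 2)) \<partial>lborel))"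
    by (simp add: mult.assoc[symmetric])
  then show ?thesis unfolding 1[symmetric] by simp
qed

lemma integrable_exp_neg_norm:
  assumes "c > 0"
  shows "integrable lborel (\<lambda>v::real^'n::finite. exp (- c * (norm v)^2))"
proof (rule integrableI_bounded)
  let ?s = "1 / sqrt (2 * c)"
  have s: "?s > 0" using assms by simp
  have d: "(norm (dil (\<lambda>_. ?s) v))^2 = (norm v)^2 / (2 * c)" for v :: "real^'n"
  proof -
    have "dil (\<lambda>_. ?s) v = ?s *\<^sub>R v" by (simp add: vec_eq_iff)
    then show ?thesis using assms by (simp add: power_divide)
  qed
  have "(\<integral>\<^sup>+v. ennreal (norm (exp (- c * (norm (v::real^'n))^2))) \<partial>lborel)
      = ennreal (\<Prod>i\<in>(UNIV::'n set). ?s) * (\<integral>\<^sup>+v. ennreal (norm (exp (- c * (norm (dil (\<lambda>_. ?s) (v::real^'n)))^2))) \<partial>lborel)"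
    by (rule nn_integral_lborel_dil) (use s in auto)
  also have "(\<integral>\<^sup>+v. ennreal (norm (exp (- c * (norm (dil (\<lambda>_. ?s) (v::real^'n)))^2))) \<partial>lborel)
     = ennreal ((2 * pi) powr (real CARD('n) / 2))"
    unfolding d nn_integral_exp_neg_norm[symmetric] using assms by simp
  also have "ennreal (\<Prod>i\<in>(UNIV::'n set). ?s) * ennreal ((2 * pi) powr (real CARD('n) / 2)) < \<infinity>"
    by (simp add: ennreal_mult_less_top)
  finally show "(\<integral>\<^sup>+v. ennreal (norm (exp (- c * (norm (v::real^'n))^2))) \<partial>lborel) < \<infinity>" .
qed simp

text \<open>After exchanging the integrals, translation invariance removes the random shift and
  leaves the Gaussian integral.\<close>

lemma nn_integral_gshift:
  "(\<integral>\<^sup>+v. ennreal (gshift (v::real^'n::finite)) \<partial>lborel) = ennreal ((2 * pi) powr (real CARD('n) / 2))"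
proof -
  interpret pair_sigma_finite lborel "gauss_vec :: (real^'n) measure" ..
  have "(\<integral>\<^sup>+v. ennreal (gshift (v::real^'n)) \<partial>lborel)
      = (\<integral>\<^sup>+v. (\<integral>\<^sup>+Y. ennreal (exp (- ((norm (v + Y :: real^'n))^2) / 2)) \<partial>gauss_vec) \<partial>lborel)"
    unfolding gshift_def by (intro nn_integral_cong nn_integral_eq_integral[symmetric] integrable_gshift) auto
  also have "\<dots> = (\<integral>\<^sup>+Y. (\<integral>\<^sup>+v. ennreal (exp (- ((norm (v + Y :: real^'n))^2) / 2)) \<partial>lborel) \<partial>gauss_vec)"
    by (rule Fubini'[symmetric]) measurable
  also have "\<dots> = (\<integral>\<^sup>+Y. (\<integral>\<^sup>+v. ennreal (exp (- ((norm (v :: real^'n))^2) / 2)) \<partial>lborel) \<partial>(gauss_vec :: (real^'n) measure))"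
  proof (rule nn_integral_cong)
    fix Y :: "real^'n"
    have "(\<integral>\<^sup>+v. ennreal (exp (- ((norm (v :: real^'n))^2) / 2)) \<partial>lborel)
        = (\<integral>\<^sup>+v. ennreal (exp (- ((norm (v :: real^'n))^2) / 2)) \<partial>distr lborel borel ((+) Y))"
      by (simp add: lborel_distr_plus)
    also have "\<dots> = (\<integral>\<^sup>+v. ennreal (exp (- ((norm (v + Y :: real^'n))^2) / 2)) \<partial>lborel)"
      by (simp add: nn_integral_distr add.commute)
    finally show "(\<integral>\<^sup>+v. ennreal (exp (- ((norm (v + Y :: real^'n))^2) / 2)) \<partial>lborel)
        = (\<integral>\<^sup>+v. ennreal (exp (- ((norm (v :: real^'n))^2) / 2)) \<partial>lborel)" by simp
  qed
  also have "\<dots> = ennreal ((2 * pi) powr (real CARD('n) / 2))"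
    unfolding nn_integral_exp_neg_norm by simp
  finally show ?thesis .
qed

text \<open>\<open>exp (-|w|^2/2)\<close> is the characteristic function at \<open>w\<close> of a
  Gaussian V, used here for \<open>w = v + Y\<close> and then again for Y. The same device for the
  finite-sample statistic reduces its limit to pointwise convergence of characteristic
  functions.\<close>

lemma gshift_char:
  fixes v :: "real^'n::finite"
  shows "(\<integral>V. exp (\<i> * complex_of_real (v \<bullet> V) - complex_of_real ((norm V)^2) / 2) \<partial>gauss_vec) = complex_of_real (gshift v)"
proof -
  interpret pair_prob_space "gauss_vec :: (real^'n) measure" "gauss_vec :: (real^'n) measure" ..
  have i: "integrable (gauss_vec \<Otimes>\<^sub>M gauss_vec) (\<lambda>(V, Y). iexp (V \<bullet> (v + Y)))"
    by (rule integrable_const_bound[of _ 1]) (auto simp: split_beta')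
  have "(\<integral>V. exp (\<i> * complex_of_real (v \<bullet> V) - complex_of_real ((norm V)^2) / 2) \<partial>gauss_vec)
      = (\<integral>V. (\<integral>Y. iexp (V \<bullet> (v + Y)) \<partial>gauss_vec) \<partial>gauss_vec)"
  proof (rule Bochner_Integration.integral_cong[OF refl])
    fix V :: "real^'n"
    have "exp (\<i> * complex_of_real (v \<bullet> V) - complex_of_real ((norm V)^2) / 2)
        = iexp (v \<bullet> V) * complex_of_real (exp (- ((norm V)^2) / 2))"
    proof -
      have "exp (a - b / 2) = exp a * exp (- b / 2)" for a b :: complex by (simp flip: exp_add)
      from this[of "\<i> * complex_of_real (v \<bullet> V)" "complex_of_real ((norm V)^2)"]
      show ?thesis by (simp only: exp_of_real[symmetric] of_real_minus of_real_divide of_real_numeral)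
    qed
    also have "\<dots> = (\<integral>Y. iexp (v \<bullet> V) * iexp (Y \<bullet> V) \<partial>gauss_vec)"
      unfolding gauss_char[symmetric] by simp
    also have "\<dots> = (\<integral>Y. iexp (V \<bullet> (v + Y)) \<partial>gauss_vec)"
      by (simp add: inner_add_right inner_commute algebra_simps flip: exp_add)
    finally show "exp (\<i> * complex_of_real (v \<bullet> V) - complex_of_real ((norm V)^2) / 2) = (\<integral>Y. iexp (V \<bullet> (v + Y)) \<partial>gauss_vec)" .
  qed
  also have "\<dots> = (\<integral>Y. (\<integral>V. iexp (V \<bullet> (v + Y)) \<partial>gauss_vec) \<partial>gauss_vec)"
    by (rule Fubini_integral[symmetric, OF i])
  also have "\<dots> = (\<integral>Y. complex_of_real (exp (- ((norm (v + Y))^2) / 2)) \<partial>gauss_vec)"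
    by (simp add: gauss_char)
  also have "\<dots> = complex_of_real (gshift v)" unfolding gshift_def by (rule integral_of_real[OF integrable_gshift])
  finally show ?thesis .
qed

section \<open>The whitened score statistic and its limit\<close>

context
  fixes k :: "'n::finite" and x :: "real^'n" and T :: "real^'n \<Rightarrow> real^'n"
  assumes frame: "polar_frame k x T"
begin

abbreviation whiten where "whiten \<equiv> wmap k x T"

lemma whiten_eq_sum: "whiten v = (\<Sum>i\<in>UNIV. v $ i *\<^sub>R whiten (axis i 1))"
proof -
  have "v = (\<Sum>i\<in>UNIV. v $ i *\<^sub>R axis i 1)" by (simp add: vec_eq_iff axis_def if_distrib cong: if_cong)
  then have "whiten v = whiten (\<Sum>i\<in>UNIV. v $ i *\<^sub>R axis i 1)" by simp
  also have "\<dots> = (\<Sum>i\<in>UNIV. v $ i *\<^sub>R whiten (axis i 1))"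
    using linear_wmap[OF frame] by (simp add: linear_sum linear_scale)
  finally show ?thesis .
qed

text \<open>The central sequence at \<open>x\<close>: the sum of the scores over
  \<open>sqrt N\<close>, tested on the whitened coordinate directions. This is the vector S of the
  overview.\<close>

definition stat :: "nat \<Rightarrow> (nat \<Rightarrow> real^'n) \<Rightarrow> real^'n" where
  "stat N K = (\<chi> i. (\<Sum>l<N. score_vec x (K l) \<bullet> whiten (axis i 1)) / sqrt (real N))"

lemma inner_stat: "v \<bullet> stat N K = (\<Sum>l<N. score_vec x (K l) \<bullet> whiten v) / sqrt (real N)"
proof -
  have "v \<bullet> stat N K = (\<Sum>i\<in>UNIV. \<Sum>l<N. v $ i * (score_vec x (K l) \<bullet> whiten (axis i 1)) / sqrt (real N))"
    by (simp add: inner_vec_def stat_def sum_divide_distrib sum_distrib_left)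
  also have "\<dots> = (\<Sum>l<N. \<Sum>i\<in>UNIV. v $ i * (score_vec x (K l) \<bullet> whiten (axis i 1)) / sqrt (real N))"
    by (rule sum.swap)
  also have "\<dots> = (\<Sum>l<N. score_vec x (K l) \<bullet> whiten v) / sqrt (real N)"
    by (subst (2) whiten_eq_sum) (simp add: inner_sum_right sum_divide_distrib)
  finally show ?thesis .
qed

lemma stat_measurable [measurable]: "stat N \<in> borel_measurable (chan_H N)"
  unfolding stat_def[abs_def]
proof (subst borel_measurable_euclidean_space, rule ballI)
  fix b :: "real^'n" assume "b \<in> Basis"
  then obtain i where b: "b = axis i 1" by (auto simp: Basis_vec_def)
  show "(\<lambda>K. (\<chi> i. (\<Sum>l<N. score_vec x (K l) \<bullet> whiten (axis i 1)) / sqrt (real N)) \<bullet> b) \<in> borel_measurable (chan_H N)"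
    unfolding b inner_axis by simp
qed

lemma stat_second_moment:
  assumes N: "N > 0"
  shows "(\<integral>K. lik N x K * (norm (stat N K))^2 \<partial>chan_H N) = real CARD('n)"
    and "integrable (chan_H N) (\<lambda>K. lik N x K * (norm (stat N K))^2)"
proof -
  let ?P = "PiM {..<N} (\<lambda>_. folded_law x)"
  let ?a = "\<lambda>i k. score_vec x k \<bullet> whiten (axis i 1)"
  have am: "?a i \<in> borel_measurable (folded_law x)" for i by simp
  have i2: "integrable (folded_law x) (\<lambda>k. \<bar>?a i k\<bar>^2)" for i by (rule integrable_folded_law(1)[OF integrable_score_vec_power])
  have e: "(norm (stat N K))^2 = (\<Sum>i\<in>UNIV. (\<Sum>l<N. ?a i (K l))^2 / real N)" for K
    by (simp add: norm_vec_def L2_set_def sum_nonneg stat_def power_divide)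
  have i: "integrable ?P (\<lambda>K. (\<Sum>l<N. ?a i (K l))^2)" for i
    by (rule folded_law.integrable_iid_sum_power[OF am i2])
  have m: "(\<integral>K. (\<Sum>l<N. ?a i (K l))^2 \<partial>?P) = real N" for i
    by (subst folded_law.iid_sum_second_moment[OF am i2 folded_law_score_vec_mean])
      (simp add: power2_eq_square folded_law_score_vec_product finfo_wmap[OF frame] inner_axis_axis)
  have meas: "(\<lambda>K. (norm (stat N K))^2) \<in> borel_measurable (chan_H N)" by measurable
  show "(\<integral>K. lik N x K * (norm (stat N K))^2 \<partial>chan_H N) = real CARD('n)"
    unfolding integral_lik_times[OF meas] unfolding e using N by (simp add: i m)
  show "integrable (chan_H N) (\<lambda>K. lik N x K * (norm (stat N K))^2)"
    unfolding integrable_lik_times[OF meas] unfolding e by (intro Bochner_Integration.integrable_sum integrable_divide i)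
qed

text \<open>The statistic is built at \<open>x\<close> while the samples come from input
  \<open>x'\<close>; averaging over \<open>x'\<close> gives the expectation of
  \<open>exp (-|S|^2/2)\<close> under the mixture.\<close>

definition gpart :: "nat \<Rightarrow> real^'n \<Rightarrow> real" where
  "gpart N x' = (\<integral>K. lik N x' K * exp (- ((norm (stat N K))^2) / 2) \<partial>chan_H N)"

lemma integrable_gpart: "integrable (chan_H N) (\<lambda>K. lik N x' K * exp (- ((norm (stat N K))^2) / 2))"
proof (rule chan_H.integrable_const_bound[of _ "2 ^ N * 1"])
  show "AE K in chan_H N. norm (lik N x' K * exp (- ((norm (stat N K))^2) / 2)) \<le> 2 ^ N * 1"
    unfolding norm_mult by (intro AE_I2 mult_mono) (auto simp: lik_le)
qed measurable

lemma gpart_measurable [measurable]: "gpart N \<in> borel_measurable borel"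
  unfolding gpart_def[abs_def]
proof (rule chan_H.borel_measurable_lebesgue_integral)
  note [measurable] = lik_measurable_pair(1)[unfolded split_beta']
  show "(\<lambda>(x', K). lik N x' K * exp (- ((norm (stat N K))^2) / 2)) \<in> borel_measurable (borel \<Otimes>\<^sub>M chan_H N)"
    unfolding split_beta' by measurable
qed

lemma gpart_nonneg: "gpart N x' \<ge> 0"
  unfolding gpart_def by (intro integral_nonneg_AE) auto

text \<open>The Donsker-Varadhan variational bound with test function \<open>-|S|^2/2\<close>; under
  the input \<open>x\<close> this function has mean \<open>-n/2\<close>.\<close>

lemma KL_ge_gpart:
  assumes nu: "peak_input nu R'" and x: "norm x \<le> R'" and N: "N > 0"
  shows "KL N nu x \<ge> - real CARD('n) / 2 - ln (\<integral>x'. gpart N x' \<partial>nu)" "(\<integral>x'. gpart N x' \<partial>nu) > 0"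
proof -
  interpret nu: peak_input nu R' by fact
  define F where "F K = (norm (stat N K))^2 / 2" for K
  have [measurable]: "F \<in> borel_measurable (chan_H N)" unfolding F_def by measurable
  define c0 where "c0 = (\<integral>K. mix N nu K * exp (- F K) \<partial>chan_H N)"
  have ic: "integrable (chan_H N) (\<lambda>K. mix N nu K * exp (- F K))"
  proof (rule chan_H.integrable_const_bound[of _ "2 ^ N * 1"])
    show "AE K in chan_H N. norm (mix N nu K * exp (- F K)) \<le> 2 ^ N * 1"
      unfolding norm_mult by (intro AE_I2 mult_mono) (auto simp: nu.mix_le_2 F_def)
  qed measurable
  have c0: "c0 > 0" unfolding c0_def by (rule integral_pos[OF prob_space_chan_H ic]) simp
  have Fub: "c0 = (\<integral>x'. gpart N x' \<partial>nu)"
  proof -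
    note [measurable] = lik_measurable_pair(1)[unfolded split_beta']
    interpret pp: pair_prob_space nu "chan_H N :: (nat \<Rightarrow> real^'n) measure" ..
    have i: "integrable (nu \<Otimes>\<^sub>M chan_H N) (\<lambda>(x', K). lik N x' K * exp (- F K))"
    proof (rule pp.integrable_const_bound[of _ "2 ^ N * 1"])
      show "AE p in nu \<Otimes>\<^sub>M chan_H N. norm ((\<lambda>(x', K). lik N x' K * exp (- F K)) p) \<le> 2 ^ N * 1"
        unfolding split_beta' norm_mult by (intro AE_I2 mult_mono) (auto simp: lik_le F_def)
    qed (unfold split_beta', measurable)
    have "c0 = (\<integral>K. (\<integral>x'. lik N x' K * exp (- F K) \<partial>nu) \<partial>chan_H N)"
      unfolding c0_def mix_def by simp
    also have "\<dots> = (\<integral>x'. (\<integral>K. lik N x' K * exp (- F K) \<partial>chan_H N) \<partial>nu)"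
      by (rule nu.pair.Fubini_integral[where N = N, OF i])
    finally show ?thesis by (simp add: gpart_def F_def)
  qed
  have iF: "integrable (chan_H N) (\<lambda>K. lik N x K * F K)" "(\<integral>K. lik N x K * F K \<partial>chan_H N) = real CARD('n) / 2"
    using stat_second_moment[OF N] by (simp_all add: F_def)
  have iK: "integrable (chan_H N) (\<lambda>K. lik N x K * ln (lik N x K / mix N nu K))"
    by (rule nu.integrable_kl_integrand[OF x])
  \<comment> \<open>\<open>ln t \<le> t - 1\<close> for the ratio of the tilted mixture, normalised
    by \<open>c0\<close>, to the likelihood at \<open>x\<close>; hence the right side integrates to
    0.\<close>
  have le: "- (lik N x K * ln (lik N x K / mix N nu K)) - lik N x K * F K - ln c0 * lik N x K
      \<le> mix N nu K * exp (- F K) / c0 - lik N x K" for K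
  proof -
    let ?t = "mix N nu K * exp (- F K) / (lik N x K * c0)"
    have "ln ?t = - ln (lik N x K / mix N nu K) - F K - ln c0"
      using c0 by (simp add: ln_div ln_mult)
    moreover have "ln ?t \<le> ?t - 1" using c0 by (intro ln_le_minus_one) auto
    ultimately have "lik N x K * (- ln (lik N x K / mix N nu K) - F K - ln c0) \<le> lik N x K * (?t - 1)"
      by (intro mult_left_mono) auto
    also have "\<dots> = mix N nu K * exp (- F K) / c0 - lik N x K"
      using c0 by (simp add: field_simps)
    finally show ?thesis by (simp add: algebra_simps)
  qed
  have "(\<integral>K. - (lik N x K * ln (lik N x K / mix N nu K)) - lik N x K * F K - ln c0 * lik N x K \<partial>chan_H N)
      \<le> (\<integral>K. mix N nu K * exp (- F K) / c0 - lik N x K \<partial>chan_H N)"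
    by (rule integral_mono)
      (intro Bochner_Integration.integrable_diff Bochner_Integration.integrable_minus integrable_mult_right integrable_divide iK iF ic integral_lik le)+
  also have "\<dots> = 0"
    using ic c0 by (simp add: integral_lik c0_def[symmetric])
  also have "(\<integral>K. - (lik N x K * ln (lik N x K / mix N nu K)) - lik N x K * F K - ln c0 * lik N x K \<partial>chan_H N)
      = - KL N nu x - real CARD('n) / 2 - ln c0"
    using iK iF integral_lik[of N x] by (simp add: KL_def)
  finally show "KL N nu x \<ge> - real CARD('n) / 2 - ln (\<integral>x'. gpart N x' \<partial>nu)" using Fub by simp
  show "(\<integral>x'. gpart N x' \<partial>nu) > 0" using c0 Fub by simp
qed

text \<open>From \<open>|S - \<tau> v|^2 \<ge> 0\<close> the function \<open>exp (-|S|^2/2)\<close>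
  is at most \<open>exp (-\<tau> (v \<bullet> S) + \<tau>^2 |v|^2 / 2)\<close>. The linear exponent
  turns the expectation into an N-th power, and the second term is paid by the reserve in the
  Chernoff bound with D equal to b/2.\<close>

lemma gpart_le:
  assumes ch: "integrable gauss_vec (\<lambda>k. 2 * Phi (k \<bullet> x') * exp (- \<tau> * (score_vec x k \<bullet> (x' - x))))"
     "(\<integral>k. 2 * Phi (k \<bullet> x') * exp (- \<tau> * (score_vec x k \<bullet> (x' - x))) \<partial>gauss_vec) * exp (\<tau>^2 * (b / 2) * (norm (x' - x))^2)
       \<le> exp (- c * (norm (x' - x))^2)"
    and fb: "\<And>i. fisher_eig k x i \<le> b" and c: "c \<ge> 0" and N: "N > 0" and x': "x' = x + (1 / sqrt (real N)) *\<^sub>R whiten v"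
  shows "gpart N x' \<le> exp (- (c / b) * (norm v)^2)"
proof -
  have b: "b > 0" using fb[of k] fisher_eig_pos[of k x k] by linarith
  let ?m = "\<lambda>k. 2 * Phi (k \<bullet> x') * exp (- \<tau> * (score_vec x k \<bullet> (x' - x)))"
  have eq: "lik N x' K * exp (- \<tau> * (v \<bullet> stat N K)) = (\<Prod>l<N. ?m (K l))" for K
  proof -
    have "- \<tau> * (v \<bullet> stat N K) = (\<Sum>l<N. - \<tau> * (score_vec x (K l) \<bullet> (x' - x)))"
      unfolding inner_stat by (simp add: x' sum_divide_distrib sum_distrib_left)
    then show ?thesis unfolding lik_def by (simp add: exp_sum prod.distrib)
  qed
  have iprod: "integrable (chan_H N) (\<lambda>K. \<Prod>l<N. ?m (K l))" "(\<integral>K. (\<Prod>l<N. ?m (K l)) \<partial>chan_H N) = (\<integral>k. ?m k \<partial>gauss_vec) ^ N"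
    unfolding chan_H_eq_iid using gauss.integral_iid_prod[OF ch(1), of N] by auto
  have nv: "(norm v)^2 \<le> b * (real N * (norm (x' - x))^2)"
    using norm_wmap_bounds[OF frame fb, of v] N by (simp add: x' power_divide)
  have "gpart N x' \<le> (\<integral>K. (\<Prod>l<N. ?m (K l)) * exp (\<tau>^2 * (norm v)^2 / 2) \<partial>chan_H N)"
    unfolding gpart_def
  proof (rule integral_mono[OF integrable_gpart])
    show "integrable (chan_H N) (\<lambda>K. (\<Prod>l<N. ?m (K l)) * exp (\<tau>^2 * (norm v)^2 / 2))" using iprod by simp
    fix K
    have "0 \<le> (norm (stat N K - \<tau> *\<^sub>R v))^2" by simp
    also have "\<dots> = (norm (stat N K))^2 - 2 * (\<tau> * (v \<bullet> stat N K)) + \<tau>^2 * (norm v)^2"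
      unfolding power2_norm_eq_inner by (simp add: inner_diff_left inner_diff_right inner_commute power2_eq_square algebra_simps)
    finally have "exp (- ((norm (stat N K))^2) / 2) \<le> exp (- \<tau> * (v \<bullet> stat N K) + \<tau>^2 * (norm v)^2 / 2)"
      by simp
    then have "lik N x' K * exp (- ((norm (stat N K))^2) / 2) \<le> lik N x' K * (exp (- \<tau> * (v \<bullet> stat N K)) * exp (\<tau>^2 * (norm v)^2 / 2))"
      unfolding exp_add by (intro mult_left_mono) auto
    also have "\<dots> = (\<Prod>l<N. ?m (K l)) * exp (\<tau>^2 * (norm v)^2 / 2)" unfolding eq[symmetric] by (simp only: mult.assoc)
    finally show "lik N x' K * exp (- ((norm (stat N K))^2) / 2) \<le> (\<Prod>l<N. ?m (K l)) * exp (\<tau>^2 * (norm v)^2 / 2)" .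
  qed
  also have "\<dots> = (\<integral>k. ?m k \<partial>gauss_vec) ^ N * exp (\<tau>^2 * (norm v)^2 / 2)" using iprod by simp
  also have "\<dots> \<le> (\<integral>k. ?m k \<partial>gauss_vec) ^ N * exp (\<tau>^2 * (b / 2) * (norm (x' - x))^2) ^ N"
  proof (intro mult_left_mono zero_le_power integral_nonneg_AE)
    have "\<tau>^2 * (norm v)^2 / 2 \<le> \<tau>^2 * (b * (real N * (norm (x' - x))^2)) / 2"
      by (intro divide_right_mono mult_left_mono nv) auto
    then show "exp (\<tau>^2 * (norm v)^2 / 2) \<le> exp (\<tau>^2 * (b / 2) * (norm (x' - x))^2) ^ N"
      by (simp add: mult_ac flip: exp_of_nat_mult)
  qed auto
  also have "\<dots> \<le> exp (- c * (norm (x' - x))^2) ^ N"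
    unfolding power_mult_distrib[symmetric]
    by (intro power_mono ch(2) mult_nonneg_nonneg integral_nonneg_AE) auto
  also have "\<dots> = exp (- (c * (real N * (norm (x' - x))^2)))" by (simp add: mult_ac flip: exp_of_nat_mult)
  also have "\<dots> \<le> exp (- (c / b) * (norm v)^2)"
    using mult_left_mono[OF nv, of "c / b"] b c by simp
  finally show ?thesis .
qed

text \<open>\<open>exp (-|S|^2/2)\<close> is written as the mean of
  \<open>iexp (V \<bullet> S)\<close> over a Gaussian V. For fixed V the expectation over the
  samples is the N-th power of a one-sample function \<open>psi\<close> with modulus at most 1, so
  dominated convergence applies in V.\<close>

lemma gpart_tendsto: "(\<lambda>N. gpart N (x + (1 / sqrt (real N)) *\<^sub>R whiten v)) \<longlonglongrightarrow> gshift v"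
proof -
  define xN where "xN N = x + (1 / sqrt (real N)) *\<^sub>R whiten v" for N
  define psi where "psi N V = (\<integral>k. complex_of_real (2 * Phi (k \<bullet> xN N)) * iexp ((1 / sqrt (real N)) * (score_vec x k \<bullet> whiten V)) \<partial>gauss_vec)" for N V
  have im: "integrable gauss_vec (\<lambda>k. complex_of_real (2 * Phi (k \<bullet> y)) * iexp (s * (score_vec x k \<bullet> w)))" for y s w
    by (rule integrable_gauss_poly_bound[where C = 2 and p = 0]) (auto simp: norm_mult)
  have psi_le: "cmod (psi N V) \<le> 1" for N V
  proof -
    have "cmod (psi N V) \<le> (\<integral>k. 2 * Phi (k \<bullet> xN N) \<partial>gauss_vec)"
      unfolding psi_def
    proof (rule Bochner_Integration.integral_norm_bound_integral[OF im])
      show "integrable gauss_vec (\<lambda>k. 2 * Phi (k \<bullet> xN N))" by (simp add: integrable_gauss_Phi)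
    qed (simp add: norm_mult)
    then show ?thesis by (simp add: integral_gauss_Phi)
  qed
  have Am [measurable]: "whiten \<in> borel_measurable borel" by (rule wmap_measurable[OF frame])
  have psi_meas: "(\<lambda>V. psi N V) \<in> borel_measurable borel" for N
    unfolding psi_def by (rule gauss.borel_measurable_lebesgue_integral) measurable
  have lim: "(\<lambda>N. psi N V ^ N) \<longlonglongrightarrow> exp (\<i> * complex_of_real (v \<bullet> V) - complex_of_real ((norm V)^2) / 2)" for V
  proof (rule tendsto_power_exp_complex[OF _ psi_le])
    let ?z = "\<i> * complex_of_real (v \<bullet> V) - complex_of_real ((norm V)^2) / 2"
    obtain C where C: "\<And>e. e \<ge> 0 \<Longrightarrow> cmod ((\<integral>k. complex_of_real (2 * Phi (k \<bullet> (x + e *\<^sub>R whiten v))) * iexp (e * (score_vec x k \<bullet> whiten V)) \<partial>gauss_vec)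
       - 1 - of_real (e^2) * (\<i> * finfo x (whiten v) (whiten V) - finfo x (whiten V) (whiten V) / 2)) \<le> C * e^3"
      using score_char_expansion[of x "whiten v" "whiten V"] by blast
    have C': "cmod (of_nat N * (psi N V - 1) - ?z) \<le> C * (1 / sqrt (real N))" if N: "N > 0" for N
    proof -
      define e where "e = 1 / sqrt (real N)"
      have e: "e \<ge> 0" "real N * e^2 = 1" using N by (auto simp: e_def power_divide)
      have "cmod (psi N V - 1 - of_real (e^2) * ?z) \<le> C * e^3"
        using C[OF e(1)] unfolding psi_def xN_def e_def[symmetric] finfo_wmap[OF frame] by (simp add: power2_norm_eq_inner)
      then have "real N * cmod (psi N V - 1 - of_real (e^2) * ?z) \<le> real N * (C * e^3)"
        by (rule mult_left_mono) simp
      also have "\<dots> = (real N * e^2) * (C * e)" by (simp add: power2_eq_square power3_eq_cube)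
      finally have 1: "real N * cmod (psi N V - 1 - of_real (e^2) * ?z) \<le> C * e" unfolding e(2) by simp
      have "of_nat N * (of_real (e^2) * ?z) = of_real (real N * e^2) * ?z" by (simp add: mult.assoc)
      then have "of_nat N * (psi N V - 1) - ?z = of_nat N * (psi N V - 1 - of_real (e^2) * ?z)"
        unfolding e(2) by (simp only: right_diff_distrib of_real_1 mult_1_left)
      then have "cmod (of_nat N * (psi N V - 1) - ?z) = real N * cmod (psi N V - 1 - of_real (e^2) * ?z)"
        by (simp only: norm_mult norm_of_nat)
      with 1 show ?thesis by (simp add: e_def)
    qed
    have "(\<lambda>N. of_nat N * (psi N V - 1) - ?z) \<longlonglongrightarrow> 0"
    proof (rule Lim_null_comparison)
      show "eventually (\<lambda>N. cmod (of_nat N * (psi N V - 1) - ?z) \<le> C * (1 / sqrt (real N))) sequentially"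
        using eventually_gt_at_top[of 0] by eventually_elim (rule C')
      have "(\<lambda>N. 1 / sqrt (real N)) \<longlonglongrightarrow> 0"
        by (rule tendsto_divide_0[OF tendsto_const])
          (intro filterlim_at_top_imp_at_infinity filterlim_compose[OF sqrt_at_top filterlim_real_sequentially])
      then show "(\<lambda>N. C * (1 / sqrt (real N))) \<longlonglongrightarrow> 0" by (rule tendsto_mult_right_zero)
    qed
    then show "(\<lambda>N. of_nat N * (psi N V - 1)) \<longlonglongrightarrow> ?z" by (simp only: LIM_zero_iff)
  qed simp
  have "(\<lambda>N. \<integral>V. psi N V ^ N \<partial>gauss_vec) \<longlonglongrightarrow> (\<integral>V. exp (\<i> * complex_of_real (v \<bullet> V) - complex_of_real ((norm V)^2) / 2) \<partial>gauss_vec)"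
  proof (rule integral_dominated_convergence[where w = "\<lambda>_. 1"])
    show "AE V in gauss_vec. (\<lambda>N. psi N V ^ N) \<longlonglongrightarrow> exp (\<i> * complex_of_real (v \<bullet> V) - complex_of_real ((norm V)^2) / 2)"
      using lim by simp
    show "AE V in gauss_vec. cmod (psi N V ^ N) \<le> 1" for N
      using psi_le by (simp add: norm_power power_le_one)
    show "(\<lambda>V. psi N V ^ N) \<in> borel_measurable gauss_vec" for N using psi_meas by simp
  qed auto
  moreover have "complex_of_real (gpart N (xN N)) = (\<integral>V. psi N V ^ N \<partial>gauss_vec)" for N
  proof -
    note [measurable] = lik_measurable(1)
    interpret pp: pair_prob_space "chan_H N :: (nat \<Rightarrow> real^'n) measure" "gauss_vec :: (real^'n) measure" ..
    have i: "integrable (chan_H N \<Otimes>\<^sub>M gauss_vec) (\<lambda>(K, V). complex_of_real (lik N (xN N) K) * iexp (V \<bullet> stat N K))"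
    proof (rule pp.integrable_const_bound[of _ "2 ^ N * 1"])
      show "AE p in chan_H N \<Otimes>\<^sub>M gauss_vec. cmod ((\<lambda>(K, V). complex_of_real (lik N (xN N) K) * iexp (V \<bullet> stat N K)) p) \<le> 2 ^ N * 1"
        unfolding split_beta' norm_mult by (intro AE_I2 mult_mono) (auto simp: lik_le)
    qed (unfold split_beta', measurable)
    have "complex_of_real (gpart N (xN N)) = (\<integral>K. complex_of_real (lik N (xN N) K * exp (- ((norm (stat N K))^2) / 2)) \<partial>chan_H N)"
      unfolding gpart_def by (rule integral_of_real[symmetric, OF integrable_gpart])
    also have "\<dots> = (\<integral>K. (\<integral>V. complex_of_real (lik N (xN N) K) * iexp (V \<bullet> stat N K) \<partial>gauss_vec) \<partial>chan_H N)"
      by (simp only: of_real_mult gauss_char[symmetric] integral_mult_right_zero)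
    also have "\<dots> = (\<integral>V. (\<integral>K. complex_of_real (lik N (xN N) K) * iexp (V \<bullet> stat N K) \<partial>chan_H N) \<partial>gauss_vec)"
      by (rule pp.Fubini_integral[symmetric, OF i])
    also have "\<dots> = (\<integral>V. psi N V ^ N \<partial>gauss_vec)"
    proof (rule Bochner_Integration.integral_cong[OF refl])
      fix V
      let ?f = "\<lambda>k. complex_of_real (2 * Phi (k \<bullet> xN N)) * iexp ((1 / sqrt (real N)) * (score_vec x k \<bullet> whiten V))"
      have pw: "complex_of_real (lik N (xN N) K) * iexp (V \<bullet> stat N K) = (\<Prod>l<N. ?f (K l))" for K
      proof -
        have "iexp (V \<bullet> stat N K) = (\<Prod>l<N. iexp ((1 / sqrt (real N)) * (score_vec x (K l) \<bullet> whiten V)))"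
          unfolding inner_stat by (simp add: sum_divide_distrib sum_distrib_left flip: exp_sum)
        then show ?thesis unfolding lik_def of_real_prod by (simp only: prod.distrib)
      qed
      show "(\<integral>K. complex_of_real (lik N (xN N) K) * iexp (V \<bullet> stat N K) \<partial>chan_H N) = psi N V ^ N"
        unfolding psi_def chan_H_eq_iid by (simp only: pw gauss.integral_iid_prod(1)[OF im])
    qed
    finally show ?thesis .
  qed
  ultimately have "(\<lambda>N. complex_of_real (gpart N (xN N))) \<longlonglongrightarrow> complex_of_real (gshift v)"
    unfolding gshift_char by simp
  then show ?thesis unfolding xN_def tendsto_of_real_iff .
qed

end

subsection \<open>Asymptotic lower bound for Jeffreys' prior\<close>

lemma jeffreys_weight_bounds:
  assumes "R \<ge> 0"
  shows "\<exists>a>0. \<exists>b>0. \<forall>r. 0 \<le> r \<longrightarrow> r \<le> R \<longrightarrow> a \<le> jeffreys_weight n r \<and> jeffreys_weight n r \<le> b"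
proof -
  have c: "compact {0..R}" "{0..R} \<noteq> {}" using assms by auto
  obtain r1 where r1: "r1 \<in> {0..R}" "\<And>r. r \<in> {0..R} \<Longrightarrow> jeffreys_weight n r1 \<le> jeffreys_weight n r"
    using continuous_attains_inf[OF c continuous_on_jeffreys_weight[of _ n]] by blast
  obtain r2 where r2: "r2 \<in> {0..R}" "\<And>r. r \<in> {0..R} \<Longrightarrow> jeffreys_weight n r \<le> jeffreys_weight n r2"
    using continuous_attains_sup[OF c continuous_on_jeffreys_weight[of _ n]] by blast
  have "\<forall>r. 0 \<le> r \<longrightarrow> r \<le> R \<longrightarrow> jeffreys_weight n r1 \<le> jeffreys_weight n r \<and> jeffreys_weight n r \<le> jeffreys_weight n r2" using r1 r2 by auto
  then show ?thesis using jeffreys_weight_pos by blast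
qed

lemma zeta_bounds:
  assumes "R \<ge> 0"
  shows "\<exists>a>0. \<exists>b>0. \<forall>r. 0 \<le> r \<longrightarrow> r \<le> R \<longrightarrow> a \<le> zeta 0 r \<and> zeta 0 r \<le> b \<and> a \<le> zeta 2 r \<and> zeta 2 r \<le> b"
proof -
  have c: "compact {0..R}" "{0..R} \<noteq> {}" using assms by auto
  obtain r1 where r1: "r1 \<in> {0..R}" "\<And>r. r \<in> {0..R} \<Longrightarrow> zeta 0 r1 \<le> zeta 0 r"
    using continuous_attains_inf[OF c continuous_on_zeta_0] by blast
  obtain r2 where r2: "r2 \<in> {0..R}" "\<And>r. r \<in> {0..R} \<Longrightarrow> zeta 0 r \<le> zeta 0 r2"
    using continuous_attains_sup[OF c continuous_on_zeta_0] by blast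
  obtain r3 where r3: "r3 \<in> {0..R}" "\<And>r. r \<in> {0..R} \<Longrightarrow> zeta 2 r3 \<le> zeta 2 r"
    using continuous_attains_inf[OF c continuous_on_zeta_2] by blast
  obtain r4 where r4: "r4 \<in> {0..R}" "\<And>r. r \<in> {0..R} \<Longrightarrow> zeta 2 r \<le> zeta 2 r4"
    using continuous_attains_sup[OF c continuous_on_zeta_2] by blast
  define a where "a = min (zeta 0 r1) (zeta 2 r3)"
  define b where "b = max (zeta 0 r2) (zeta 2 r4)"
  have "\<forall>r. 0 \<le> r \<longrightarrow> r \<le> R \<longrightarrow> a \<le> zeta 0 r \<and> zeta 0 r \<le> b \<and> a \<le> zeta 2 r \<and> zeta 2 r \<le> b"
    using r1 r2 r3 r4 unfolding a_def b_def by (auto simp: min_le_iff_disj le_max_iff_disj)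
  moreover have "a > 0" "b > 0" by (simp_all add: a_def b_def less_max_iff_disj)
  ultimately show ?thesis by blast
qed

lemma fisher_eig_bounds:
  assumes "R \<ge> 0"
  shows "\<exists>a>0. \<exists>b>0. \<forall>(k::'n::finite) x i. norm x \<le> R \<longrightarrow> a \<le> fisher_eig k x i \<and> fisher_eig k x i \<le> b"
proof -
  obtain a b where ab: "a > 0" "b > 0" "\<And>r. 0 \<le> r \<Longrightarrow> r \<le> R \<Longrightarrow> a \<le> zeta 0 r \<and> zeta 0 r \<le> b \<and> a \<le> zeta 2 r \<and> zeta 2 r \<le> b"
    using zeta_bounds[OF assms] by blast
  then have "\<forall>(k::'n) x i. norm x \<le> R \<longrightarrow> a \<le> fisher_eig k x i \<and> fisher_eig k x i \<le> b"
    unfolding fisher_eig_def by (simp add: norm_ge_zero)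
  with ab(1,2) show ?thesis by blast
qed

lemma jeffreys_density_nonneg:
  assumes "snr > 0"
  shows "jeffreys_density snr (x :: real^'n::finite) \<ge> 0"
  using jeffreys_mass_pos[of "sqrt snr" "CARD('n)"] assms
  by (auto simp: jeffreys_density_eq intro!: divide_nonneg_pos split: split_indicator)

lemma jeffreys_density_bounded:
  assumes "snr > 0"
  shows "\<exists>W>0. \<forall>x :: real^'n::finite. jeffreys_density snr x \<le> W"
proof -
  let ?c = "jeffreys_mass CARD('n) (sqrt snr)"
  have c: "?c > 0" using assms by (intro jeffreys_mass_pos) auto
  obtain b where b: "b > 0" "\<And>r. 0 \<le> r \<Longrightarrow> r \<le> sqrt snr \<Longrightarrow> jeffreys_weight CARD('n) r \<le> b"
    using jeffreys_weight_bounds[of "sqrt snr" "CARD('n)"] assms by force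
  show ?thesis
    using b c by (intro exI[of _ "b / ?c"]) (auto simp: jeffreys_density_eq divide_right_mono split: split_indicator)
qed

lemma jeffreys_density_isCont:
  fixes x :: "real^'n::finite"
  assumes "norm x < sqrt snr"
  shows "isCont (jeffreys_density snr) x"
proof -
  let ?f = "\<lambda>y::real^'n. jeffreys_weight CARD('n) (norm y) / jeffreys_mass CARD('n) (sqrt snr)"
  have "continuous_on UNIV ?f"
    unfolding divide_inverse
    by (intro continuous_on_mult_right continuous_on_compose2[OF continuous_on_jeffreys_weight[of UNIV]] continuous_intros) auto
  then have f: "isCont ?f x" by (simp add: continuous_on_eq_continuous_at)
  have "eventually (\<lambda>y. y \<in> ball 0 (sqrt snr)) (nhds x)"
    using assms by (intro eventually_nhds_in_open) auto
  then have "eventually (\<lambda>y. ?f y = jeffreys_density snr y) (nhds x)"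
    by eventually_elim (simp add: jeffreys_density_eq)
  then have "isCont ?f x = isCont (jeffreys_density snr) x" by (rule isCont_cong)
  with f show ?thesis by simp
qed

lemma peak_input_jeffreys:
  assumes "snr > 0"
  shows "peak_input (jeffreys snr :: (real^'n::finite) measure) (sqrt snr)"
  by (rule peak_inputI[OF jeffreys_in_input_dists[OF assms]])

text \<open>The integrand of the mixture of \<open>gpart\<close> in the local coordinate v around
  \<open>x\<close>, without the Jacobian.\<close>

definition local_mix :: "real \<Rightarrow> 'n \<Rightarrow> real^'n::finite \<Rightarrow> (real^'n \<Rightarrow> real^'n) \<Rightarrow> nat \<Rightarrow> real^'n \<Rightarrow> real" where
  "local_mix snr k x T N v = jeffreys_density snr (x + (1 / sqrt (real N)) *\<^sub>R wmap k x T v) *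
     gpart k x T N (x + (1 / sqrt (real N)) *\<^sub>R wmap k x T v)"

text \<open>The Chernoff estimate requires both inputs in the ball; outside it the prior density
  vanishes, so one Gaussian bound holds for all v. Its constants depend neither on \<open>x\<close>
  nor on N.\<close>

lemma local_mix_bound:
  assumes "snr > 0"
  shows "\<exists>c>0. \<exists>W>0. \<forall>(k::'n::finite) x T N v. norm x \<le> sqrt snr \<longrightarrow> polar_frame k x T \<longrightarrow> N > 0 \<longrightarrow>
     0 \<le> local_mix snr k x T N v \<and> local_mix snr k x T N v \<le> W * exp (- c * (norm v)^2)"
proof -
  let ?R = "sqrt snr"
  have R: "?R \<ge> 0" using assms by simp
  obtain a b where ab: "a > 0" "b > 0" "\<And>(k::'n) x i. norm x \<le> ?R \<Longrightarrow> a \<le> fisher_eig k x i \<and> fisher_eig k x i \<le> b"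
    using fisher_eig_bounds[OF R, where 'n = 'n] by blast
  have "b / 2 \<ge> 0" using ab by simp
  from score_chernoff[OF R this, where 'n = 'n] obtain \<tau> c where c: "\<tau> > 0" "c > 0"
    "\<And>x x' :: real^'n. norm x \<le> ?R \<Longrightarrow> norm x' \<le> ?R \<Longrightarrow>
     integrable gauss_vec (\<lambda>k. 2 * Phi (k \<bullet> x') * exp (- \<tau> * (score_vec x k \<bullet> (x' - x)))) \<and>
     (\<integral>k. 2 * Phi (k \<bullet> x') * exp (- \<tau> * (score_vec x k \<bullet> (x' - x))) \<partial>gauss_vec) * exp (\<tau>^2 * (b / 2) * (norm (x' - x))^2)
       \<le> exp (- c * (norm (x' - x))^2)" by blast
  obtain W where W: "W > 0" "\<And>x :: real^'n. jeffreys_density snr x \<le> W"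
    using jeffreys_density_bounded[OF assms, where 'n = 'n] by blast
  have "0 \<le> local_mix snr k x T N v \<and> local_mix snr k x T N v \<le> W * exp (- (c / b) * (norm v)^2)"
    if x: "norm x \<le> ?R" and fr: "polar_frame k x T" and N: "N > 0" for k :: 'n and x T N v
  proof
    let ?x' = "x + (1 / sqrt (real N)) *\<^sub>R wmap k x T v"
    show "0 \<le> local_mix snr k x T N v"
      unfolding local_mix_def by (intro mult_nonneg_nonneg jeffreys_density_nonneg[OF assms] gpart_nonneg[OF fr])
    show "local_mix snr k x T N v \<le> W * exp (- (c / b) * (norm v)^2)"
    proof (cases "norm ?x' \<le> ?R")
      case True
      have "gpart k x T N ?x' \<le> exp (- (c / b) * (norm v)^2)"
        by (rule gpart_le[OF fr]) (use c(3)[OF x True] ab(3)[OF x] c(2) N in auto)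
      then show ?thesis
        unfolding local_mix_def
        by (intro mult_mono W gpart_nonneg[OF fr]) (use W(1) in auto)
    next
      case False
      then have "jeffreys_density snr ?x' = 0" by (simp add: jeffreys_density_eq)
      then show ?thesis unfolding local_mix_def using W(1) by simp
    qed
  qed
  moreover have "c / b > 0" using c ab by simp
  ultimately show ?thesis using W(1) by blast
qed

lemma local_mix_measurable:
  assumes "polar_frame k x T"
  shows "local_mix snr k x T N \<in> borel_measurable (borel :: (real^'n::finite) measure)"
proof -
  note [measurable] = gpart_measurable[OF assms] wmap_measurable[OF assms]
  show ?thesis unfolding local_mix_def[abs_def] by measurable
qed

lemma integral_gpart_jeffreys:
  fixes x :: "real^'n::finite"
  assumes snr: "snr > 0" and fr: "polar_frame k x T" and x: "norm x \<le> sqrt snr" and N: "N > 0"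
  shows "(\<integral>x'. gpart k x T N x' \<partial>jeffreys snr) = (\<integral>v. local_mix snr k x T N v \<partial>lborel) / (sqrt (real N) ^ CARD('n) * jeffreys_weight CARD('n) (norm x))"
    and "integrable lborel (local_mix snr k x T N)"
proof -
  note [measurable] = gpart_measurable[OF fr] local_mix_measurable[OF fr]
  interpret j: peak_input "jeffreys snr :: (real^'n) measure" "sqrt snr" by (rule peak_input_jeffreys[OF snr])
  let ?q = "sqrt (real N) ^ CARD('n) * jeffreys_weight CARD('n) (norm x)"
  have q: "?q > 0" using N by simp
  obtain c W where cW: "c > 0" "\<And>v. 0 \<le> local_mix snr k x T N v \<and> local_mix snr k x T N v \<le> W * exp (- c * (norm v)^2)"
    using local_mix_bound[OF snr, where 'n = 'n] x fr N by blast
  have nn: "local_mix snr k x T N v \<ge> 0" for v using cW(2) by blast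
  show il: "integrable lborel (local_mix snr k x T N)"
  proof (rule Bochner_Integration.integrable_bound)
    show "integrable lborel (\<lambda>v::real^'n. W * exp (- c * (norm v)^2))"
      by (intro integrable_mult_right integrable_exp_neg_norm cW)
    show "AE v in lborel. norm (local_mix snr k x T N v) \<le> norm (W * exp (- c * (norm v)^2))"
    proof (rule AE_I2)
      fix v show "norm (local_mix snr k x T N v) \<le> norm (W * exp (- c * (norm v)^2))"
        using cW(2)[of v] by (simp only: real_norm_def) linarith
    qed
  qed measurable
  have g1: "gpart k x T N x' \<le> 1" for x'
  proof -
    have "gpart k x T N x' \<le> (\<integral>K. lik N x' K \<partial>chan_H N)"
      unfolding gpart_def[OF fr]
      by (rule integral_mono[OF integrable_gpart[OF fr] integral_lik(2)]) (auto intro!: mult_right_le_one_le)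
    then show ?thesis by (simp add: integral_lik)
  qed
  have ig: "integrable (jeffreys snr) (gpart k x T N)"
  proof (rule j.integrable_const_bound[of _ 1])
    show "AE x' in jeffreys snr. norm (gpart k x T N x') \<le> 1"
      using g1 gpart_nonneg[OF fr] by (intro AE_I2) simp
    show "gpart k x T N \<in> borel_measurable (jeffreys snr)" by (simp add: measurable_cong_sets[OF j.sets_mu refl])
  qed
  have "ennreal (\<integral>x'. gpart k x T N x' \<partial>jeffreys snr) = (\<integral>\<^sup>+x'. ennreal (gpart k x T N x') \<partial>jeffreys snr)"
    by (rule nn_integral_eq_integral[symmetric, OF ig]) (simp add: gpart_nonneg[OF fr])
  also have "\<dots> = (\<integral>\<^sup>+x'. ennreal (jeffreys_density snr x') * ennreal (gpart k x T N x') \<partial>lborel)"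
    unfolding jeffreys_def by (rule nn_integral_density) auto
  also have "\<dots> = (\<integral>\<^sup>+x'. ennreal (jeffreys_density snr x' * gpart k x T N x') \<partial>lborel)"
    by (simp add: ennreal_mult jeffreys_density_nonneg[OF snr] gpart_nonneg[OF fr])
  also have "\<dots> = ennreal (1 / ?q) * (\<integral>\<^sup>+v. ennreal (local_mix snr k x T N v) \<partial>lborel)"
    unfolding local_mix_def by (rule nn_integral_lborel_wmap[OF fr N]) measurable
  also have "(\<integral>\<^sup>+v. ennreal (local_mix snr k x T N v) \<partial>lborel) = ennreal (\<integral>v. local_mix snr k x T N v \<partial>lborel)"
    by (rule nn_integral_eq_integral[OF il]) (simp add: nn)
  also have "ennreal (1 / ?q) * \<dots> = ennreal ((\<integral>v. local_mix snr k x T N v \<partial>lborel) / ?q)"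
    using q by (subst ennreal_mult[symmetric]) (auto intro!: integral_nonneg_AE simp: nn)
  finally show "(\<integral>x'. gpart k x T N x' \<partial>jeffreys snr) = (\<integral>v. local_mix snr k x T N v \<partial>lborel) / ?q"
    by (subst (asm) ennreal_inj) (use q nn gpart_nonneg[OF fr] in \<open>auto intro!: integral_nonneg_AE divide_nonneg_pos\<close>)
qed

lemma KL_jeffreys_ge:
  fixes x :: "real^'n::finite"
  assumes snr: "snr > 0" and fr: "polar_frame k x T" and x: "norm x \<le> sqrt snr" and N: "N > 0"
  shows "KL N (jeffreys snr) x - real CARD('n) / 2 * ln (real N)
      \<ge> ln (jeffreys_weight CARD('n) (norm x)) - real CARD('n) / 2 - ln (\<integral>v. local_mix snr k x T N v \<partial>lborel)"
    and "(\<integral>v. local_mix snr k x T N v \<partial>lborel) > 0"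
proof -
  let ?q = "sqrt (real N) ^ CARD('n) * jeffreys_weight CARD('n) (norm x)"
  let ?I = "\<integral>v. local_mix snr k x T N v \<partial>lborel"
  have q: "?q > 0" using N by simp
  note K = KL_ge_gpart[OF fr peak_input_jeffreys[OF snr] x N]
  note e = integral_gpart_jeffreys(1)[OF snr fr x N]
  have "?I / ?q > 0" using K(2) e by simp
  then show I: "?I > 0" using q by (simp add: zero_less_divide_iff)
  have "ln (?I / ?q) = ln ?I - ln ?q" using I q N by (simp add: ln_div)
  also have "ln ?q = real CARD('n) * ln (sqrt (real N)) + ln (jeffreys_weight CARD('n) (norm x))"
    using N by (subst ln_mult) (auto simp: ln_realpow)
  also have "ln (sqrt (real N)) = ln (real N) / 2" using N by (simp add: ln_sqrt)
  finally have "ln (?I / ?q) = ln ?I - (real CARD('n) * (ln (real N) / 2) + ln (jeffreys_weight CARD('n) (norm x)))" .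
  with K(1) show "KL N (jeffreys snr) x - real CARD('n) / 2 * ln (real N)
      \<ge> ln (jeffreys_weight CARD('n) (norm x)) - real CARD('n) / 2 - ln ?I" unfolding e by simp
qed

text \<open>The constant of the expansion in nats, with \<open>alpha\<close> and the volume of the
  unit ball merged into one mass.\<close>

definition cap_const :: "nat \<Rightarrow> real \<Rightarrow> real" where
  "cap_const n R = ln (jeffreys_mass n R) - real n / 2 * ln (2 * pi * exp 1)"

text \<open>A bound uniform in \<open>x\<close> and N, which later permits integrating the pointwise
  lower limit over the prior.\<close>

lemma KL_jeffreys_bounded_below:
  assumes snr: "snr > 0"
  shows "\<exists>C. \<forall>(x :: real^'n::finite) N. norm x \<le> sqrt snr \<longrightarrow> N > 0 \<longrightarrow> C \<le> KL N (jeffreys snr) x - real CARD('n) / 2 * ln (real N)"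
proof -
  obtain k :: 'n where True by simp
  have R: "sqrt snr \<ge> 0" using snr by simp
  obtain a where a: "a > 0" "\<And>r. 0 \<le> r \<Longrightarrow> r \<le> sqrt snr \<Longrightarrow> a \<le> jeffreys_weight CARD('n) r"
    using jeffreys_weight_bounds[OF R, of "CARD('n)"] by blast
  obtain c W where cW: "c > 0" "W > 0" "\<And>(k::'n) x T N v. norm x \<le> sqrt snr \<Longrightarrow> polar_frame k x T \<Longrightarrow> N > 0 \<Longrightarrow>
      0 \<le> local_mix snr k x T N v \<and> local_mix snr k x T N v \<le> W * exp (- c * (norm v)^2)"
    using local_mix_bound[OF snr, where 'n = 'n] by blast
  define W' where "W' = (\<integral>v. W * exp (- c * (norm (v::real^'n))^2) \<partial>lborel)"
  have "ln a - real CARD('n) / 2 - ln W' \<le> KL N (jeffreys snr) x - real CARD('n) / 2 * ln (real N)"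
    if x: "norm x \<le> sqrt snr" and N: "N > 0" for x :: "real^'n" and N
  proof -
    obtain T where fr: "polar_frame k x T" using polar_frame_exists by blast
    have "(\<integral>v. local_mix snr k x T N v \<partial>lborel) \<le> W'"
      unfolding W'_def
    proof (rule integral_mono[OF integral_gpart_jeffreys(2)[OF snr fr x N]])
      show "integrable lborel (\<lambda>v::real^'n. W * exp (- c * (norm v)^2))"
        by (intro integrable_mult_right integrable_exp_neg_norm cW(1))
    qed (use cW(3)[OF x fr N] in blast)
    then have "ln (\<integral>v. local_mix snr k x T N v \<partial>lborel) \<le> ln W'"
      using KL_jeffreys_ge(2)[OF snr fr x N] by simp
    moreover have "ln a \<le> ln (jeffreys_weight CARD('n) (norm x))" using a(1) a(2)[of "norm x"] x by simp
    ultimately show ?thesis using KL_jeffreys_ge(1)[OF snr fr x N] by linarith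
  qed
  then show ?thesis by blast
qed

text \<open>At an interior point the prior density is continuous, so it converges to its value at
  \<open>x\<close> and only the integral of \<open>gshift\<close> remains.\<close>

lemma local_mix_tendsto:
  fixes x :: "real^'n::finite"
  assumes snr: "snr > 0" and fr: "polar_frame k x T" and x: "norm x < sqrt snr"
  shows "(\<lambda>N. \<integral>v. local_mix snr k x T N v \<partial>lborel) \<longlonglongrightarrow> jeffreys_density snr x * (2 * pi) powr (real CARD('n) / 2)"
\<comment> \<open>The dominating function is available for N > 0 only, hence the shift of the
  index.\<close>
proof (rule LIMSEQ_imp_Suc)
  note [measurable] = local_mix_measurable[OF fr]
  have xle: "norm x \<le> sqrt snr" using x by simp
  obtain c W where cW: "c > 0" "\<And>N v. N > 0 \<Longrightarrow> 0 \<le> local_mix snr k x T N v \<and> local_mix snr k x T N v \<le> W * exp (- c * (norm v)^2)"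
    using local_mix_bound[OF snr, where 'n = 'n] xle fr by blast
  have s0: "(\<lambda>N. 1 / sqrt (real N)) \<longlonglongrightarrow> 0"
    by (rule tendsto_divide_0[OF tendsto_const])
      (intro filterlim_at_top_imp_at_infinity filterlim_compose[OF sqrt_at_top filterlim_real_sequentially])
  have pw: "(\<lambda>N. local_mix snr k x T N v) \<longlonglongrightarrow> jeffreys_density snr x * gshift v" for v
    unfolding local_mix_def
  proof (intro tendsto_mult gpart_tendsto[OF fr])
    have "(\<lambda>N. x + (1 / sqrt (real N)) *\<^sub>R wmap k x T v) \<longlonglongrightarrow> x + 0 *\<^sub>R wmap k x T v"
      by (intro tendsto_intros s0)
    then show "(\<lambda>N. jeffreys_density snr (x + (1 / sqrt (real N)) *\<^sub>R wmap k x T v)) \<longlonglongrightarrow> jeffreys_density snr x"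
      using isCont_tendsto_compose[OF jeffreys_density_isCont[OF x]] by simp
  qed
  have ig: "integrable lborel (gshift :: real^'n \<Rightarrow> real)"
    by (rule integrableI_nonneg) (use gshift_pos nn_integral_gshift[where 'n = 'n] in \<open>auto intro: less_imp_le\<close>)
  have "ennreal (\<integral>v. gshift (v::real^'n) \<partial>lborel) = ennreal ((2 * pi) powr (real CARD('n) / 2))"
    unfolding nn_integral_gshift[symmetric]
    by (rule nn_integral_eq_integral[symmetric, OF ig]) (auto intro: less_imp_le gshift_pos)
  then have g: "(\<integral>v. gshift (v::real^'n) \<partial>lborel) = (2 * pi) powr (real CARD('n) / 2)"
    by (subst (asm) ennreal_inj) (auto intro!: integral_nonneg_AE simp: less_imp_le[OF gshift_pos])
  have "(\<lambda>N. \<integral>v. local_mix snr k x T (Suc N) v \<partial>lborel) \<longlonglongrightarrow> (\<integral>v. jeffreys_density snr x * gshift (v::real^'n) \<partial>lborel)"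
  proof (rule integral_dominated_convergence[where w = "\<lambda>v::real^'n. W * exp (- c * (norm v)^2)"])
    show "integrable lborel (\<lambda>v::real^'n. W * exp (- c * (norm v)^2))"
      by (intro integrable_mult_right integrable_exp_neg_norm cW)
    show "AE v in lborel. (\<lambda>N. local_mix snr k x T (Suc N) v) \<longlonglongrightarrow> jeffreys_density snr x * gshift v"
      using pw by (intro AE_I2 LIMSEQ_Suc)
    show "AE v in lborel. norm (local_mix snr k x T (Suc N) v) \<le> W * exp (- c * (norm v)^2)" for N
      using cW(2)[of "Suc N"] by (intro AE_I2) simp
  qed auto
  then show "(\<lambda>N. \<integral>v. local_mix snr k x T (Suc N) v \<partial>lborel) \<longlonglongrightarrow> jeffreys_density snr x * (2 * pi) powr (real CARD('n) / 2)"
    by (simp add: g)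
qed

text \<open>The weight at \<open>x\<close> in the Jacobian cancels against the one in the prior
  density. What remains is the mass, the factor \<open>2 * pi\<close> and the summand
  \<open>-n/2\<close>, which accounts for \<open>exp 1\<close> inside the logarithm.\<close>

lemma KL_jeffreys_eventually_ge:
  fixes x :: "real^'n::finite"
  assumes snr: "snr > 0" and x: "norm x < sqrt snr" and e: "e > 0"
  shows "eventually (\<lambda>N. KL N (jeffreys snr) x - real CARD('n) / 2 * ln (real N) \<ge> cap_const CARD('n) (sqrt snr) - e) sequentially"
proof -
  obtain k :: 'n where True by simp
  obtain T where fr: "polar_frame k x T" using polar_frame_exists by blast
  have xle: "norm x \<le> sqrt snr" using x by simp
  let ?I = "\<lambda>N. \<integral>v. local_mix snr k x T N v \<partial>lborel"
  let ?d = "jeffreys_density snr x"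
  let ?p = "(2 * pi) powr (real CARD('n) / 2)"
  have c: "jeffreys_mass CARD('n) (sqrt snr) > 0" using snr by (intro jeffreys_mass_pos) auto
  have d: "?d = jeffreys_weight CARD('n) (norm x) / jeffreys_mass CARD('n) (sqrt snr)"
    using x by (simp add: jeffreys_density_eq)
  have dpos: "?d > 0" unfolding d using c by simp
  have "(\<lambda>N. ln (?I N)) \<longlonglongrightarrow> ln (?d * ?p)"
    by (intro tendsto_ln local_mix_tendsto[OF snr fr x]) (use dpos in auto)
  then have "(\<lambda>N. ln (jeffreys_weight CARD('n) (norm x)) - real CARD('n) / 2 - ln (?I N)) \<longlonglongrightarrow> ln (jeffreys_weight CARD('n) (norm x)) - real CARD('n) / 2 - ln (?d * ?p)"
    by (intro tendsto_diff tendsto_const)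
  moreover have "ln (jeffreys_weight CARD('n) (norm x)) - real CARD('n) / 2 - ln (?d * ?p) = cap_const CARD('n) (sqrt snr)"
  proof -
    have "ln (?d * ?p) = ln ?d + real CARD('n) / 2 * ln (2 * pi)"
      using dpos by (subst ln_mult) (auto simp: ln_powr)
    moreover have "ln ?d = ln (jeffreys_weight CARD('n) (norm x)) - ln (jeffreys_mass CARD('n) (sqrt snr))"
      unfolding d using c by (simp add: ln_div)
    moreover have "ln (2 * pi * exp 1) = ln (2 * pi) + (1::real)"
      by (subst ln_mult) auto
    ultimately show ?thesis by (simp add: cap_const_def algebra_simps)
  qed
  ultimately have "(\<lambda>N. ln (jeffreys_weight CARD('n) (norm x)) - real CARD('n) / 2 - ln (?I N)) \<longlonglongrightarrow> cap_const CARD('n) (sqrt snr)" by simp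
  then have "eventually (\<lambda>N. ln (jeffreys_weight CARD('n) (norm x)) - real CARD('n) / 2 - ln (?I N) > cap_const CARD('n) (sqrt snr) - e) sequentially"
    by (rule order_tendstoD(1)) (use e in simp)
  then show ?thesis
    using eventually_gt_at_top[of 0]
  proof eventually_elim
    case (elim N)
    then show ?case using KL_jeffreys_ge(1)[OF snr fr xle elim(2)] by linarith
  qed
qed

text \<open>The norm has a density under the prior, so the boundary sphere carries no mass.\<close>

lemma AE_jeffreys_norm_less:
  assumes snr: "snr > 0"
  shows "AE x in (jeffreys snr :: (real^'n::finite) measure). norm x < sqrt snr"
proof -
  interpret j: peak_input "jeffreys snr :: (real^'n) measure" "sqrt snr" by (rule peak_input_jeffreys[OF snr])
  have "AE r in density lborel (\<lambda>r. ennreal (mag_density snr CARD('n) r)). r \<noteq> sqrt snr"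
  proof (subst AE_density)
    show "(\<lambda>r. ennreal (mag_density snr CARD('n) r)) \<in> borel_measurable lborel"
      unfolding mag_density_def mag_weight_def by measurable
    show "AE r in lborel. 0 < ennreal (mag_density snr CARD('n) r) \<longrightarrow> r \<noteq> sqrt snr"
      using AE_lborel_singleton[of "sqrt snr"] by eventually_elim simp
  qed
  then have "AE r in distr (jeffreys snr :: (real^'n) measure) borel norm. r \<noteq> sqrt snr"
    by (simp only: jeffreys_distr_norm[OF snr])
  then have "AE x in (jeffreys snr :: (real^'n) measure). norm x \<noteq> sqrt snr"
    by (subst (asm) AE_distr_iff) (auto simp: measurable_cong_sets[OF j.sets_mu refl])
  with j.AE_norm show ?thesis by eventually_elim simp
qed

lemma mutual_info_jeffreys_ge:
  assumes snr: "snr > 0" and e: "e > 0"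
  shows "eventually (\<lambda>N. mutual_info N (jeffreys snr :: (real^'n::finite) measure) * ln 2 - real CARD('n) / 2 * ln (real N)
      \<ge> cap_const CARD('n) (sqrt snr) - e) sequentially"
proof -
  interpret j: peak_input "jeffreys snr :: (real^'n) measure" "sqrt snr" by (rule peak_input_jeffreys[OF snr])
  let ?L = "cap_const CARD('n) (sqrt snr)"
  let ?k = "\<lambda>N (x::real^'n). KL N (jeffreys snr) x - real CARD('n) / 2 * ln (real N)"
  obtain C where C: "\<And>(x :: real^'n) N. norm x \<le> sqrt snr \<Longrightarrow> N > 0 \<Longrightarrow> C \<le> ?k N x"
    using KL_jeffreys_bounded_below[OF snr, where 'n = 'n] by blast
  \<comment> \<open>Only a lower limit is known for \<open>?k\<close>. Clamping it between
    \<open>min C ?L\<close> and \<open>?L\<close> gives a bounded function that stays below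
    \<open>?k\<close> on the ball and has \<open>?L\<close> as a genuine limit.\<close>
  define h where "h N x = max (min C ?L) (min (?k N x) ?L)" for N and x :: "real^'n"
  have hm [measurable]: "h N \<in> borel_measurable (jeffreys snr)" for N unfolding h_def by measurable
  have hb: "\<bar>h N x\<bar> \<le> \<bar>C\<bar> + \<bar>?L\<bar>" for N x unfolding h_def by auto
  have ih: "integrable (jeffreys snr) (h N)" for N
    by (rule j.integrable_const_bound[of _ "\<bar>C\<bar> + \<bar>?L\<bar>"]) (auto simp: hb)
  have lim: "(\<lambda>N. h N x) \<longlonglongrightarrow> ?L" if x: "norm x < sqrt snr" for x
  proof (rule order_tendstoI)
    fix a assume a: "a < ?L"
    have "eventually (\<lambda>N. ?k N x \<ge> ?L - (?L - a) / 2) sequentially"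
      by (rule KL_jeffreys_eventually_ge[OF snr x]) (use a in simp)
    then show "eventually (\<lambda>N. a < h N x) sequentially"
    proof eventually_elim
      case (elim N)
      then have "a < min (?k N x) ?L" using a by (simp add: field_simps)
      then show ?case by (simp add: h_def less_max_iff_disj)
    qed
  next
    fix a assume a: "a > ?L"
    have "h N x \<le> ?L" for N by (simp add: h_def)
    with a show "eventually (\<lambda>N. h N x < a) sequentially" by (intro always_eventually) (metis le_less_trans)
  qed
  have "(\<lambda>N. \<integral>x. h N x \<partial>jeffreys snr) \<longlonglongrightarrow> (\<integral>(x::real^'n). ?L \<partial>jeffreys snr)"
  proof (rule integral_dominated_convergence[where w = "\<lambda>_. \<bar>C\<bar> + \<bar>?L\<bar>"])
    show "AE x in jeffreys snr. (\<lambda>N. h N x) \<longlonglongrightarrow> ?L"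
      using AE_jeffreys_norm_less[OF snr] by eventually_elim (rule lim)
  qed (auto simp: hb)
  then have "(\<lambda>N. \<integral>x. h N x \<partial>jeffreys snr) \<longlonglongrightarrow> ?L" by simp
  then have "eventually (\<lambda>N. (\<integral>x. h N x \<partial>jeffreys snr) > ?L - e) sequentially"
    by (rule order_tendstoD(1)) (use e in simp)
  then show ?thesis
    using eventually_gt_at_top[of 0]
  proof eventually_elim
    case (elim N)
    have iK: "integrable (jeffreys snr :: (real^'n) measure) (KL N (jeffreys snr))"
      by (rule j.integrable_KL[OF peak_input_jeffreys[OF snr] order_refl])
    have "(\<integral>x. h N x \<partial>jeffreys snr) \<le> (\<integral>x. ?k N x \<partial>jeffreys snr)"
    proof (rule integral_mono_AE[OF ih])
      show "integrable (jeffreys snr) (?k N)" using iK by simp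
      show "AE x in jeffreys snr. h N x \<le> ?k N x"
        using j.AE_norm by eventually_elim (use C elim in \<open>auto simp: h_def min_le_iff_disj\<close>)
    qed
    also have "\<dots> = (\<integral>(x::real^'n). KL N (jeffreys snr) x \<partial>jeffreys snr) - real CARD('n) / 2 * ln (real N)"
      using iK by simp
    also have "(\<integral>(x::real^'n). KL N (jeffreys snr) x \<partial>jeffreys snr) = mutual_info N (jeffreys snr :: (real^'n) measure) * ln 2"
      by (simp add: j.mutual_info_eq_KL)
    finally show ?case using elim by simp
  qed
qed

subsection \<open>Laplace's method from below\<close>

definition gmass :: "'n::finite itself \<Rightarrow> real \<Rightarrow> real" where
  "gmass _ m = (\<integral>v. indicator (cball 0 m) (v::real^'n) * exp (- ((norm v)^2) / 2) \<partial>lborel)"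

text \<open>The Laplace integral of the limiting log-likelihood ratio
  \<open>v \<bullet> s - |v|^2/2\<close>, truncated to the ball of radius M.\<close>

definition tilted :: "real \<Rightarrow> real^'n::finite \<Rightarrow> real" where
  "tilted M s = (\<integral>v. indicator (cball 0 M) v * exp (v \<bullet> s - (norm v)^2 / 2) \<partial>lborel)"

lemma integrable_exp_half_norm: "integrable lborel (\<lambda>v::real^'n::finite. exp (- ((norm v)^2) / 2))"
  using integrable_exp_neg_norm[of "1/2", where 'n = 'n] by simp

lemma integrable_gmass: "integrable lborel (\<lambda>v::real^'n::finite. indicator (cball 0 m) v * exp (- ((norm v)^2) / 2))"
  using integrable_mult_indicator[of "cball 0 m" lborel "\<lambda>v::real^'n. exp (- ((norm v)^2) / 2)"] integrable_exp_half_norm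
  by simp

lemma integrable_tilted: "integrable lborel (\<lambda>v::real^'n::finite. indicator (cball 0 M) v * exp (v \<bullet> s - (norm v)^2 / 2))"
  using borel_integrable_compact[of "cball 0 M :: (real^'n) set" "\<lambda>v. exp (v \<bullet> s - (norm v)^2 / 2)"]
  by (simp add: continuous_intros)

lemma integral_lborel_uminus:
  fixes f :: "real^'n::finite \<Rightarrow> real"
  assumes [measurable]: "f \<in> borel_measurable borel"
  shows "(\<integral>v. f (- v) \<partial>lborel) = (\<integral>v. f v \<partial>lborel)"
proof -
  have "(\<integral>v. f v \<partial>lborel) = (\<integral>v. f v \<partial>distr lborel borel uminus)"
    by (simp add: lborel_distr_orthogonal[OF orthogonal_transformation_uminus])
  also have "\<dots> = (\<integral>v. f (- v) \<partial>lborel)" by (rule integral_distr) auto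
  finally show ?thesis by simp
qed

lemma gmass_mono: "m \<le> m' \<Longrightarrow> gmass TYPE('n::finite) m \<le> gmass TYPE('n) m'"
  unfolding gmass_def
  by (rule integral_mono[OF integrable_gmass integrable_gmass]) (auto split: split_indicator)

lemma gmass_tendsto: "(\<lambda>m::nat. gmass TYPE('n::finite) (real m)) \<longlonglongrightarrow> (2 * pi) powr (real CARD('n) / 2)"
proof -
  have "(\<lambda>m::nat. gmass TYPE('n) (real m)) \<longlonglongrightarrow> (\<integral>v. exp (- ((norm (v::real^'n))^2) / 2) \<partial>lborel)"
    unfolding gmass_def
  proof (rule integral_dominated_convergence[where w = "\<lambda>v::real^'n. exp (- ((norm v)^2) / 2)"])
    show "AE v in lborel. (\<lambda>m. indicator (cball 0 (real m)) v * exp (- ((norm (v::real^'n))^2) / 2)) \<longlonglongrightarrow> exp (- ((norm v)^2) / 2)"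
    proof (rule AE_I2)
      fix v :: "real^'n"
      obtain m0 :: nat where m0: "norm v \<le> real m0" using real_arch_simple by blast
      have "eventually (\<lambda>m. indicator (cball 0 (real m)) v * exp (- ((norm v)^2) / 2) = exp (- ((norm v)^2) / 2)) sequentially"
        using eventually_ge_at_top[of m0] by eventually_elim (use m0 in auto)
      then show "(\<lambda>m. indicator (cball 0 (real m)) v * exp (- ((norm v)^2) / 2)) \<longlonglongrightarrow> exp (- ((norm v)^2) / 2)"
        by (rule tendsto_eventually)
    qed
    show "AE v in lborel. norm (indicator (cball 0 (real m)) v * exp (- ((norm (v::real^'n))^2) / 2)) \<le> exp (- ((norm v)^2) / 2)" for m
      by (intro AE_I2) (auto split: split_indicator)
  qed (use integrable_exp_half_norm borel_measurable_integrable[OF integrable_exp_half_norm]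
        borel_measurable_integrable[OF integrable_gmass] in simp_all)
  moreover have "(\<integral>v. exp (- ((norm (v::real^'n))^2) / 2) \<partial>lborel) = (2 * pi) powr (real CARD('n) / 2)"
  proof -
    have "ennreal (\<integral>v. exp (- ((norm (v::real^'n))^2) / 2) \<partial>lborel) = ennreal ((2 * pi) powr (real CARD('n) / 2))"
      unfolding nn_integral_exp_neg_norm[symmetric]
      by (rule nn_integral_eq_integral[symmetric, OF integrable_exp_half_norm]) simp
    then show ?thesis by (subst (asm) ennreal_inj) (auto intro!: integral_nonneg_AE)
  qed
  ultimately show ?thesis by simp
qed

text \<open>Completing the square if \<open>|s| \<le> M/2\<close>, and \<open>e\<^sup>t \<ge> 1 + t\<close> otherwise.\<close>
lemma tilted_ge:
  fixes s :: "real^'n::finite"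
  assumes M: "M > 0"
  shows "tilted M s \<ge> gmass TYPE('n) (M / 2) * exp ((norm s)^2 / 2 - 2 * (norm s)^4 / M^2)"
proof -
  have g0: "gmass TYPE('n) (M / 2) \<ge> 0" unfolding gmass_def by (intro integral_nonneg_AE) auto
  show ?thesis
  proof (cases "norm s \<le> M / 2")
    case True
    have "gmass TYPE('n) (M / 2) * exp ((norm s)^2 / 2 - 2 * (norm s)^4 / M^2) \<le> gmass TYPE('n) (M / 2) * exp ((norm s)^2 / 2)"
      by (intro mult_left_mono g0) simp
    also have "\<dots> = (\<integral>v. exp ((norm s)^2 / 2) * (indicator (cball 0 (M/2)) v * exp (- ((norm (v::real^'n))^2) / 2)) \<partial>lborel)"
      by (simp add: gmass_def)
    also have "\<dots> \<le> (\<integral>v. indicator (cball 0 M) (s + v) * exp ((s + v) \<bullet> s - (norm (s + v))^2 / 2) \<partial>lborel)"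
    proof (rule integral_mono)
      show "integrable lborel (\<lambda>v. exp ((norm s)^2 / 2) * (indicator (cball 0 (M/2)) v * exp (- ((norm (v::real^'n))^2) / 2)))"
        by (intro integrable_mult_right integrable_gmass)
      have "integrable (distr lborel borel ((+) s)) (\<lambda>v. indicator (cball 0 M) v * exp (v \<bullet> s - (norm v)^2 / 2))"
        unfolding lborel_distr_plus by (rule integrable_tilted)
      then show "integrable lborel (\<lambda>v. indicator (cball 0 M) (s + v) * exp ((s + v) \<bullet> s - (norm (s + v))^2 / 2))"
        by (rule integrable_distr[rotated]) simp
      fix v :: "real^'n"
      have e: "(s + v) \<bullet> s - (norm (s + v))^2 / 2 = (norm s)^2 / 2 + (- ((norm v)^2) / 2)"
        unfolding power2_norm_eq_inner by (simp add: inner_add_left inner_add_right inner_commute field_simps)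
      have "v \<in> cball 0 (M/2) \<Longrightarrow> s + v \<in> cball 0 M"
        using True norm_triangle_ineq[of s v] by simp
      then show "exp ((norm s)^2 / 2) * (indicator (cball 0 (M/2)) v * exp (- ((norm v)^2) / 2)) \<le> indicator (cball 0 M) (s + v) * exp ((s + v) \<bullet> s - (norm (s + v))^2 / 2)"
        unfolding e exp_add by (auto split: split_indicator)
    qed
    also have "\<dots> = (\<integral>v. indicator (cball 0 M) v * exp (v \<bullet> s - (norm v)^2 / 2) \<partial>distr lborel borel ((+) s))"
      by (rule integral_distr[symmetric]) (use borel_measurable_integrable[OF integrable_tilted] in simp_all)
    also have "\<dots> = tilted M s" unfolding lborel_distr_plus tilted_def ..
    finally show ?thesis .
  next
    case False
    then have s: "norm s > M / 2" by simp
    \<comment> \<open>For such s the correction \<open>2 * (norm s)^4 / M^2\<close> exceeds half the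
      squared norm, so the claimed lower bound is at most \<open>gmass\<close> at
      \<open>M / 2\<close>. This is the purpose of the quartic term.\<close>
    have "(M/2)^2 \<le> (norm s)^2" using s M by (intro power_mono) auto
    then have "(norm s)^2 * M^2 \<le> (norm s)^2 * (4 * (norm s)^2)" by (intro mult_left_mono) (auto simp: power_divide)
    then have "(norm s)^2 / 2 - 2 * (norm s)^4 / M^2 \<le> 0" using M by (simp add: field_simps eval_nat_numeral)
    then have "gmass TYPE('n) (M / 2) * exp ((norm s)^2 / 2 - 2 * (norm s)^4 / M^2) \<le> gmass TYPE('n) (M / 2) * 1"
      by (intro mult_left_mono g0) simp
    also have "\<dots> \<le> gmass TYPE('n) M" using gmass_mono[of "M/2" M, where 'n = 'n] M by simp
    also have "\<dots> \<le> tilted M s"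
    proof -
      let ?g = "\<lambda>v::real^'n. indicator (cball 0 M) v * exp (- ((norm v)^2) / 2)"
      \<comment> \<open>The first-order term of \<open>exp (v \<bullet> s)\<close> is odd on a
        symmetric ball and integrates to 0.\<close>
      let ?o = "\<lambda>v::real^'n. ?g v * (v \<bullet> s)"
      have io: "integrable lborel ?o"
      proof -
        have "integrable lborel (\<lambda>v::real^'n. indicator (cball 0 M) v *\<^sub>R (exp (- ((norm v)^2) / 2) * (v \<bullet> s)))"
          by (intro borel_integrable_compact continuous_intros) auto
        then show ?thesis by (simp add: mult.assoc)
      qed
      have "(\<integral>v. ?o v \<partial>lborel) = (\<integral>v. ?o (- v) \<partial>lborel)"
        by (rule integral_lborel_uminus[symmetric]) (use borel_measurable_integrable[OF io] in simp)
      also have "(\<lambda>v. ?o (- v)) = (\<lambda>v. - ?o v)" by (auto simp: fun_eq_iff split: split_indicator)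
      finally have "(\<integral>v. ?o v \<partial>lborel) = - (\<integral>v. ?o v \<partial>lborel)"
        by (simp only: Bochner_Integration.integral_minus)
      then have o0: "(\<integral>v. ?o v \<partial>lborel) = 0" by linarith
      have "gmass TYPE('n) M = (\<integral>v. ?g v + ?o v \<partial>lborel)"
        unfolding gmass_def Bochner_Integration.integral_add[OF integrable_gmass io] o0 by simp
      also have "\<dots> \<le> tilted M s"
        unfolding tilted_def
      proof (rule integral_mono[OF Bochner_Integration.integrable_add[OF integrable_gmass io] integrable_tilted])
        fix v :: "real^'n"
        have "?g v + ?o v = ?g v * (1 + v \<bullet> s)" by (simp add: algebra_simps)
        also have "\<dots> \<le> ?g v * exp (v \<bullet> s)" by (intro mult_left_mono exp_ge_add_one_self) auto
        also have "\<dots> = indicator (cball 0 M) v * exp (v \<bullet> s - (norm v)^2 / 2)"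
          by (simp add: mult.assoc flip: exp_add)
        finally show "?g v + ?o v \<le> indicator (cball 0 M) v * exp (v \<bullet> s - (norm v)^2 / 2)" .
      qed
      finally show ?thesis .
    qed
    finally show ?thesis .
  qed
qed

section \<open>Quadratic expansion of the log-likelihood and its errors\<close>

context
  fixes k :: "'n::finite" and x :: "real^'n" and T :: "real^'n \<Rightarrow> real^'n"
  assumes frame: "polar_frame k x T"
begin

text \<open>The fluctuation of the whitened negative Hessian of the log-likelihood around its mean, the identity.\<close>
definition hess_dev :: "'n \<Rightarrow> 'n \<Rightarrow> real^'n \<Rightarrow> real" where
  "hess_dev i j h = curv (h \<bullet> x) * ((h \<bullet> wmap k x T (axis i 1)) * (h \<bullet> wmap k x T (axis j 1))) - (if i = j then 1 else 0)"

text \<open>The loss in the expansion for \<open>norm v \<le> M\<close>, independent of v: the first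
  term pays for replacing the empirical Hessian by the identity, the second for the cubic Taylor
  remainder.\<close>

definition lap_err :: "real \<Rightarrow> real \<Rightarrow> nat \<Rightarrow> (nat \<Rightarrow> real^'n) \<Rightarrow> real" where
  "lap_err C M N K = M^2 / 2 * (\<Sum>i\<in>UNIV. \<Sum>j\<in>UNIV. \<bar>(\<Sum>l<N. hess_dev i j (K l)) / real N\<bar>)
     + C * M^3 / sqrt (real N) * ((\<Sum>l<N. (1 + norm (K l))^6) / real N)"

lemma hess_dev_measurable [measurable]: "hess_dev i j \<in> borel_measurable borel"
  unfolding hess_dev_def[abs_def] by measurable

text \<open>The empirical quadratic form differs from the squared norm by a form with the averaged
  \<open>hess_dev\<close> as its coefficients; each product of two coordinates of v is at most
  \<open>M^2\<close>.\<close>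

lemma quad_form_le:
  assumes v: "norm v \<le> M" and N: "N > 0"
  shows "(\<Sum>l<N. curv (K l \<bullet> x) * (K l \<bullet> wmap k x T v)^2) / real N
     \<le> (norm v)^2 + M^2 * (\<Sum>i\<in>UNIV. \<Sum>j\<in>UNIV. \<bar>(\<Sum>l<N. hess_dev i j (K l)) / real N\<bar>)"
proof -
  let ?e = "\<lambda>i. wmap k x T (axis i 1)"
  let ?D = "\<lambda>i j. (\<Sum>l<N. hess_dev i j (K l)) / real N"
  have sq: "(h \<bullet> wmap k x T v)^2 = (\<Sum>i\<in>UNIV. \<Sum>j\<in>UNIV. v $ i * v $ j * ((h \<bullet> ?e i) * (h \<bullet> ?e j)))" for h
    by (subst whiten_eq_sum[OF frame]) (simp add: inner_sum_right power2_eq_square sum_product mult_ac)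
  have c: "curv (h \<bullet> x) * (h \<bullet> wmap k x T v)^2 = (\<Sum>i\<in>UNIV. \<Sum>j\<in>UNIV. v $ i * v $ j * hess_dev i j h) + (norm v)^2" for h
  proof -
    have "(norm v)^2 = (\<Sum>i\<in>UNIV. \<Sum>j\<in>UNIV. v $ i * v $ j * (if i = j then 1 else 0))"
      by (simp add: norm_vec_def L2_set_def sum_nonneg power2_eq_square if_distrib cong: if_cong)
    then have "(\<Sum>i\<in>UNIV. \<Sum>j\<in>UNIV. v $ i * v $ j * hess_dev i j h) + (norm v)^2
      = (\<Sum>i\<in>UNIV. \<Sum>j\<in>UNIV. v $ i * v $ j * hess_dev i j h + v $ i * v $ j * (if i = j then 1 else 0))"
      by (simp only: sum.distrib)
    also have "\<dots> = (\<Sum>i\<in>UNIV. \<Sum>j\<in>UNIV. v $ i * v $ j * (curv (h \<bullet> x) * ((h \<bullet> ?e i) * (h \<bullet> ?e j))))"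
      by (intro sum.cong refl) (simp add: hess_dev_def algebra_simps)
    also have "\<dots> = curv (h \<bullet> x) * (h \<bullet> wmap k x T v)^2"
      unfolding sq sum_distrib_left by (intro sum.cong refl) (simp only: mult_ac)
    finally show ?thesis by simp
  qed
  have "(\<Sum>l<N. curv (K l \<bullet> x) * (K l \<bullet> wmap k x T v)^2) / real N
      = (\<Sum>l<N. \<Sum>i\<in>UNIV. \<Sum>j\<in>UNIV. v $ i * v $ j * hess_dev i j (K l)) / real N + (norm v)^2"
    unfolding c sum.distrib using N by (simp add: add_divide_distrib)
  also have "(\<Sum>l<N. \<Sum>i\<in>UNIV. \<Sum>j\<in>UNIV. v $ i * v $ j * hess_dev i j (K l)) / real N
      = (\<Sum>i\<in>UNIV. \<Sum>j\<in>UNIV. v $ i * v $ j * ?D i j)"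
  proof -
    have "(\<Sum>l<N. \<Sum>i\<in>UNIV. \<Sum>j\<in>UNIV. v $ i * v $ j * hess_dev i j (K l))
        = (\<Sum>i\<in>UNIV. \<Sum>l<N. \<Sum>j\<in>UNIV. v $ i * v $ j * hess_dev i j (K l))" by (rule sum.swap)
    also have "\<dots> = (\<Sum>i\<in>UNIV. \<Sum>j\<in>UNIV. \<Sum>l<N. v $ i * v $ j * hess_dev i j (K l))"
      by (intro sum.cong refl sum.swap)
    finally show ?thesis by (simp only: sum_divide_distrib sum_distrib_left times_divide_eq_right)
  qed
  also have "(\<Sum>i\<in>UNIV. \<Sum>j\<in>UNIV. v $ i * v $ j * ?D i j) \<le> (\<Sum>i\<in>UNIV. \<Sum>j\<in>UNIV. M^2 * \<bar>?D i j\<bar>)"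
  proof (intro sum_mono)
    fix i j
    have "\<bar>v $ i\<bar> * \<bar>v $ j\<bar> \<le> M * M"
      using component_le_norm_cart[of v i] component_le_norm_cart[of v j] v by (intro mult_mono) auto
    then have "\<bar>v $ i\<bar> * \<bar>v $ j\<bar> * \<bar>?D i j\<bar> \<le> M^2 * \<bar>?D i j\<bar>"
      by (intro mult_right_mono) (auto simp: power2_eq_square)
    moreover have "v $ i * v $ j * ?D i j \<le> \<bar>v $ i\<bar> * \<bar>v $ j\<bar> * \<bar>?D i j\<bar>"
      by (metis abs_ge_self abs_mult)
    ultimately show "v $ i * v $ j * ?D i j \<le> M^2 * \<bar>?D i j\<bar>" by linarith
  qed
  finally show ?thesis by (simp add: sum_distrib_left algebra_simps)
qed

text \<open>The scalar Taylor bound is summed over the antennas. In C the power of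
  \<open>1 + R\<close> comes from the range of the arguments, and the power of \<open>sqrt a\<close>
  from \<open>norm (wmap k x T v) \<le> M / sqrt a\<close>.\<close>

lemma lik_ratio_ge:
  assumes v: "norm v \<le> M" and N: "N > 0"
    and a: "\<And>i. fisher_eig k x i \<ge> a" "a > 0" and R: "norm x \<le> R" "norm (x + (1 / sqrt (real N)) *\<^sub>R wmap k x T v) \<le> R"
  defines "C \<equiv> 1232 * (1 + R)^3 / sqrt a ^ 3"
  shows "ln (lik N (x + (1 / sqrt (real N)) *\<^sub>R wmap k x T v) K) \<ge>
     ln (lik N x K) + v \<bullet> stat k x T N K - (norm v)^2 / 2 - lap_err C M N K"
proof -
  define x' where "x' = x + (1 / sqrt (real N)) *\<^sub>R wmap k x T v"
  define w where "w = wmap k x T v"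
  have R0: "R \<ge> 0" using R(1) norm_ge_zero[of x] by linarith
  have M0: "M \<ge> 0" using v norm_ge_zero[of v] by linarith
  have wn: "norm w \<le> M / sqrt a"
  proof -
    have "(norm w)^2 \<le> (norm v)^2 / a" unfolding w_def by (rule norm_wmap_le[OF frame a])
    also have "\<dots> \<le> M^2 / a" using v a(2) by (intro divide_right_mono power_mono) auto
    also have "\<dots> = (M / sqrt a)^2" using a(2) by (simp add: power_divide)
    finally show ?thesis by (rule power2_le_imp_le) (use M0 a(2) in auto)
  qed
  have one: "ln (Phi (h \<bullet> x')) \<ge> ln (Phi (h \<bullet> x)) + (score_vec x h \<bullet> w) / sqrt (real N) - curv (h \<bullet> x) * (h \<bullet> w)^2 / (real N * 2)
      - C * M^3 / (sqrt (real N) * real N) * (1 + norm h)^6" for h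
  proof -
    have d: "h \<bullet> x' - h \<bullet> x = (h \<bullet> w) / sqrt (real N)" by (simp add: x'_def w_def inner_add_right)
    have ax: "\<bar>h \<bullet> y\<bar> \<le> R * norm h" if "norm y \<le> R" for y
      using Cauchy_Schwarz_ineq2[of h y] mult_left_mono[OF that, of "norm h"] by (simp add: mult.commute)
    note t = ln_Phi_taylor[of "h \<bullet> x" "R * norm h" "h \<bullet> x'", OF ax[OF R(1)] ax[OF R(2)[folded x'_def]]]
    have "\<bar>h \<bullet> x' - h \<bullet> x\<bar>^3 \<le> ((1 + norm h) * (M / sqrt a) / sqrt (real N))^3"
    proof (rule power_mono)
      have "\<bar>h \<bullet> w\<bar> \<le> norm h * norm w" by (rule Cauchy_Schwarz_ineq2)
      also have "\<dots> \<le> (1 + norm h) * (M / sqrt a)" using wn by (intro mult_mono) auto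
      finally have "\<bar>h \<bullet> w\<bar> / sqrt (real N) \<le> (1 + norm h) * (M / sqrt a) / sqrt (real N)"
        by (rule divide_right_mono) simp
      then show "\<bar>h \<bullet> x' - h \<bullet> x\<bar> \<le> (1 + norm h) * (M / sqrt a) / sqrt (real N)"
        unfolding d by simp
    qed simp
    moreover have "(1 + R * norm h)^3 \<le> ((1 + R) * (1 + norm h))^3"
      using R0 by (intro power_mono) (auto simp: algebra_simps)
    ultimately have "1232 * (1 + R * norm h)^3 * \<bar>h \<bullet> x' - h \<bullet> x\<bar>^3
        \<le> 1232 * ((1 + R) * (1 + norm h))^3 * ((1 + norm h) * (M / sqrt a) / sqrt (real N))^3"
      using R0 by (intro mult_mono) auto
    also have "\<dots> = C * M^3 / (sqrt (real N) * real N) * (1 + norm h)^6"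
    proof -
      have "sqrt (real N) ^ 3 = sqrt (real N) * real N" by (simp add: power3_eq_cube)
      moreover have "(1 + norm h)^6 = (1 + norm h)^3 * (1 + norm h)^3" by (simp flip: power_add)
      ultimately show ?thesis unfolding C_def by (simp add: power_mult_distrib power_divide)
    qed
    finally have r: "1232 * (1 + R * norm h)^3 * \<bar>h \<bullet> x' - h \<bullet> x\<bar>^3 \<le> C * M^3 / (sqrt (real N) * real N) * (1 + norm h)^6" .
    have m: "mills (h \<bullet> x) * (h \<bullet> x' - h \<bullet> x) = (score_vec x h \<bullet> w) / sqrt (real N)"
      unfolding d by (simp add: score_vec_def)
    have q: "curv (h \<bullet> x) * (h \<bullet> x' - h \<bullet> x)^2 / 2 = curv (h \<bullet> x) * (h \<bullet> w)^2 / (real N * 2)"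
      unfolding d by (simp add: power_divide)
    from t r show ?thesis unfolding m q by linarith
  qed
  have "(\<Sum>l<N. ln 2 + ln (Phi (K l \<bullet> x'))) \<ge> (\<Sum>l<N. ln 2 + (ln (Phi (K l \<bullet> x)) + (score_vec x (K l) \<bullet> w) / sqrt (real N)
      - curv (K l \<bullet> x) * (K l \<bullet> w)^2 / (real N * 2) - C * M^3 / (sqrt (real N) * real N) * (1 + norm (K l))^6))"
    by (intro sum_mono add_left_mono one)
  also have "(\<Sum>l<N. ln 2 + (ln (Phi (K l \<bullet> x)) + (score_vec x (K l) \<bullet> w) / sqrt (real N)
      - curv (K l \<bullet> x) * (K l \<bullet> w)^2 / (real N * 2) - C * M^3 / (sqrt (real N) * real N) * (1 + norm (K l))^6))
    = ln (lik N x K) + v \<bullet> stat k x T N K - ((\<Sum>l<N. curv (K l \<bullet> x) * (K l \<bullet> w)^2) / real N) / 2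
      - C * M^3 / sqrt (real N) * ((\<Sum>l<N. (1 + norm (K l))^6) / real N)"
    unfolding ln_lik inner_stat[OF frame] w_def[symmetric]
    by (simp add: sum.distrib sum_subtractf sum_divide_distrib sum_distrib_left)
  finally have "ln (lik N x' K) \<ge> ln (lik N x K) + v \<bullet> stat k x T N K - ((\<Sum>l<N. curv (K l \<bullet> x) * (K l \<bullet> w)^2) / real N) / 2
      - C * M^3 / sqrt (real N) * ((\<Sum>l<N. (1 + norm (K l))^6) / real N)"
    unfolding ln_lik .
  moreover have "l + t - c / 2 - r \<le> L \<Longrightarrow> c \<le> n + m * Q \<Longrightarrow> l + t - n / 2 - (m / 2 * Q + r) \<le> L"
    for l t c r L n m Q :: real by (simp add: field_simps)
  moreover have "(\<Sum>l<N. curv (K l \<bullet> x) * (K l \<bullet> w)^2) / real N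
     \<le> (norm v)^2 + M^2 * (\<Sum>i\<in>UNIV. \<Sum>j\<in>UNIV. \<bar>(\<Sum>l<N. hess_dev i j (K l)) / real N\<bar>)"
    unfolding w_def by (rule quad_form_le[OF v N])
  ultimately show ?thesis unfolding lap_err_def x'_def by blast
qed

text \<open>The mixture is bounded below by its part with local coordinate
  \<open>norm v \<le> M\<close>, where the prior density loses at most the factor
  \<open>1 - \<eta>\<close> and the likelihood is bounded by its quadratic expansion;
  \<open>tilted_ge\<close> evaluates the resulting integral.\<close>

lemma mix_jeffreys_ge:
  assumes snr: "snr > 0" and N: "N > 0" and M: "M > 0"
    and a: "\<And>i. fisher_eig k x i \<ge> a" "a > 0" and x: "norm x \<le> sqrt snr"
    and near: "\<And>v. norm v \<le> M \<Longrightarrow> norm (x + (1 / sqrt (real N)) *\<^sub>R wmap k x T v) \<le> sqrt snr \<and>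
       jeffreys_weight CARD('n) (norm (x + (1 / sqrt (real N)) *\<^sub>R wmap k x T v)) \<ge> (1 - \<eta>) * jeffreys_weight CARD('n) (norm x)"
    and \<eta>: "\<eta> < 1" and gp: "gmass TYPE('n) (M / 2) > 0"
  defines "C \<equiv> 1232 * (1 + sqrt snr)^3 / sqrt a ^ 3"
  shows "ln (mix N (jeffreys snr) K / lik N x K) \<ge>
     ln (1 - \<eta>) - real CARD('n) / 2 * ln (real N) - ln (jeffreys_mass CARD('n) (sqrt snr)) - lap_err C M N K
     + ln (gmass TYPE('n) (M / 2)) + (norm (stat k x T N K))^2 / 2 - 2 * (norm (stat k x T N K))^4 / M^2"
    (is "_ \<ge> ?B")
proof -
  interpret j: peak_input "jeffreys snr :: (real^'n) measure" "sqrt snr" by (rule peak_input_jeffreys[OF snr])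
  let ?n = "CARD('n)" let ?S = "stat k x T N K" let ?jc = "jeffreys_mass CARD('n) (sqrt snr)"
  let ?y = "\<lambda>v. x + (1 / sqrt (real N)) *\<^sub>R wmap k x T v"
  let ?q = "sqrt (real N) ^ CARD('n) * jeffreys_weight CARD('n) (norm x)"
  have jc: "?jc > 0" using snr by (intro jeffreys_mass_pos) auto
  have q: "?q > 0" using N by simp
  define c where "c = (1 - \<eta>) * jeffreys_weight ?n (norm x) / ?jc * (lik N x K * exp (- lap_err C M N K))"
  have c: "c > 0" unfolding c_def using \<eta> jc by simp
  have pw: "c * (indicator (cball 0 M) v * exp (v \<bullet> ?S - (norm v)^2 / 2)) \<le> jeffreys_density snr (?y v) * lik N (?y v) K" for v
  proof (cases "norm v \<le> M")
    case True
    have "lik N x K * exp (- lap_err C M N K) * exp (v \<bullet> ?S - (norm v)^2 / 2)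
        = exp (ln (lik N x K) + v \<bullet> ?S - (norm v)^2 / 2 - lap_err C M N K)"
    proof -
      have "ln (lik N x K) + v \<bullet> ?S - (norm v)^2 / 2 - lap_err C M N K
          = ln (lik N x K) + - lap_err C M N K + (v \<bullet> ?S - (norm v)^2 / 2)" by simp
      then show ?thesis by (simp only: exp_add exp_ln lik_pos)
    qed
    also have "\<dots> \<le> exp (ln (lik N (?y v) K))"
      unfolding exp_le_cancel_iff C_def by (rule lik_ratio_ge[OF True N a x]) (use near[OF True] in blast)
    finally have 1: "lik N x K * exp (- lap_err C M N K) * exp (v \<bullet> ?S - (norm v)^2 / 2) \<le> lik N (?y v) K" by simp
    have "(1 - \<eta>) * jeffreys_weight ?n (norm x) / ?jc \<le> jeffreys_density snr (?y v)"
      unfolding jeffreys_density_eq using near[OF True] jc by (simp add: divide_right_mono)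
    then have "((1 - \<eta>) * jeffreys_weight ?n (norm x) / ?jc) * (lik N x K * exp (- lap_err C M N K) * exp (v \<bullet> ?S - (norm v)^2 / 2))
        \<le> jeffreys_density snr (?y v) * lik N (?y v) K"
      using \<eta> by (intro mult_mono 1 jeffreys_density_nonneg[OF snr]) auto
    then show ?thesis unfolding c_def using True by (simp add: mult.assoc)
  next
    case False
    then show ?thesis using jeffreys_density_nonneg[OF snr, of "?y v"] by simp
  qed
  have "ennreal (mix N (jeffreys snr) K) = (\<integral>\<^sup>+x'. ennreal (lik N x' K) \<partial>(jeffreys snr :: (real^'n) measure))"
    unfolding mix_def by (rule nn_integral_eq_integral[symmetric, OF j.integrable_lik]) simp
  also have "\<dots> = (\<integral>\<^sup>+x'. ennreal (jeffreys_density snr x') * ennreal (lik N x' K) \<partial>lborel)"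
    unfolding jeffreys_def by (rule nn_integral_density) auto
  also have "\<dots> = (\<integral>\<^sup>+x'. ennreal (jeffreys_density snr x' * lik N x' K) \<partial>lborel)"
    by (simp add: ennreal_mult jeffreys_density_nonneg[OF snr])
  also have "\<dots> = ennreal (1 / ?q) * (\<integral>\<^sup>+v. ennreal (jeffreys_density snr (?y v) * lik N (?y v) K) \<partial>lborel)"
    by (rule nn_integral_lborel_wmap[OF frame N]) measurable
  also have "\<dots> \<ge> ennreal (1 / ?q) * (\<integral>\<^sup>+v. ennreal (c * (indicator (cball 0 M) v * exp (v \<bullet> ?S - (norm v)^2 / 2))) \<partial>lborel)"
    by (intro mult_left_mono nn_integral_mono ennreal_leI pw) simp
  also have "(\<integral>\<^sup>+v. ennreal (c * (indicator (cball 0 M) v * exp (v \<bullet> ?S - (norm v)^2 / 2))) \<partial>lborel) = ennreal (c * tilted M ?S)"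
    unfolding tilted_def using c
    by (subst nn_integral_eq_integral) (auto intro!: integrable_mult_right integrable_tilted)
  also have "ennreal (1 / ?q) * ennreal (c * tilted M ?S) = ennreal (1 / ?q * (c * tilted M ?S))"
    using q by (intro ennreal_mult[symmetric]) (auto intro!: mult_nonneg_nonneg less_imp_le[OF c] integral_nonneg_AE simp: tilted_def)
  finally have mx: "mix N (jeffreys snr) K \<ge> 1 / ?q * (c * tilted M ?S)"
    by (subst (asm) ennreal_le_iff) simp_all
  define G where "G = gmass TYPE('n) (M / 2) * exp ((norm ?S)^2 / 2 - 2 * (norm ?S)^4 / M^2)"
  have G: "G > 0" unfolding G_def using gp by simp
  have "1 / ?q * (c * G) \<le> 1 / ?q * (c * tilted M ?S)"
    unfolding G_def using q c by (intro mult_left_mono tilted_ge[OF M]) auto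
  with mx have "1 / ?q * (c * G) \<le> mix N (jeffreys snr) K" by linarith
  then have "1 / ?q * (c * G) / lik N x K \<le> mix N (jeffreys snr) K / lik N x K" by (rule divide_right_mono) simp
  also have "1 / ?q * (c * G) / lik N x K = (1 - \<eta>) / (sqrt (real N) ^ ?n * ?jc) * (exp (- lap_err C M N K) * G)"
    using q jc N unfolding c_def by (simp add: field_simps)
  finally have le: "(1 - \<eta>) / (sqrt (real N) ^ ?n * ?jc) * (exp (- lap_err C M N K) * G) \<le> mix N (jeffreys snr) K / lik N x K" .
  have pos: "(1 - \<eta>) / (sqrt (real N) ^ ?n * ?jc) * (exp (- lap_err C M N K) * G) > 0"
    using \<eta> N jc G by simp
  have "ln ((1 - \<eta>) / (sqrt (real N) ^ ?n * ?jc) * (exp (- lap_err C M N K) * G)) = ?B"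
  proof -
    have "ln ((1 - \<eta>) / (sqrt (real N) ^ ?n * ?jc) * (exp (- lap_err C M N K) * G))
       = ln (1 - \<eta>) - (real ?n * ln (sqrt (real N)) + ln ?jc) + (- lap_err C M N K + (ln (gmass TYPE('n) (M / 2)) + ((norm ?S)^2 / 2 - 2 * (norm ?S)^4 / M^2)))"
      unfolding G_def using \<eta> N jc gp by (simp add: ln_mult ln_div ln_realpow)
    moreover have "ln (sqrt (real N)) = ln (real N) / 2" using N by (simp add: ln_sqrt)
    ultimately show ?thesis by simp
  qed
  then show ?thesis using le pos by (metis ln_mono)
qed

lemma norm_wmap_axis_le:
  assumes a: "\<And>i. fisher_eig k x i \<ge> a" "a > 0"
  shows "norm (wmap k x T (axis i 1)) \<le> 1 / sqrt a"
proof -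
  have "(norm (wmap k x T (axis i 1)))^2 \<le> (norm (axis i 1 :: real^'n))^2 / a" by (rule norm_wmap_le[OF frame a])
  also have "\<dots> = (1 / sqrt a)^2" using a(2) by (simp add: power_divide)
  finally show ?thesis by (rule power2_le_imp_le) (use a(2) in simp)
qed

lemma hess_dev_le:
  assumes a: "\<And>i. fisher_eig k x i \<ge> a" "a > 0" and x: "norm x \<le> R"
  shows "\<bar>hess_dev i j h\<bar> \<le> (72 * (1 + R)^2 / a + 1) * (1 + norm h)^4"
proof -
  have R: "R \<ge> 0" using x norm_ge_zero[of x] by linarith
  have e: "\<bar>h \<bullet> wmap k x T (axis i 1)\<bar> \<le> (1 + norm h) * (1 / sqrt a)" for i
    using Cauchy_Schwarz_ineq2[of h "wmap k x T (axis i 1)"]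
    by (rule order_trans) (use norm_wmap_axis_le[OF a] in \<open>auto intro!: mult_mono simp del: times_divide_eq_right\<close>)
  have c: "\<bar>curv (h \<bullet> x)\<bar> \<le> 72 * ((1 + R) * (1 + norm h))^2"
  proof -
    have "(1 + \<bar>h \<bullet> x\<bar>) \<le> (1 + R) * (1 + norm h)"
      using one_plus_inner_le[of h x] by (rule order_trans) (use x in \<open>auto intro!: mult_right_mono\<close>)
    then have "(1 + \<bar>h \<bullet> x\<bar>)^2 \<le> ((1 + R) * (1 + norm h))^2" by (intro power_mono) auto
    then show ?thesis using curv_abs_le[of "h \<bullet> x"] by linarith
  qed
  have "\<bar>hess_dev i j h\<bar> \<le> \<bar>curv (h \<bullet> x)\<bar> * (\<bar>h \<bullet> wmap k x T (axis i 1)\<bar> * \<bar>h \<bullet> wmap k x T (axis j 1)\<bar>) + 1"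
    unfolding hess_dev_def abs_mult[symmetric] by (auto simp: abs_if)
  also have "\<dots> \<le> 72 * ((1 + R) * (1 + norm h))^2 * (((1 + norm h) * (1 / sqrt a)) * ((1 + norm h) * (1 / sqrt a))) + 1 * (1 + norm h)^4"
    using a(2) R by (intro add_mono mult_mono c e) auto
  also have "\<dots> = (72 * (1 + R)^2 / a + 1) * (1 + norm h)^4"
  proof -
    have "72 * (p * y)^2 * ((y * (1 / q)) * (y * (1 / q))) + 1 * y^4 = (72 * p^2 / (q * q) + 1) * y^4"
      if "q > 0" for p q y :: real
      using that by (simp add: field_simps eval_nat_numeral)
    from this[of "sqrt a" "1 + R" "1 + norm h"] show ?thesis using a(2) by simp
  qed
  finally show ?thesis .
qed

text \<open>The information identity \<open>folded_law_curv_product\<close>, read in whitened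
  coordinates.\<close>

lemma hess_dev_mean: "(\<integral>h. hess_dev i j h \<partial>folded_law x) = 0"
proof -
  have i: "integrable (folded_law x) (\<lambda>h. curv (h \<bullet> x) * ((h \<bullet> wmap k x T (axis i 1)) * (h \<bullet> wmap k x T (axis j 1))))"
  proof -
    obtain a where a: "a > 0" "\<And>i. a \<le> fisher_eig k x i"
      using fisher_eig_bounds[of "norm x", where 'n = 'n] by auto
    have "integrable gauss_vec (\<lambda>h. hess_dev i j h + (if i = j then 1 else 0))"
      by (intro Bochner_Integration.integrable_add
          integrable_gauss_poly_bound[OF hess_dev_measurable hess_dev_le[OF a(2,1) order_refl, folded real_norm_def]]) simp
    then show ?thesis by (intro integrable_folded_law(1)) (simp add: hess_dev_def)
  qed
  have "(\<integral>h. hess_dev i j h \<partial>folded_law x) = finfo x (wmap k x T (axis i 1)) (wmap k x T (axis j 1)) - (if i = j then 1 else 0)"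
    unfolding hess_dev_def
    by (subst Bochner_Integration.integral_diff[OF i]) (simp_all add: folded_law_curv_product folded_law.prob_space[simplified])
  then show ?thesis by (simp add: finfo_wmap[OF frame] inner_axis_axis)
qed

definition gauss_moment :: "'n itself \<Rightarrow> nat \<Rightarrow> real" where
  "gauss_moment _ p = (\<integral>h. (1 + norm (h::real^'n))^p \<partial>gauss_vec)"

lemma integral_folded_law_poly_le:
  assumes [measurable]: "f \<in> borel_measurable borel" and f: "\<And>h. 0 \<le> f h" "\<And>h. f h \<le> B * (1 + norm h)^p"
  shows "(\<integral>h. f h \<partial>folded_law x) \<le> 2 * (B * gauss_moment TYPE('n) p)" "integrable (folded_law x) f" "integrable gauss_vec f"
proof -
  show ig: "integrable gauss_vec f" by (rule integrable_gauss_poly_bound[where C = B and p = p]) (use f in auto)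
  then show "integrable (folded_law x) f" by (rule integrable_folded_law(1))
  have "(\<integral>h. f h \<partial>folded_law x) \<le> 2 * (\<integral>h. f h \<partial>gauss_vec)" by (rule integral_folded_law_le[OF ig f(1)])
  also have "(\<integral>h. f h \<partial>gauss_vec) \<le> (\<integral>h. B * (1 + norm (h::real^'n))^p \<partial>gauss_vec)"
    by (rule integral_mono[OF ig]) (use f integrable_gauss_poly in auto)
  finally show "(\<integral>h. f h \<partial>folded_law x) \<le> 2 * (B * gauss_moment TYPE('n) p)" by (simp add: gauss_moment_def)
qed

text \<open>Both terms decay like \<open>1 / sqrt N\<close>: the first by the law of large numbers
  for the centred Hessian entries, the second by its explicit factor. H1 counts \<open>n^2\<close>
  entries; the factor 2 bounds the density of the folded law.\<close>

lemma lap_err_mean: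
  assumes a: "\<And>i. fisher_eig k x i \<ge> a" "a > 0" and x: "norm x \<le> R" and N: "N > 0" and C: "C \<ge> 0" and M: "M \<ge> 0"
  defines "H1 \<equiv> real CARD('n)^2 * sqrt (2 * ((72 * (1 + R)^2 / a + 1)^2 * gauss_moment TYPE('n) 8))"
  shows "(\<integral>K. lap_err C M N K \<partial>PiM {..<N} (\<lambda>_. folded_law x)) \<le> (M^2 / 2 * H1 + C * M^3 * (2 * gauss_moment TYPE('n) 6)) / sqrt (real N)"
    and "integrable (PiM {..<N} (\<lambda>_. folded_law x)) (lap_err C M N)"
proof -
  let ?P = "PiM {..<N} (\<lambda>_. folded_law x)"
  let ?B = "72 * (1 + R)^2 / a + 1"
  let ?D = "\<lambda>i j K. \<bar>(\<Sum>l<N. hess_dev i j (K l)) / real N\<bar>"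
  have hm: "hess_dev i j \<in> borel_measurable (folded_law x)" for i j by simp
  have h2: "\<bar>hess_dev i j h\<bar>^2 \<le> ?B^2 * (1 + norm h)^8" for i j h
    using power_mono[OF hess_dev_le[OF a x, of i j h], of 2] by (simp add: power_mult_distrib flip: power_mult)
  have ih2: "integrable (folded_law x) (\<lambda>h. \<bar>hess_dev i j h\<bar>^2)" and mh2: "(\<integral>h. (hess_dev i j h)^2 \<partial>folded_law x) \<le> 2 * (?B^2 * gauss_moment TYPE('n) 8)" for i j
    using integral_folded_law_poly_le[of "\<lambda>h. \<bar>hess_dev i j h\<bar>^2", OF _ _ h2] by simp_all
  have iD: "integrable ?P (?D i j)" for i j
  proof -
    have "integrable (folded_law x) (\<lambda>h. \<bar>hess_dev i j h\<bar>^1)" by (rule folded_law.integrable_lower_power(1)[OF hm ih2]) simp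
    then have "integrable ?P (\<lambda>K. (\<Sum>l<N. hess_dev i j (K l))^1)" by (rule folded_law.integrable_iid_sum_power[OF hm])
    then show ?thesis by (intro integrable_abs integrable_divide) simp
  qed
  have mD: "(\<integral>K. ?D i j K \<partial>?P) \<le> sqrt (2 * (?B^2 * gauss_moment TYPE('n) 8)) / sqrt (real N)" for i j
  proof -
    have "(\<integral>K. ?D i j K \<partial>?P) \<le> sqrt (\<integral>h. (hess_dev i j h)^2 \<partial>folded_law x) / sqrt (real N)"
      by (rule folded_law.iid_mean_abs_deviation[OF hm ih2 hess_dev_mean N])
    also have "\<dots> \<le> sqrt (2 * (?B^2 * gauss_moment TYPE('n) 8)) / sqrt (real N)"
      by (intro divide_right_mono real_sqrt_le_mono mh2) simp
    finally show ?thesis .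
  qed
  let ?h = "\<lambda>h::real^'n. (1 + norm h)^6"
  have hb: "?h \<in> borel_measurable borel" "\<And>h. 0 \<le> ?h h" "\<And>h. ?h h \<le> 1 * (1 + norm h)^6" by auto
  have m6: "(\<integral>h. ?h h \<partial>folded_law x) \<le> 2 * gauss_moment TYPE('n) 6" "integrable (folded_law x) ?h"
    using integral_folded_law_poly_le(1)[OF hb] integral_folded_law_poly_le(2)[OF hb] by (simp_all only: mult_1_left)
  have i6: "integrable ?P (\<lambda>K. (\<Sum>l<N. ?h (K l)) / real N)"
    by (intro integrable_divide Bochner_Integration.integrable_sum folded_law.integrable_iid_component m6) auto
  have e6: "(\<integral>K. (\<Sum>l<N. ?h (K l)) / real N \<partial>?P) = (\<integral>h. ?h h \<partial>folded_law x)"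
  proof -
    have "(\<integral>K. (\<Sum>l<N. ?h (K l)) \<partial>?P) = (\<Sum>l<N. (\<integral>K. ?h (K l) \<partial>?P))"
      by (rule Bochner_Integration.integral_sum) (auto intro: folded_law.integrable_iid_component[OF m6(2)])
    also have "\<dots> = (\<Sum>l<N. (\<integral>h. ?h h \<partial>folded_law x))"
      by (intro sum.cong refl folded_law.integral_iid_component) auto
    finally show ?thesis using N by simp
  qed
  have iDD: "integrable ?P (\<lambda>K. \<Sum>i\<in>UNIV. \<Sum>j\<in>UNIV. ?D i j K)"
    by (intro Bochner_Integration.integrable_sum iD)
  show il: "integrable ?P (lap_err C M N)"
    unfolding lap_err_def[abs_def] by (intro Bochner_Integration.integrable_add integrable_mult_right iDD i6)
  have "(\<integral>K. lap_err C M N K \<partial>?P) = M^2 / 2 * (\<Sum>i\<in>UNIV. \<Sum>j\<in>UNIV. (\<integral>K. ?D i j K \<partial>?P)) + C * M^3 / sqrt (real N) * (\<integral>h. ?h h \<partial>folded_law x)"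
    unfolding lap_err_def e6[symmetric]
    by (subst Bochner_Integration.integral_add[OF integrable_mult_right[OF iDD] integrable_mult_right[OF i6]])
      (simp only: integral_mult_right_zero Bochner_Integration.integral_sum iD Bochner_Integration.integrable_sum)
  also have "\<dots> \<le> M^2 / 2 * (\<Sum>i\<in>(UNIV::'n set). \<Sum>j\<in>(UNIV::'n set). sqrt (2 * (?B^2 * gauss_moment TYPE('n) 8)) / sqrt (real N)) + C * M^3 / sqrt (real N) * (2 * gauss_moment TYPE('n) 6)"
    by (intro add_mono mult_left_mono sum_mono mD m6(1)) (use C M in auto)
  also have "\<dots> = (M^2 / 2 * H1 + C * M^3 * (2 * gauss_moment TYPE('n) 6)) / sqrt (real N)"
    unfolding H1_def by (simp add: power2_eq_square add_divide_distrib algebra_simps)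
  finally show "(\<integral>K. lap_err C M N K \<partial>?P) \<le> (M^2 / 2 * H1 + C * M^3 * (2 * gauss_moment TYPE('n) 6)) / sqrt (real N)" .
qed

text \<open>Bounded uniformly in N, so the quartic correction of \<open>tilted_ge\<close> is
  negligible for large M. In H2 one factor n is due to Cauchy-Schwarz and one to the sum over
  coordinates, 3 to \<open>iid_sum_fourth_moment\<close>, and 2 to the density of the folded
  law.\<close>

lemma stat_fourth_moment:
  assumes a: "\<And>i. fisher_eig k x i \<ge> a" "a > 0" and x: "norm x \<le> R" and N: "N > 0"
  defines "H2 \<equiv> real CARD('n)^2 * (3 * (2 * ((8 * (1 + R) / sqrt a)^4 * gauss_moment TYPE('n) 8)))"
  shows "(\<integral>K. (norm (stat k x T N K))^4 \<partial>PiM {..<N} (\<lambda>_. folded_law x)) \<le> H2"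
    and "integrable (PiM {..<N} (\<lambda>_. folded_law x)) (\<lambda>K. (norm (stat k x T N K))^4)"
proof -
  let ?P = "PiM {..<N} (\<lambda>_. folded_law x)"
  let ?n = "real CARD('n)"
  let ?a = "\<lambda>i h. score_vec x h \<bullet> wmap k x T (axis i 1)"
  let ?B = "8 * (1 + R) / sqrt a"
  have R: "R \<ge> 0" using x norm_ge_zero[of x] by linarith
  have am: "?a i \<in> borel_measurable (folded_law x)" for i by simp
  have a4: "\<bar>?a i h\<bar>^4 \<le> ?B^4 * (1 + norm h)^8" for i h
  proof -
    have "\<bar>?a i h\<bar>^4 \<le> (8 * (1 + norm x) * norm (wmap k x T (axis i 1)))^4 * (1 + norm h)^(2 * 4)"
      by (rule abs_score_vec_power_le)
    also have "\<dots> \<le> (8 * (1 + R) * (1 / sqrt a))^4 * (1 + norm h)^(2 * 4)"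
      using x R norm_wmap_axis_le[OF a, of i] by (intro mult_right_mono power_mono mult_mono) auto
    finally show ?thesis by simp
  qed
  have ia: "integrable (folded_law x) (\<lambda>h. \<bar>?a i h\<bar>^4)" and ma: "(\<integral>h. (?a i h)^4 \<partial>folded_law x) \<le> 2 * (?B^4 * gauss_moment TYPE('n) 8)" for i
    using integral_folded_law_poly_le[of "\<lambda>h. \<bar>?a i h\<bar>^4", OF _ _ a4] by simp_all
  let ?s = "\<lambda>i K. (\<Sum>l<N. ?a i (K l))^4 / (real N)^2"
  have iss: "integrable ?P (?s i)" for i
    by (intro integrable_divide folded_law.integrable_iid_sum_power[OF am ia])
  have ms: "(\<integral>K. ?s i K \<partial>?P) \<le> 3 * (2 * (?B^4 * gauss_moment TYPE('n) 8))" for i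
  proof -
    have "(\<integral>K. (\<Sum>l<N. ?a i (K l))^4 \<partial>?P) \<le> 3 * (real N)^2 * (\<integral>h. (?a i h)^4 \<partial>folded_law x)"
      by (rule folded_law.iid_sum_fourth_moment[OF am ia folded_law_score_vec_mean])
    also have "\<dots> \<le> 3 * (real N)^2 * (2 * (?B^4 * gauss_moment TYPE('n) 8))" by (intro mult_left_mono ma) simp
    finally have "(\<integral>K. (\<Sum>l<N. ?a i (K l))^4 \<partial>?P) / (real N)^2 \<le> 3 * (real N)^2 * (2 * (?B^4 * gauss_moment TYPE('n) 8)) / (real N)^2"
      by (rule divide_right_mono) simp
    then show ?thesis using N by simp
  qed
  have le: "(norm (stat k x T N K))^4 \<le> ?n * (\<Sum>i\<in>UNIV. ?s i K)" for K
  proof -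
    let ?t = "\<lambda>i. (stat k x T N K $ i)^2"
    have "(norm (stat k x T N K))^2 = (\<Sum>i\<in>UNIV. ?t i)" by (simp add: norm_vec_def L2_set_def sum_nonneg)
    then have "(norm (stat k x T N K))^4 = (\<Sum>i\<in>UNIV. ?t i)^2" by (simp add: power2_eq_square eval_nat_numeral)
    also have "\<dots> \<le> (\<Sum>i\<in>UNIV. (?t i)^2) * ?n" by (rule sum_squared_le_sum_of_squares)
    also have "(\<Sum>i\<in>UNIV. (?t i)^2) = (\<Sum>i\<in>UNIV. ?s i K)"
    proof (intro sum.cong refl)
      fix i
      have "(sqrt (real N))^4 = (real N)^2" by (simp add: eval_nat_numeral)
      then show "(?t i)^2 = ?s i K" by (simp add: stat_def[OF frame] power_divide flip: power_mult)
    qed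
    finally show ?thesis by (simp add: mult.commute)
  qed
  have iS: "integrable ?P (\<lambda>K. ?n * (\<Sum>i\<in>UNIV. ?s i K))"
    by (intro integrable_mult_right Bochner_Integration.integrable_sum iss)
  have sm: "(\<lambda>K. (norm (stat k x T N K))^4) \<in> borel_measurable ?P"
  proof -
    have "stat k x T N \<in> borel_measurable (chan_H N)" by (rule stat_measurable[OF frame])
    then have "stat k x T N \<in> borel_measurable ?P" unfolding iid_folded_law_eq_density by simp
    then show ?thesis by measurable
  qed
  show i4: "integrable ?P (\<lambda>K. (norm (stat k x T N K))^4)"
  proof (rule Bochner_Integration.integrable_bound[OF iS sm], rule AE_I2)
    fix K show "norm ((norm (stat k x T N K))^4) \<le> norm (?n * (\<Sum>i\<in>UNIV. ?s i K))"
      unfolding real_norm_def abs_of_nonneg[OF zero_le_power[OF norm_ge_zero]] using le[of K] by linarith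
  qed
  have "(\<integral>K. (norm (stat k x T N K))^4 \<partial>?P) \<le> (\<integral>K. ?n * (\<Sum>i\<in>UNIV. ?s i K) \<partial>?P)"
    by (rule integral_mono[OF i4 iS le])
  also have "\<dots> = ?n * (\<Sum>i\<in>UNIV. (\<integral>K. ?s i K \<partial>?P))"
    by (simp only: integral_mult_right_zero Bochner_Integration.integral_sum iss)
  also have "\<dots> \<le> ?n * (\<Sum>i\<in>(UNIV::'n set). 3 * (2 * (?B^4 * gauss_moment TYPE('n) 8)))"
    by (intro mult_left_mono sum_mono ms) simp
  also have "\<dots> = H2" by (simp add: H2_def power2_eq_square)
  finally show "(\<integral>K. (norm (stat k x T N K))^4 \<partial>?P) \<le> H2" .
qed

end

subsection \<open>Capacity asymptotics\<close>

text \<open>The pointwise bound is averaged under the law at \<open>x\<close>; the mean of half the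
  squared statistic supplies \<open>-n/2\<close>, matching the lower bound.\<close>

lemma KL_jeffreys_le:
  assumes frame: "polar_frame k (x::real^'n::finite) T"
    and snr: "snr > 0" and N: "N > 0" and M: "M > 0"
    and a: "\<And>i. fisher_eig k x i \<ge> a" "a > 0" and x: "norm x \<le> sqrt snr"
    and near: "\<And>v. norm v \<le> M \<Longrightarrow> norm (x + (1 / sqrt (real N)) *\<^sub>R wmap k x T v) \<le> sqrt snr \<and>
       jeffreys_weight CARD('n) (norm (x + (1 / sqrt (real N)) *\<^sub>R wmap k x T v)) \<ge> (1 - \<eta>) * jeffreys_weight CARD('n) (norm x)"
    and \<eta>: "\<eta> < 1" and gp: "gmass TYPE('n) (M / 2) > 0"
  defines "C \<equiv> 1232 * (1 + sqrt snr)^3 / sqrt a ^ 3"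
    and "H1 \<equiv> real CARD('n)^2 * sqrt (2 * ((72 * (1 + sqrt snr)^2 / a + 1)^2 * gauss_moment TYPE('n) 8))"
    and "H2 \<equiv> real CARD('n)^2 * (3 * (2 * ((8 * (1 + sqrt snr) / sqrt a)^4 * gauss_moment TYPE('n) 8)))"
  shows "KL N (jeffreys snr) x - real CARD('n) / 2 * ln (real N) \<le>
      ln (jeffreys_mass CARD('n) (sqrt snr)) - ln (1 - \<eta>) - ln (gmass TYPE('n) (M / 2)) - real CARD('n) / 2
      + (M^2 / 2 * H1 + C * M^3 * (2 * gauss_moment TYPE('n) 6)) / sqrt (real N) + 2 * H2 / M^2"
proof -
  interpret j: peak_input "jeffreys snr :: (real^'n) measure" "sqrt snr" by (rule peak_input_jeffreys[OF snr])
  let ?P = "PiM {..<N} (\<lambda>_. folded_law x)"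
  let ?S = "\<lambda>K. norm (stat k x T N K)"
  define c where "c = real CARD('n) / 2 * ln (real N) + ln (jeffreys_mass CARD('n) (sqrt snr)) - ln (1 - \<eta>) - ln (gmass TYPE('n) (M / 2))"
  let ?U = "\<lambda>K. c + lap_err k x T C M N K + (- 1 / 2) * (?S K)^2 + 2 / M^2 * (?S K)^4"
  have C: "C \<ge> 0" unfolding C_def using snr a(2) by simp
  note le = lap_err_mean[OF frame a x N C less_imp_le[OF M]]
  note s4 = stat_fourth_moment[OF frame a x N]
  note s2 = stat_second_moment[OF frame N]
  have sm: "stat k x T N \<in> borel_measurable (chan_H N)" by (rule stat_measurable[OF frame])
  have m2: "(\<lambda>K. (?S K)^2) \<in> borel_measurable (chan_H N)" using sm by measurable
  have s2': "(\<integral>K. (?S K)^2 \<partial>?P) = real CARD('n)" "integrable ?P (\<lambda>K. (?S K)^2)"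
    using s2 integral_lik_times[OF m2] integrable_lik_times[OF m2] by simp_all
  have pp: "prob_space ?P" by (rule prob_space_PiM) (rule folded_law.prob_space_axioms)
  interpret P: prob_space ?P by (rule pp)
  have iU: "integrable ?P ?U"
    by (intro Bochner_Integration.integrable_add integrable_mult_right le(2) s2'(2) s4(2)) simp
  have "(\<integral>K. ?U K \<partial>?P) = c + (\<integral>K. lap_err k x T C M N K \<partial>?P) - real CARD('n) / 2 + 2 / M^2 * (\<integral>K. (?S K)^4 \<partial>?P)"
    using le(2) s2' s4(2) P.prob_space by (simp add: Bochner_Integration.integral_add)
  also have "\<dots> \<le> c + (M^2 / 2 * H1 + C * M^3 * (2 * gauss_moment TYPE('n) 6)) / sqrt (real N) - real CARD('n) / 2 + 2 / M^2 * H2"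
    unfolding H1_def H2_def by (intro add_mono diff_mono mult_left_mono le(1) s4(1)) auto
  finally have iUle: "(\<integral>K. ?U K \<partial>?P) \<le> c + (M^2 / 2 * H1 + C * M^3 * (2 * gauss_moment TYPE('n) 6)) / sqrt (real N) - real CARD('n) / 2 + 2 / M^2 * H2" .
  have Um: "?U \<in> borel_measurable (chan_H N)"
    using borel_measurable_integrable[OF iU] unfolding iid_folded_law_eq_density by simp
  have "KL N (jeffreys snr) x \<le> (\<integral>K. lik N x K * ?U K \<partial>chan_H N)"
    unfolding KL_def
  proof (rule integral_mono)
    show "integrable (chan_H N) (\<lambda>K. lik N x K * ln (lik N x K / mix N (jeffreys snr) K))"
      by (rule j.integrable_kl_integrand[OF x])
    show "integrable (chan_H N) (\<lambda>K. lik N x K * ?U K)"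
      unfolding integrable_lik_times[OF Um] by (rule iU)
    fix K
    have "ln (lik N x K / mix N (jeffreys snr) K) = - ln (mix N (jeffreys snr) K / lik N x K)"
      by (simp add: ln_div)
    also have "\<dots> \<le> ?U K"
      using mix_jeffreys_ge[OF frame snr N M a x near \<eta> gp, of K] unfolding c_def C_def by (simp add: field_simps)
    finally show "lik N x K * ln (lik N x K / mix N (jeffreys snr) K) \<le> lik N x K * ?U K"
      by (rule mult_left_mono) simp
  qed
  also have "\<dots> = (\<integral>K. ?U K \<partial>?P)" by (rule integral_lik_times[OF Um])
  finally show ?thesis using iUle unfolding c_def by simp
qed

lemma KL_jeffreys_uniformly_le:
  assumes snr: "snr > 0" and R: "R < sqrt snr" and e: "e > 0"
  shows "eventually (\<lambda>N. \<forall>x::real^'n::finite. norm x \<le> R \<longrightarrow>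
     KL N (jeffreys snr) x - real CARD('n) / 2 * ln (real N) \<le> cap_const CARD('n) (sqrt snr) + e) sequentially"
proof -
  let ?\<rho> = "sqrt snr"
  obtain k :: 'n where True by simp
  have \<rho>: "?\<rho> \<ge> 0" using snr by simp
  obtain a where a: "a > 0" "\<And>(k::'n) x i. norm x \<le> ?\<rho> \<Longrightarrow> a \<le> fisher_eig k x i"
    using fisher_eig_bounds[OF \<rho>, where 'n = 'n] by blast
  obtain l where l: "l > 0" "\<And>r. 0 \<le> r \<Longrightarrow> r \<le> ?\<rho> \<Longrightarrow> l \<le> jeffreys_weight CARD('n) r"
    using jeffreys_weight_bounds[OF \<rho>, of "CARD('n)"] by blast
  \<comment> \<open>The tolerance e is split into quarters for the variation of the prior density,
    the truncated Gaussian mass, the quartic correction and the expansion error.\<close>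
  define \<theta> where "\<theta> = exp (- (e / 4))"
  have \<theta>: "\<theta> > 0" "\<theta> < 1" "ln \<theta> = - (e / 4)" using e by (simp_all add: \<theta>_def)
  define H1 where "H1 = real CARD('n)^2 * sqrt (2 * ((72 * (1 + sqrt snr)^2 / a + 1)^2 * gauss_moment TYPE('n) 8))"
  define H2 where "H2 = real CARD('n)^2 * (3 * (2 * ((8 * (1 + sqrt snr) / sqrt a)^4 * gauss_moment TYPE('n) 8)))"
  define C where "C = 1232 * (1 + sqrt snr)^3 / sqrt a ^ 3"
  have "eventually (\<lambda>m::nat. m > 0 \<and> gmass TYPE('n) (real m) > 0 \<and> ln (gmass TYPE('n) (real m)) > real CARD('n) / 2 * ln (2 * pi) - e / 4
      \<and> H2 / (2 * (real m)^2) < e / 4) sequentially"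
  proof (intro eventually_conj)
    show "eventually (\<lambda>m::nat. m > 0) sequentially" by (rule eventually_gt_at_top)
    show "eventually (\<lambda>m. gmass TYPE('n) (real m) > 0) sequentially"
      by (rule order_tendstoD(1)[OF gmass_tendsto]) simp
    have "(\<lambda>m::nat. ln (gmass TYPE('n) (real m))) \<longlonglongrightarrow> ln ((2 * pi) powr (real CARD('n) / 2))"
      by (rule tendsto_ln[OF gmass_tendsto]) simp
    then show "eventually (\<lambda>m. ln (gmass TYPE('n) (real m)) > real CARD('n) / 2 * ln (2 * pi) - e / 4) sequentially"
      by (rule order_tendstoD(1)) (use e in \<open>simp add: ln_powr\<close>)
    have "(\<lambda>m::nat. H2 / (2 * (real m)^2)) \<longlonglongrightarrow> 0" by real_asymp
    then show "eventually (\<lambda>m. H2 / (2 * (real m)^2) < e / 4) sequentially"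
      by (rule order_tendstoD(2)) (use e in simp)
  qed
  then obtain m :: nat where m: "m > 0" "gmass TYPE('n) (real m) > 0" "ln (gmass TYPE('n) (real m)) > real CARD('n) / 2 * ln (2 * pi) - e / 4"
    "H2 / (2 * (real m)^2) < e / 4"
    by (auto simp: eventually_sequentially)
  \<comment> \<open>M is fixed before N grows, because the expansion error is small only for fixed
    M. Doubling makes \<open>M / 2\<close> equal to m and \<open>2 * H2 / M^2\<close> equal to the
    controlled quantity.\<close>
  define M where "M = 2 * real m"
  have M: "M > 0" "M / 2 = real m" using m(1) by (simp_all add: M_def)
  have "uniformly_continuous_on {0..?\<rho>} (jeffreys_weight CARD('n))"
    by (intro compact_uniformly_continuous continuous_on_jeffreys_weight) simp
  \<comment> \<open>The positive lower bound l of the weight converts the additive modulus of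
    continuity into the multiplicative estimate required by \<open>KL_jeffreys_le\<close>.\<close>
  moreover have "(1 - \<theta>) * l > 0" using \<theta> l(1) by simp
  ultimately obtain \<delta> where \<delta>: "\<delta> > 0" "\<And>r r'. r \<in> {0..?\<rho>} \<Longrightarrow> r' \<in> {0..?\<rho>} \<Longrightarrow> dist r' r < \<delta> \<Longrightarrow>
      dist (jeffreys_weight CARD('n) r') (jeffreys_weight CARD('n) r) < (1 - \<theta>) * l"
    unfolding uniformly_continuous_on_def by metis
  define A where "A = M^2 / 2 * H1 + C * M^3 * (2 * gauss_moment TYPE('n) 6)"
  have ev: "eventually (\<lambda>N. N > 0 \<and> A / sqrt (real N) < e / 4 \<and> M / sqrt a / sqrt (real N) < min (?\<rho> - R) \<delta>) sequentially"
  proof (intro eventually_conj)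
    show "eventually (\<lambda>N::nat. N > 0) sequentially" by (rule eventually_gt_at_top)
    have z: "(\<lambda>N::nat. c / sqrt (real N)) \<longlonglongrightarrow> 0" for c :: real by real_asymp
    show "eventually (\<lambda>N. A / sqrt (real N) < e / 4) sequentially"
      by (rule order_tendstoD(2)[OF z]) (use e in simp)
    show "eventually (\<lambda>N. M / sqrt a / sqrt (real N) < min (?\<rho> - R) \<delta>) sequentially"
      by (rule order_tendstoD(2)[OF z]) (use R \<delta>(1) in simp)
  qed
  then show ?thesis
  proof eventually_elim
    case (elim N)
    show ?case
    proof (intro allI impI)
      fix x :: "real^'n" assume x: "norm x \<le> R"
      then have x\<rho>: "norm x \<le> ?\<rho>" using R by linarith
      obtain T where fr: "polar_frame k x T" using polar_frame_exists by blast
      have fdx: "fisher_eig k x i \<ge> a" for i by (rule a(2)[OF x\<rho>])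
      have near: "norm (x + (1 / sqrt (real N)) *\<^sub>R wmap k x T v) \<le> ?\<rho> \<and>
         jeffreys_weight CARD('n) (norm (x + (1 / sqrt (real N)) *\<^sub>R wmap k x T v)) \<ge> (1 - (1 - \<theta>)) * jeffreys_weight CARD('n) (norm x)"
        if v: "norm v \<le> M" for v
      proof -
        define d where "d = (1 / sqrt (real N)) *\<^sub>R wmap k x T v"
        have "norm (wmap k x T v) \<le> M / sqrt a"
        proof -
          have "(norm (wmap k x T v))^2 \<le> (norm v)^2 / a" by (rule norm_wmap_le[OF fr fdx a(1)])
          also have "\<dots> \<le> M^2 / a" using v a(1) by (intro divide_right_mono power_mono) auto
          also have "\<dots> = (M / sqrt a)^2" using a(1) by (simp add: power_divide)
          finally show ?thesis by (rule power2_le_imp_le) (use M a(1) in auto)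
        qed
        then have "norm (wmap k x T v) / sqrt (real N) \<le> M / sqrt a / sqrt (real N)" by (rule divide_right_mono) simp
        then have "norm d \<le> M / sqrt a / sqrt (real N)" unfolding d_def by simp
        with elim have d: "norm d < ?\<rho> - R" "norm d < \<delta>" by simp_all
        have xd: "norm (x + d) \<le> ?\<rho>" using norm_triangle_ineq[of x d] x d(1) by linarith
        have "dist (norm (x + d)) (norm x) < \<delta>"
          using norm_triangle_ineq3[of "x + d" x] d(2) by (simp add: dist_real_def)
        then have "dist (jeffreys_weight CARD('n) (norm (x + d))) (jeffreys_weight CARD('n) (norm x)) < (1 - \<theta>) * l"
          by (intro \<delta>(2)) (use xd x\<rho> in auto)
        moreover have "(1 - \<theta>) * l \<le> (1 - \<theta>) * jeffreys_weight CARD('n) (norm x)"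
          using \<theta>(2) l(2)[OF norm_ge_zero x\<rho>] by (intro mult_left_mono) auto
        ultimately have "jeffreys_weight CARD('n) (norm (x + d)) \<ge> jeffreys_weight CARD('n) (norm x) - (1 - \<theta>) * jeffreys_weight CARD('n) (norm x)"
          unfolding dist_real_def by linarith
        then show ?thesis using xd unfolding d_def by (simp add: algebra_simps)
      qed
      have gp: "gmass TYPE('n) (M / 2) > 0" unfolding M(2) by (rule m(2))
      have "KL N (jeffreys snr) x - real CARD('n) / 2 * ln (real N) \<le>
        ln (jeffreys_mass CARD('n) (sqrt snr)) - ln (1 - (1 - \<theta>)) - ln (gmass TYPE('n) (M / 2)) - real CARD('n) / 2
        + A / sqrt (real N) + 2 * H2 / M^2"
        unfolding A_def H1_def H2_def C_def
        by (rule KL_jeffreys_le[OF fr snr _ M(1) fdx a(1) x\<rho> near _ gp]) (use elim \<theta> in auto)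
      also have "\<dots> \<le> ln (jeffreys_mass CARD('n) (sqrt snr)) + e / 4 - (real CARD('n) / 2 * ln (2 * pi) - e / 4) - real CARD('n) / 2 + e / 4 + e / 4"
      proof -
        have "2 * H2 / M^2 = H2 / (2 * (real m)^2)" using m(1) by (simp add: M_def power2_eq_square)
        then have "2 * H2 / M^2 < e / 4" using m(4) by simp
        moreover have "ln (1 - (1 - \<theta>)) = - (e / 4)" using \<theta>(3) by simp
        ultimately show ?thesis using elim m(3) unfolding M(2) by linarith
      qed
      also have "\<dots> = cap_const CARD('n) (sqrt snr) + e"
        unfolding cap_const_def by (subst ln_mult) (simp_all add: algebra_simps)
      finally show "KL N (jeffreys snr) x - real CARD('n) / 2 * ln (real N) \<le> cap_const CARD('n) (sqrt snr) + e" .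
    qed
  qed
qed

lemma mutual_info_uniformly_le:
  assumes snr: "0 \<le> snr" "snr < snr'" and e: "e > 0"
  shows "eventually (\<lambda>N. \<forall>mu \<in> (input_dists snr :: (real^'n::finite) measure set).
     mutual_info N mu * ln 2 - real CARD('n) / 2 * ln (real N) \<le> cap_const CARD('n) (sqrt snr') + e) sequentially"
proof -
  have snr': "snr' > 0" and R: "sqrt snr < sqrt snr'" using snr by simp_all
  show ?thesis
    using KL_jeffreys_uniformly_le[OF snr' R e, where 'n = 'n]
  proof eventually_elim
    case (elim N)
    show ?case
    proof
      fix mu :: "(real^'n) measure" assume "mu \<in> input_dists snr"
      then interpret peak_input mu "sqrt snr" by (rule peak_inputI)
      note pj = peak_input_jeffreys[OF snr', where 'n = 'n] less_imp_le[OF R]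
      have iK: "integrable mu (KL N (jeffreys snr'))" by (rule integrable_KL[OF pj])
      have "(\<integral>x. KL N (jeffreys snr') x \<partial>mu) \<le> (\<integral>x. real CARD('n) / 2 * ln (real N) + (cap_const CARD('n) (sqrt snr') + e) \<partial>mu)"
      proof (rule integral_mono_AE[OF iK])
        show "AE x in mu. KL N (jeffreys snr') x \<le> real CARD('n) / 2 * ln (real N) + (cap_const CARD('n) (sqrt snr') + e)"
          using AE_norm by eventually_elim (use elim in \<open>simp add: algebra_simps\<close>)
      qed simp
      moreover have "mutual_info N mu * ln 2 \<le> (\<integral>x. KL N (jeffreys snr') x \<partial>mu)"
        using mutual_info_le_KL[OF pj, of N] by (simp add: field_simps)
      ultimately show "mutual_info N mu * ln 2 - real CARD('n) / 2 * ln (real N) \<le> cap_const CARD('n) (sqrt snr') + e"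
        by simp
    qed
  qed
qed

lemma jeffreys_mass_continuous_on: "continuous_on {0..b} (jeffreys_mass n)"
proof -
  let ?f = "\<lambda>r. jeffreys_weight n r * real n * r ^ (n - 1)"
  have c: "continuous_on A ?f" for A by (intro continuous_intros continuous_on_jeffreys_weight)
  have e: "jeffreys_mass n R = vol_ball n * integral {0..R} ?f" for R
    unfolding jeffreys_mass_def using set_borel_integral_eq_integral(2)[OF set_integrable_jeffreys_weight_radial[of R n]] by simp
  have "continuous_on {0..b} (\<lambda>R. integral {0..R} ?f)"
    by (intro indefinite_integral_continuous_1 integrable_continuous_interval c)
  then show ?thesis unfolding e[abs_def] by (intro continuous_intros)
qed

text \<open>Letting the radius of the comparison ball shrink to the original one costs nothing, as
  the mass is a continuous function of the radius.\<close>

lemma cap_const_near: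
  assumes snr: "snr > 0" and n: "n > 0" and e: "e > 0"
  shows "\<exists>snr'>snr. cap_const n (sqrt snr') \<le> cap_const n (sqrt snr) + e"
proof -
  have "continuous_on {snr..snr + 1} (\<lambda>s. cap_const n (sqrt s))"
    unfolding cap_const_def
  proof (intro continuous_intros continuous_on_compose2[OF jeffreys_mass_continuous_on[of "sqrt (snr + 1)" n]])
    show "\<forall>s\<in>{snr..snr + 1}. jeffreys_mass n (sqrt s) \<noteq> 0"
    proof
      fix s assume "s \<in> {snr..snr + 1}"
      then have "jeffreys_mass n (sqrt s) > 0" using snr n by (intro jeffreys_mass_pos) auto
      then show "jeffreys_mass n (sqrt s) \<noteq> 0" by simp
    qed
  qed (use snr in auto)
  then obtain d where d: "d > 0" "\<And>s. s \<in> {snr..snr + 1} \<Longrightarrow> dist s snr < d \<Longrightarrow> dist (cap_const n (sqrt s)) (cap_const n (sqrt snr)) < e"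
    unfolding continuous_on_iff using e by (metis add_increasing2 atLeastAtMost_iff order_refl zero_le_one)
  define s where "s = snr + min 1 (d / 2)"
  have "dist (cap_const n (sqrt s)) (cap_const n (sqrt snr)) < e"
    by (rule d(2)) (use d(1) in \<open>auto simp: s_def dist_real_def\<close>)
  then have "cap_const n (sqrt s) \<le> cap_const n (sqrt snr) + e" by (simp add: dist_real_def)
  then show ?thesis using d(1) by (intro exI[of _ s]) (simp add: s_def)
qed

lemma capacity_asymptotics:
  assumes snr: "snr > 0" and e: "e > 0"
  shows "eventually (\<lambda>N.
      mutual_info N (jeffreys snr :: (real^'n::finite) measure) \<le> capacity TYPE('n) N snr
    \<and> cap_const CARD('n) (sqrt snr) - e \<le> mutual_info N (jeffreys snr :: (real^'n) measure) * ln 2 - real CARD('n) / 2 * ln (real N)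
    \<and> capacity TYPE('n) N snr * ln 2 - real CARD('n) / 2 * ln (real N) \<le> cap_const CARD('n) (sqrt snr) + e) sequentially"
proof -
  obtain snr' where s: "snr' > snr" "cap_const CARD('n) (sqrt snr') \<le> cap_const CARD('n) (sqrt snr) + e / 2"
    using cap_const_near[OF snr, of "CARD('n)" "e / 2"] e by auto
  have s0: "0 \<le> snr" "e / 2 > 0" using snr e by simp_all
  show ?thesis
    using mutual_info_uniformly_le[OF s0(1) s(1) s0(2), where 'n = 'n] mutual_info_jeffreys_ge[OF snr e, where 'n = 'n]
  proof eventually_elim
    case (elim N)
    let ?b = "(real CARD('n) / 2 * ln (real N) + cap_const CARD('n) (sqrt snr) + e) / ln 2"
    \<comment> \<open>Besides bounding the capacity, the common bound makes the set of mutual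
      informations bounded above, without which the real supremum carries no information.\<close>
    have b: "mutual_info N mu \<le> ?b" if "mu \<in> (input_dists snr :: (real^'n) measure set)" for mu
    proof -
      have "mutual_info N mu * ln 2 \<le> real CARD('n) / 2 * ln (real N) + cap_const CARD('n) (sqrt snr) + e"
        using bspec[OF elim(1) that] s(2) by linarith
      then show ?thesis by (simp add: pos_le_divide_eq)
    qed
    have j: "jeffreys snr \<in> (input_dists snr :: (real^'n) measure set)" by (rule jeffreys_in_input_dists[OF snr])
    have "capacity TYPE('n) N snr \<le> ?b"
      unfolding capacity_def by (rule cSUP_least) (use j b in auto)
    moreover have "mutual_info N (jeffreys snr :: (real^'n) measure) \<le> capacity TYPE('n) N snr"
      unfolding capacity_def by (rule cSUP_upper[OF j]) (use b in \<open>auto simp: bdd_above_def\<close>)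
    ultimately show ?case using elim(2) by (simp add: pos_le_divide_eq)
  qed
qed

lemma cap_const_bits:
  assumes "snr > 0" "n > 0" "N > 0"
  shows "(real n / 2 * log 2 (real N / (2 * pi * exp 1)) + log 2 (vol_ball n) + log 2 (alpha snr n)) * ln 2
    = real n / 2 * ln (real N) + cap_const n (sqrt snr)"
proof -
  have jc: "jeffreys_mass n (sqrt snr) > 0" using assms by (intro jeffreys_mass_pos) auto
  have v: "vol_ball n > 0" unfolding vol_ball_def by (simp add: Gamma_real_pos)
  with jc have al: "alpha snr n > 0" unfolding alpha_eq_jeffreys_mass[symmetric] by (simp add: zero_less_mult_iff)
  have "ln (jeffreys_mass n (sqrt snr)) = ln (alpha snr n) + ln (vol_ball n)"
    unfolding alpha_eq_jeffreys_mass[symmetric] using v al by (simp add: ln_mult)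
  moreover have "ln (real N / (2 * pi * exp 1)) = ln (real N) - ln (2 * pi * exp 1)"
    using assms by (simp add: ln_div)
  moreover have "(real n / 2 * log 2 (real N / (2 * pi * exp 1)) + log 2 (vol_ball n) + log 2 (alpha snr n)) * ln 2
      = real n / 2 * ln (real N / (2 * pi * exp 1)) + ln (vol_ball n) + ln (alpha snr n)"
    unfolding log_def by (simp add: distrib_right)
  ultimately show ?thesis unfolding cap_const_def by (simp only: right_diff_distrib)
qed

theorem theorem1:
  fixes snr :: real
  assumes "snr > 0"
  shows "((\<lambda>nr. capacity TYPE('n::finite) nr snr
            - (real CARD('n) / 2 * log 2 (real nr / (2 * pi * exp 1))
               + log 2 (vol_ball CARD('n)) + log 2 (alpha snr CARD('n)))) \<longlongrightarrow> 0) sequentially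
       \<and> ((\<lambda>nr. capacity TYPE('n) nr snr - mutual_info nr (jeffreys snr :: (real^'n) measure))
            \<longlongrightarrow> 0) sequentially
       \<and> (\<forall>f :: real^'n \<Rightarrow> real^'n. orthogonal_transformation f \<longrightarrow>
            (\<forall>x::real^'n. jeffreys_density snr (f x) = jeffreys_density snr x))
       \<and> distr (jeffreys snr :: (real^'n) measure) borel norm
           = density lborel (\<lambda>r. ennreal (mag_density snr CARD('n) r))"
proof (intro conjI allI impI)
  let ?F = "\<lambda>nr. real CARD('n) / 2 * log 2 (real nr / (2 * pi * exp 1)) + log 2 (vol_ball CARD('n)) + log 2 (alpha snr CARD('n))"
  have scale: "\<bar>t * ln 2\<bar> \<le> e / 2 * ln 2 \<Longrightarrow> e > 0 \<Longrightarrow> \<bar>t\<bar> < e" for t e :: real by (simp add: abs_mult)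
  show "((\<lambda>nr. capacity TYPE('n) nr snr - ?F nr) \<longlongrightarrow> 0) sequentially"
  proof (rule tendstoI)
    fix e :: real assume e: "e > 0"
    have e2: "e / 2 * ln 2 > 0" using e by simp
    show "eventually (\<lambda>nr. dist (capacity TYPE('n) nr snr - ?F nr) 0 < e) sequentially"
      using capacity_asymptotics[OF assms e2, where 'n = 'n] eventually_gt_at_top[of 0]
    proof eventually_elim
      case (elim N)
      have "mutual_info N (jeffreys snr :: (real^'n) measure) * ln 2 \<le> capacity TYPE('n) N snr * ln 2"
        using elim by simp
      moreover have "?F N * ln 2 = real CARD('n) / 2 * ln (real N) + cap_const CARD('n) (sqrt snr)"
        using elim by (intro cap_const_bits assms) auto
      ultimately have "\<bar>(capacity TYPE('n) N snr - ?F N) * ln 2\<bar> \<le> e / 2 * ln 2"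
        unfolding left_diff_distrib using elim by linarith
      then show ?case unfolding dist_real_def using scale e by simp
    qed
  qed
  show "((\<lambda>nr. capacity TYPE('n) nr snr - mutual_info nr (jeffreys snr :: (real^'n) measure)) \<longlongrightarrow> 0) sequentially"
  proof (rule tendstoI)
    fix e :: real assume e: "e > 0"
    \<comment> \<open>Mutual information and capacity both lie within \<open>e / 4 * ln 2\<close> of
      the same quantity, hence within \<open>e / 2 * ln 2\<close> of each other.\<close>
    have e4: "e / 4 * ln 2 > 0" using e by simp
    show "eventually (\<lambda>nr. dist (capacity TYPE('n) nr snr - mutual_info nr (jeffreys snr :: (real^'n) measure)) 0 < e) sequentially"
      using capacity_asymptotics[OF assms e4, where 'n = 'n]
    proof eventually_elim
      case (elim N)
      have "mutual_info N (jeffreys snr :: (real^'n) measure) * ln 2 \<le> capacity TYPE('n) N snr * ln 2"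
        using elim by simp
      then have "\<bar>(capacity TYPE('n) N snr - mutual_info N (jeffreys snr :: (real^'n) measure)) * ln 2\<bar> \<le> e / 2 * ln 2"
        unfolding left_diff_distrib using elim by linarith
      then show ?case unfolding dist_real_def using scale e by simp
    qed
  qed
  show "jeffreys_density snr (f x) = jeffreys_density snr x" if "orthogonal_transformation f" for f :: "real^'n \<Rightarrow> real^'n" and x
    by (rule jeffreys_density_orthogonal[OF that])
  show "distr (jeffreys snr :: (real^'n) measure) borel norm = density lborel (\<lambda>r. ennreal (mag_density snr CARD('n) r))"
    by (rule jeffreys_distr_norm[OF assms])
qed

end
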